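(* Let $C$ be a tropical hypersurface in $\mathbb{R}^d$, and let $(G,p)$ be a reciprocal diagram of $C$. Then the following properties are equivalent. (1) $C$ is extremal. (2) $(G,p)$ is direction rigid, i.e., if $(G,q)$ is a framework in $\mathbb{R}^d$ where each edge of $(G,q)$ is parallel to its corresponding edge in $(G,p)$, then $(G,q)$ is a scaled and translated copy of $(G,p)$.
   Context: Tropical varieties. Polyhedral complexes are finite and nonempty; their cells are convex polyhedra, possibly unbounded. Let $C \subset \mathbb{R}^d$ be a polyhedral complex of dimension $k$ (identified with its underlying set). $\widetilde{E}$ is the set of its $k$-dimensional cells (maximal faces) and $\widetilde{V}$ the set of its $(k-1)$-dimensional cells (ridges). $C$ is always assumed pure (every cell of dimension less than $k$ is a face of a $k$-dimensional cell) and rational: for each cell $\rho \in \widetilde{E}\cup\widetilde{V}$, with $L_\rho$ the linear space parallel to $\rho$, the lattice $L_\rho \cap \mathbb{Z}^d$ has rank $\dim \rho$. For $\tau \in \widetilde{V}$, $\sigma \in \widetilde{E}$ with $\tau \subset \sigma$, fix $z_\tau(\sigma) \in L_\sigma \cap \mathbb{Z}^d$ such that $L_\sigma \cap \mathbb{Z}^d = (L_\tau \cap \mathbb{Z}^d) + \mathbb{Z} z_\tau(\sigma)$ and $x + \lambda z_\tau(\sigma) \in \sigma$ for some $x \in \tau$, $\lambda > 0$ (it is unique modulo $L_\tau \cap \mathbb{Z}^d$). A weighting is a map $\omega: \widetilde{E} \to \mathbb{Z}_{>0}$; it is balanced if for every $\tau \in \widetilde{V}$, $\sum_{\sigma \supset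 \tau} \omega(\sigma) z_\tau(\sigma) \in L_\tau$ (sum over $\sigma \in \widetilde{E}$ having $\tau$ as a face). $C$ is a tropical variety of dimension $k$ if it has a balanced weighting. A tropical variety $C$ is extremal if it cannot be written as $C = C_1 \cup C_2$ with $C_1, C_2$ tropical varieties in $\mathbb{R}^d$ that are both proper subsets of $C$. Tropical hypersurfaces. A tropical hypersurface in $\mathbb{R}^d$ is a tropical variety of dimension $d-1$. Let $V$ be the (finite) set of closures of the connected components of $\mathbb{R}^d \setminus C$; these are convex polyhedra (regions). $C$ carries the polyhedral structure for which the maximal faces are exactly the $(d-1)$-dimensional intersections $v \cap w$ of distinct $v,w \in V$. The dual graph of $C$ is the finite simple graph $G=(V,E)$ with $vw \in E$ if and only if $v \cap w \in \widetilde{E}$; this gives a bijection between $E$ and $\widetilde{E}$. For $\sigma = v \cap w \in \widetilde{E}$, $x_\sigma(v,w) \in \mathbb{Z}^d$ is the shortest nonzero integer vector perpendicular to $L_\sigma$ oriented in the direction travelled when crossing $\sigma$ from $w$ to $v$. Frameworks. A framework in $\mathbb{R}^d$ is a pair $(G,p)$ with $G=(V,E)$ a finite simple graph and $p: V \to \mathbb{R}^d$. A framework $(G,p)$ on the dual graph $G$ of $C$ is a reciprocal diagram of $C$ if for every edge $vw\in E$, with $\sigma=v\cap w$, $p(v)-p(w)$ is a positive rational multiple of $x_\sigma(v,w)$. "Each edge of $(G,q)$ is parallel to its corresponding edge in $(G,p)$" means: for each $uv \in E$ there is $\lambda_{uv} \in \mathbb{R}$ with $q(u)-q(v) = \lambda_{uv}(p(u)-p(v))$.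 "Scaled and translated copy" means: there are $z \in \mathbb{R}^d$ and $\lambda \in \mathbb{R}$ with $q(v) = \lambda p(v) + z$ for all $v \in V$. *)

theory Defs
  imports "HOL-Analysis.Analysis"
begin

definition integer_points :: "(real ^ 'n) set" where
  "integer_points = {x. \<forall>i. x $ i \<in> \<int>}"

definition parallel_space :: "(real ^ 'n) set \<Rightarrow> (real ^ 'n) set" where
  "parallel_space \<rho> = span {x - y |x y. x \<in> \<rho> \<and> y \<in> \<rho>}"

definition cell_lattice :: "(real ^ 'n) set \<Rightarrow> (real ^ 'n) set" where
  "cell_lattice \<rho> = parallel_space \<rho> \<inter> integer_points"

text \<open>Cells are nonempty. In the library the empty set is a polyhedron, a face of every convex set,
  and of affine dimension \<open>-1\<close>; allowing it as a cell would make it a spurious ridge of a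
  0-dimensional complex.\<close>

definition polyhedral_complex :: "(real ^ 'n) set set \<Rightarrow> bool" where
  "polyhedral_complex K \<longleftrightarrow>
     finite K \<and> K \<noteq> {} \<and>
     (\<forall>c\<in>K. polyhedron c \<and> c \<noteq> {}) \<and>
     (\<forall>c\<in>K. \<forall>f. f face_of c \<and> f \<noteq> {} \<longrightarrow> f \<in> K) \<and>
     (\<forall>c\<in>K. \<forall>c'\<in>K. c \<inter> c' face_of c \<and> c \<inter> c' face_of c')"

definition has_complex_dim :: "(real ^ 'n) set set \<Rightarrow> nat \<Rightarrow> bool" where
  "has_complex_dim K k \<longleftrightarrow>
     (\<exists>c\<in>K. aff_dim c = int k) \<and> (\<forall>c\<in>K. aff_dim c \<le> int k)"

definition max_cells :: "nat \<Rightarrow> (real ^ 'n) set set \<Rightarrow> (real ^ 'n) set set" where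
  "max_cells k K = {\<sigma> \<in> K. aff_dim \<sigma> = int k}"

definition ridges :: "nat \<Rightarrow> (real ^ 'n) set set \<Rightarrow> (real ^ 'n) set set" where
  "ridges k K = {\<tau> \<in> K. aff_dim \<tau> = int k - 1}"

definition pure_complex :: "nat \<Rightarrow> (real ^ 'n) set set \<Rightarrow> bool" where
  "pure_complex k K \<longleftrightarrow>
     (\<forall>c\<in>K. aff_dim c < int k \<longrightarrow> (\<exists>\<sigma>\<in>max_cells k K. c face_of \<sigma>))"

text \<open>The rank of a lattice in \<open>\<real>\<^sup>d\<close> is the dimension of its real span.\<close>

definition rational_complex :: "nat \<Rightarrow> (real ^ 'n) set set \<Rightarrow> bool" where
  "rational_complex k K \<longleftrightarrow>
     (\<forall>\<rho>\<in>max_cells k K \<union> ridges k K. int (dim (cell_lattice \<rho>)) = aff_dim \<rho>)"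

text \<open>The possible choices \<open>z\<close> of \<open>z\<^sub>\<tau>(\<sigma>)\<close>, which is unique only modulo the lattice of \<open>\<tau>\<close>.\<close>

definition lattice_normal :: "(real ^ 'n) set \<Rightarrow> (real ^ 'n) set \<Rightarrow> real ^ 'n \<Rightarrow> bool" where
  "lattice_normal \<tau> \<sigma> z \<longleftrightarrow>
     z \<in> cell_lattice \<sigma> \<and>
     cell_lattice \<sigma> = {y + of_int m *\<^sub>R z |y (m::int). y \<in> cell_lattice \<tau>} \<and>
     (\<exists>x\<in>\<tau>. \<exists>l>0. x + l *\<^sub>R z \<in> \<sigma>)"

definition balanced_weighting ::
    "nat \<Rightarrow> (real ^ 'n) set set \<Rightarrow> ((real ^ 'n) set \<Rightarrow> nat) \<Rightarrow> bool" where
  "balanced_weighting k K \<omega> \<longleftrightarrow>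
     (\<forall>\<sigma>\<in>max_cells k K. \<omega> \<sigma> > 0) \<and>
     (\<forall>\<tau>\<in>ridges k K. \<exists>z.
        (\<forall>\<sigma>\<in>max_cells k K. \<tau> face_of \<sigma> \<longrightarrow> lattice_normal \<tau> \<sigma> (z \<sigma>)) \<and>
        (\<Sum>\<sigma> | \<sigma> \<in> max_cells k K \<and> \<tau> face_of \<sigma>. real (\<omega> \<sigma>) *\<^sub>R z \<sigma>) \<in> parallel_space \<tau>)"

text \<open>A tropical variety is identified with its underlying set.\<close>

definition tropical_variety :: "nat \<Rightarrow> (real ^ 'n) set \<Rightarrow> bool" where
  "tropical_variety k C \<longleftrightarrow>
     (\<exists>K. polyhedral_complex K \<and> has_complex_dim K k \<and> pure_complex k K \<and>
          rational_complex k K \<and> \<Union>K = C \<and> (\<exists>\<omega>. balanced_weighting k K \<omega>))"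

definition extremal :: "(real ^ 'n) set \<Rightarrow> bool" where
  "extremal C \<longleftrightarrow>
     \<not> (\<exists>C1 C2. (\<exists>k. tropical_variety k C1) \<and> (\<exists>k. tropical_variety k C2) \<and>
                C1 \<subset> C \<and> C2 \<subset> C \<and> C = C1 \<union> C2)"

definition tropical_hypersurface :: "(real ^ 'n) set \<Rightarrow> bool" where
  "tropical_hypersurface C \<longleftrightarrow> tropical_variety (CARD('n) - 1) C"

definition regions :: "(real ^ 'n) set \<Rightarrow> (real ^ 'n) set set" where
  "regions C = closure ` components (- C)"

text \<open>Both the maximal faces of a tropical hypersurface, in its canonical polyhedral structure,
  and the edges of its dual graph are given by the pairs of distinct regions that meet in
  codimension one. Edges are two-element sets of regions.\<close>

definition dual_edges :: "(real ^ 'n) set \<Rightarrow> (real ^ 'n) set set set" where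
  "dual_edges C =
     {{v, w} |v w. v \<in> regions C \<and> w \<in> regions C \<and> v \<noteq> w \<and>
                   aff_dim (v \<inter> w) = int CARD('n) - 1}"

definition perp_integer_points :: "(real ^ 'n) set \<Rightarrow> (real ^ 'n) set" where
  "perp_integer_points \<sigma> =
     {x \<in> integer_points. x \<noteq> 0 \<and> (\<forall>y\<in>parallel_space \<sigma>. x \<bullet> y = 0)}"

text \<open>\<open>x = x\<^sub>\<sigma>(v,w)\<close> for \<open>\<sigma> = v \<inter> w\<close>; the last conjunct says that moving in direction \<open>x\<close>
  through a relative interior point \<open>s\<close> of \<open>\<sigma>\<close> one leaves \<open>w\<close> and enters \<open>v\<close>.\<close>

definition crossing_vector ::
    "(real ^ 'n) set \<Rightarrow> (real ^ 'n) set \<Rightarrow> real ^ 'n \<Rightarrow> bool" where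
  "crossing_vector v w x \<longleftrightarrow>
     x \<in> perp_integer_points (v \<inter> w) \<and>
     (\<forall>y\<in>perp_integer_points (v \<inter> w). norm x \<le> norm y) \<and>
     (\<exists>s\<in>rel_interior (v \<inter> w). \<exists>e>0. \<forall>t. 0 < t \<and> t < e \<longrightarrow>
        s - t *\<^sub>R x \<in> interior w \<and> s + t *\<^sub>R x \<in> interior v)"

definition reciprocal_diagram ::
    "(real ^ 'n) set \<Rightarrow> ((real ^ 'n) set \<Rightarrow> real ^ 'n) \<Rightarrow> bool" where
  "reciprocal_diagram C p \<longleftrightarrow>
     (\<forall>v w. {v, w} \<in> dual_edges C \<longrightarrow>
        (\<exists>x r. crossing_vector v w x \<and> r \<in> \<rat> \<and> r > 0 \<and> p v - p w = r *\<^sub>R x))"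

definition parallel_frameworks ::
    "'a set set \<Rightarrow> ('a \<Rightarrow> real ^ 'n) \<Rightarrow> ('a \<Rightarrow> real ^ 'n) \<Rightarrow> bool" where
  "parallel_frameworks E q p \<longleftrightarrow>
     (\<forall>u v. {u, v} \<in> E \<longrightarrow> (\<exists>l. q u - q v = l *\<^sub>R (p u - p v)))"

definition direction_rigid :: "'a set \<Rightarrow> 'a set set \<Rightarrow> ('a \<Rightarrow> real ^ 'n) \<Rightarrow> bool" where
  "direction_rigid V E p \<longleftrightarrow>
     (\<forall>q. parallel_frameworks E q p \<longrightarrow> (\<exists>z l. \<forall>v\<in>V. q v = l *\<^sub>R p v + z))"

end

theory Submission
  imports Defs
begin

text \<open>
  Let \<open>u\<close> be a direction transversal to all maximal cells of a balanced complex of codimension one.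
  Sending a point to the sum of the weighted primitive normals of the cells met by the ray from it in
  direction \<open>- u\<close> gives a function that is constant on the regions and jumps by the weighted primitive
  normal at each maximal cell: when the ray passes over a ridge, the balancing condition says exactly
  that nothing changes. So balanced weightings and frameworks on the dual graph with edges normal to
  the cells determine each other. Taking \<open>u\<close> to be the difference of two points of one region shows,
  by positivity of the weights, that regions are convex.

  If \<open>C\<close> has a proper tropical subvariety of the same dimension, then its potential, read on the
  regions of \<open>C\<close>, is a framework parallel to the reciprocal diagram that collapses some edge but not
  all of them, so the diagram is not rigid. Conversely, a parallel framework with nonconstant edge
  ratios can be made rational by a \<open>\<rat>\<close>-linear functional \<open>\<real> \<rightarrow> \<rat>\<close>, because the edges of the
  reciprocal diagram are rational. If the ratios then range between \<open>a\<close> and \<open>b\<close>, the cells with ratio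
  above \<open>a\<close> and the cells with ratio below \<open>b\<close> carry balanced weightings, and they decompose \<open>C\<close>.
\<close>

text \<open>The complex carrying \<open>C\<close> is arbitrary: an edge of the dual graph may be
  subdivided into many maximal cells, and the complexes of \<open>C\<close> and of a subvariety need
  not fit together. Edges are therefore studied at generic points, in relative interiors of maximal
  cells, where \<open>C\<close> is locally a hyperplane; it is enough that each cell lies in some
  edge and each edge is witnessed by some cell. Genericity is measured along \<open>u\<close>. Cells
  below the ridges sweep out sets of codimension at least two, which cannot disconnect a region,
  whereas swept ridges are walls. This is why balancing at ridges suffices, and why the potential is
  compared only off the walls. The dual graph is built from closures of components. The jump of the
  potential shows that the two sides of a cell are different components and that a component is the
  interior of its closure. Convexity then bounds the dimension of the intersection of two regions
  and makes the orientation of an edge the same at all its points.\<close>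

lemma open_avoids_lowdim:
  fixes W :: "'a::euclidean_space set"
  assumes "open W" "W \<noteq> {}" "finite F" and F: "\<And>A. A \<in> F \<Longrightarrow> aff_dim A < int DIM('a)"
  obtains w where "w \<in> W" "w \<notin> \<Union>F"
proof -
  have neg: "negligible A" if "A \<in> F" for A
  proof -
    have "interior (affine hull A) = {}"
      using F[OF that] by (intro low_dim_interior) simp
    then have "negligible (affine hull A)"
      by (simp add: negligible_convex_interior affine_imp_convex)
    then show ?thesis
      by (meson hull_subset negligible_subset)
  qed
  then have "negligible (\<Union>F)"
    using \<open>finite F\<close> negligible_Union by blast
  then have "\<not> W \<subseteq> \<Union>F"
    using assms(1,2) negligible_subset open_not_negligible by blast
  then show ?thesis using that by blast
qed

lemma closed_segment_avoids_affine:
  fixes a :: "'a::euclidean_space"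
  assumes "affine A" "a \<notin> A" "c \<notin> affine hull (insert a A)"
  shows "closed_segment a c \<inter> A = {}"
proof (rule ccontr)
  assume "closed_segment a c \<inter> A \<noteq> {}"
  then obtain t where t: "(1 - t) *\<^sub>R a + t *\<^sub>R c \<in> A" (is "?p \<in> A")
    by (auto simp: in_segment)
  have "t \<noteq> 0" using t assms(2) by auto
  let ?H = "affine hull (insert a A)"
  have "a \<in> ?H" "?p \<in> ?H" using t hull_subset[of "insert a A" affine] by auto
  then have "a + (1/t) *\<^sub>R (?p - a) \<in> ?H"
    by (intro mem_affine_3_minus) auto
  moreover have "a + (1/t) *\<^sub>R (?p - a) = c"
    using \<open>t \<noteq> 0\<close> by (simp add: algebra_simps)
  ultimately show False using assms(3) by simp
qed

text \<open>Inside a ball, two points are joined through a third point \<open>c\<close> chosen off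
  the affine hulls of each of them with the members of \<open>F\<close>; these hulls are still null
  because every member has codimension at least two. Connected open sets then follow by patching
  balls together.\<close>

lemma connected_open_minus_affines:
  fixes U :: "'a::euclidean_space set"
  assumes "open U" "connected U" "finite F"
    and F: "\<And>A. A \<in> F \<Longrightarrow> affine A \<and> aff_dim A < int DIM('a) - 1"
  shows "connected (U - \<Union>F)"
proof -
  have ball: "connected_component (ball y e - \<Union>F) a b"
    if ab: "a \<in> ball y e - \<Union>F" "b \<in> ball y e - \<Union>F" for y e a b
  proof -
    let ?G = "(\<lambda>A. affine hull (insert a A)) ` F \<union> (\<lambda>A. affine hull (insert b A)) ` F"
    have dim: "aff_dim (insert x A) < int DIM('a)" if "A \<in> F" for x A
      using F[OF that] by (simp add: aff_dim_insert)
    obtain c where c: "c \<in> ball y e" "c \<notin> \<Union>?G"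
    proof (rule open_avoids_lowdim[of "ball y e" ?G])
      show "ball y e \<noteq> {}" using ab(1) by blast
      show "aff_dim A < int DIM('a)" if "A \<in> ?G" for A using that dim by auto
    qed (use \<open>finite F\<close> in auto)
    have seg: "connected_component (ball y e - \<Union>F) x c"
      if x: "x \<in> ball y e - \<Union>F" "\<And>A. A \<in> F \<Longrightarrow> c \<notin> affine hull (insert x A)" for x
    proof -
      have "closed_segment x c \<subseteq> ball y e"
        using x(1) c(1) by (intro closed_segment_subset) auto
      moreover have "closed_segment x c \<inter> A = {}" if "A \<in> F" for A
        using closed_segment_avoids_affine[of A x c] that x F by blast
      ultimately have "closed_segment x c \<subseteq> ball y e - \<Union>F" by blast
      then show ?thesis
        by (meson connected_component_def connected_segment ends_in_segment)
    qed
    have "connected_component (ball y e - \<Union>F) a c" "connected_component (ball y e - \<Union>F) b c"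
      using seg ab c(2) by auto
    then show ?thesis
      by (meson connected_component_sym connected_component_trans)
  qed
  have "connected_component (U - \<Union>F) a b" if "a \<in> U - \<Union>F" "b \<in> U - \<Union>F" for a b
  proof (rule connected_equivalence_relation_gen[OF \<open>connected U\<close>, where P = "\<lambda>x. x \<notin> \<Union>F"])
    show "\<exists>z. z \<in> T \<and> z \<notin> \<Union>F" if "openin (top_of_set U) T" "x \<in> T" for T x
    proof -
      have "open T" using that(1) \<open>open U\<close> openin_open_eq by blast
      moreover have "T \<noteq> {}" using that(2) by auto
      moreover have "aff_dim A < int DIM('a)" if "A \<in> F" for A using F[OF that] by simp
      ultimately show ?thesis
        using open_avoids_lowdim[of T F] \<open>finite F\<close> by metis
    qed
    show "\<exists>T. openin (top_of_set U) T \<and> x \<in> T \<and>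
        (\<forall>y\<in>T. \<forall>z\<in>T. y \<notin> \<Union>F \<and> z \<notin> \<Union>F \<longrightarrow> connected_component (U - \<Union>F) y z)"
      if "x \<in> U" for x
    proof -
      obtain e where e: "e > 0" "ball x e \<subseteq> U"
        using \<open>open U\<close> \<open>x \<in> U\<close> open_contains_ball by blast
      have "connected_component (U - \<Union>F) y z"
        if "y \<in> ball x e" "z \<in> ball x e" "y \<notin> \<Union>F" "z \<notin> \<Union>F" for y z
      proof -
        have "connected_component (ball x e - \<Union>F) y z"
          using ball[of y x e z] that by blast
        moreover have "ball x e - \<Union>F \<subseteq> U - \<Union>F" using e by blast
        ultimately show ?thesis using connected_component_of_subset by metis
      qed
      moreover have "openin (top_of_set U) (ball x e)"
        using e \<open>open U\<close> openin_open_eq by blast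
      ultimately show ?thesis using e(1) by (intro exI[of _ "ball x e"]) auto
    qed
    show "connected_component (U - \<Union>F) x z"
      if "connected_component (U - \<Union>F) x y" "connected_component (U - \<Union>F) y z" for x y z
      using that connected_component_trans by metis
  qed (use that in auto)
  then show ?thesis
    by (simp add: connected_iff_connected_component)
qed

text \<open>The function is controlled only where \<open>P\<close> holds, but every nonempty open
  set contains such a point, so local values on overlapping neighbourhoods agree. This serves for
  functions that are meaningful only off \<open>C\<close> or off finitely many affine
  spaces.\<close>

lemma locally_constant_imp_constant:
  fixes S :: "'a::topological_space set"
  assumes "connected S" "open S"
    and dense: "\<And>V. open V \<Longrightarrow> V \<noteq> {} \<Longrightarrow> \<exists>z\<in>V. P z"
    and loc: "\<And>x. x \<in> S \<Longrightarrow> \<exists>q. eventually (\<lambda>y. P y \<longrightarrow> f y = q) (nhds x)"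
    and ab: "a \<in> S" "b \<in> S" "P a" "P b"
  shows "f a = f b"
proof (rule connected_equivalence_relation_gen[OF assms(1) ab, where R = "\<lambda>x y. f x = f y"])
  show "\<exists>z. z \<in> V \<and> P z" if "openin (top_of_set S) V" "x \<in> V" for V x
    using dense[of V] that openin_open_eq[OF assms(2)] by blast
  show "\<exists>V. openin (top_of_set S) V \<and> x \<in> V \<and> (\<forall>y\<in>V. \<forall>z\<in>V. P y \<and> P z \<longrightarrow> f y = f z)"
    if x: "x \<in> S" for x
  proof -
    obtain q V where V: "open V" "x \<in> V" "\<forall>y\<in>V. P y \<longrightarrow> f y = q"
      using loc[OF x] unfolding eventually_nhds by blast
    have "\<forall>y\<in>S \<inter> V. \<forall>z\<in>S \<inter> V. P y \<and> P z \<longrightarrow> f y = f z" using V(3) by auto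
    then show ?thesis using V(1,2) x openin_open_Int by blast
  qed
qed simp

lemma eventually_ray:
  fixes y v :: "'a::real_normed_vector"
  assumes "eventually P (nhds y)"
  shows "eventually (\<lambda>t. P (y + t *\<^sub>R v) \<and> P (y - t *\<^sub>R v)) (at_right 0)"
proof -
  have "((\<lambda>t. y + t *\<^sub>R v) \<longlongrightarrow> y + 0 *\<^sub>R v) (at_right 0)" "((\<lambda>t. y - t *\<^sub>R v) \<longlongrightarrow> y - 0 *\<^sub>R v) (at_right 0)"
    by (intro tendsto_intros)+
  then show ?thesis using assms by (intro eventually_conj) (auto elim: eventually_compose_filterlim)
qed

lemma eventually_at_right_0_ex:
  assumes "eventually P (at_right (0::real))" obtains t where "t > 0" "P t"
  using eventually_happens'[OF trivial_limit_at_right_real eventually_conj[OF eventually_at_right_less assms]]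
  by blast

text \<open>The affine hull of \<open>A\<close> moved along all lines of direction \<open>u\<close>.
  Written as the hull of two translates it is affine by construction, and it is empty for empty
  \<open>A\<close>.\<close>

definition sweep :: "'a::real_vector \<Rightarrow> 'a set \<Rightarrow> 'a set" where
  "sweep u A = affine hull (A \<union> (+) u ` A)"

lemma affine_sweep [simp]: "affine (sweep u A)"
  by (simp add: sweep_def)

lemma closed_sweep [simp]: "closed (sweep u (A :: 'a::euclidean_space set))"
  by (simp add: sweep_def)

lemma affine_hull_subset_sweep: "affine hull A \<subseteq> sweep u A"
  unfolding sweep_def by (intro hull_mono) auto

lemma sweep_shift:
  assumes "y \<in> sweep u A" shows "y + s *\<^sub>R u \<in> sweep u A"
proof -
  obtain a where "a \<in> A"
    using assms unfolding sweep_def by (cases "A = {}") auto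
  then have "a \<in> sweep u A" "u + a \<in> sweep u A"
    unfolding sweep_def by (auto intro!: hull_inc)
  then have "y + s *\<^sub>R ((u + a) - a) \<in> sweep u A"
    using assms by (intro mem_affine_3_minus) auto
  then show ?thesis by simp
qed

lemma sweepI: "y - s *\<^sub>R u \<in> affine hull A \<Longrightarrow> y \<in> sweep u A"
  using sweep_shift[of "y - s *\<^sub>R u" u A s] affine_hull_subset_sweep[of A u] by auto

lemma aff_dim_sweep_le: "aff_dim (sweep u (A :: 'a::euclidean_space set)) \<le> aff_dim A + 1"
proof (cases "A = {}")
  case False
  then obtain a where a: "a \<in> A" by blast
  have "A \<union> (+) u ` A \<subseteq> affine hull (insert (u + a) A)"
  proof -
    have "u + b \<in> affine hull (insert (u + a) A)" if "b \<in> A" for b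
    proof -
      have "b + 1 *\<^sub>R ((u + a) - a) \<in> affine hull (insert (u + a) A)"
        using that a by (intro mem_affine_3_minus) (auto intro: hull_inc)
      then show ?thesis by (simp add: add.commute)
    qed
    moreover have "A \<subseteq> affine hull (insert (u + a) A)"
      using hull_subset[of "insert (u + a) A" affine] by auto
    ultimately show ?thesis by auto
  qed
  then have "sweep u A \<subseteq> affine hull (insert (u + a) A)"
    unfolding sweep_def by (simp add: hull_minimal)
  then have "aff_dim (sweep u A) \<le> aff_dim (insert (u + a) A)"
    by (metis aff_dim_affine_hull aff_dim_subset)
  then show ?thesis by (simp add: aff_dim_insert split: if_splits)
qed (simp add: sweep_def)

section \<open>The linear space parallel to a cell\<close>

lemma subspace_parallel_space [simp]: "subspace (parallel_space \<rho>)"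
  by (simp add: parallel_space_def)

lemma parallel_space_mono: "\<rho> \<subseteq> \<rho>' \<Longrightarrow> parallel_space \<rho> \<subseteq> parallel_space \<rho>'"
  unfolding parallel_space_def by (intro span_mono) blast

lemma parallel_space_altdef:
  assumes "a \<in> \<rho>" shows "parallel_space \<rho> = span ((\<lambda>x. x - a) ` \<rho>)"
proof
  have "x - y \<in> span ((\<lambda>x. x - a) ` \<rho>)" if "x \<in> \<rho>" "y \<in> \<rho>" for x y
  proof -
    have "(x - a) - (y - a) \<in> span ((\<lambda>x. x - a) ` \<rho>)"
      using that by (intro span_diff span_base) auto
    then show ?thesis by simp
  qed
  then show "parallel_space \<rho> \<subseteq> span ((\<lambda>x. x - a) ` \<rho>)"
    unfolding parallel_space_def by (intro span_minimal) auto
  show "span ((\<lambda>x. x - a) ` \<rho>) \<subseteq> parallel_space \<rho>"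
    unfolding parallel_space_def using assms by (intro span_mono) auto
qed

lemma aff_dim_parallel_space:
  assumes "\<rho> \<noteq> {}" shows "aff_dim \<rho> = int (dim (parallel_space \<rho>))"
proof -
  obtain a where a: "a \<in> \<rho>" using assms by blast
  then have "a \<in> affine hull \<rho>" by (simp add: hull_inc)
  then show ?thesis
    by (simp add: aff_dim_eq_dim_subtract parallel_space_altdef[OF a])
qed

lemma affine_hull_parallel_space:
  assumes "a \<in> affine hull \<rho>" shows "y \<in> affine hull \<rho> \<longleftrightarrow> y - a \<in> parallel_space \<rho>"
proof -
  have *: "y \<in> affine hull \<rho> \<longleftrightarrow> y - b \<in> parallel_space \<rho>" if b: "b \<in> \<rho>" for b y
  proof -
    have "affine hull \<rho> = (\<lambda>x. b + x) ` span ((\<lambda>x. - b + x) ` (\<rho> - {b}))"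
      using affine_hull_span2[OF b] .
    also have "span ((\<lambda>x. - b + x) ` (\<rho> - {b})) = span (insert 0 ((\<lambda>x. - b + x) ` (\<rho> - {b})))"
      by simp
    also have "insert 0 ((\<lambda>x. - b + x) ` (\<rho> - {b})) = (\<lambda>x. x - b) ` \<rho>"
      using b by force
    finally show ?thesis
      by (auto simp: parallel_space_altdef[OF b] image_iff) (metis add_diff_cancel_left' diff_add_cancel add.commute)
  qed
  obtain b where b: "b \<in> \<rho>" using assms by (cases "\<rho> = {}") auto
  have ab: "a - b \<in> parallel_space \<rho>" using *[OF b] assms by simp
  have "y - b = (y - a) + (a - b)" by simp
  then have "y - b \<in> parallel_space \<rho> \<longleftrightarrow> y - a \<in> parallel_space \<rho>"
    by (metis ab add_diff_cancel_right' subspace_add subspace_diff subspace_parallel_space)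
  then show ?thesis using *[OF b] by simp
qed

lemma parallel_space_eq_hyperplane:
  fixes n :: "real ^ 'n"
  assumes "aff_dim \<rho> = int CARD('n) - 1" "\<rho> \<noteq> {}" "n \<noteq> 0" "\<And>y. y \<in> parallel_space \<rho> \<Longrightarrow> n \<bullet> y = 0"
  shows "parallel_space \<rho> = {y. n \<bullet> y = 0}"
proof (rule subspace_dim_equal)
  have "int (dim (parallel_space \<rho>)) = int CARD('n) - 1"
    using assms(1,2) aff_dim_parallel_space by metis
  moreover have "dim {y. n \<bullet> y = 0} = CARD('n) - 1"
    using dim_hyperplane[OF assms(3)] by simp
  ultimately show "dim {y. n \<bullet> y = 0} \<le> dim (parallel_space \<rho>)" by linarith
qed (use assms subspace_hyperplane in auto)

lemma orthogonal_hyperplane_collinear: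
  fixes n m :: "'a::euclidean_space"
  assumes "n \<noteq> 0" "\<And>y. n \<bullet> y = 0 \<Longrightarrow> m \<bullet> y = 0"
  shows "m = ((m \<bullet> n) / (n \<bullet> n)) *\<^sub>R n"
proof -
  let ?y = "m - ((m \<bullet> n) / (n \<bullet> n)) *\<^sub>R n"
  have "n \<bullet> ?y = 0" using assms(1) by (simp add: inner_diff_right inner_commute)
  moreover from this have "m \<bullet> ?y = 0" using assms(2) by blast
  ultimately have "?y \<bullet> ?y = 0" by (simp add: inner_diff_left)
  then show ?thesis by simp
qed

section \<open>Polyhedral complexes of codimension one\<close>

text \<open>Write \<open>p\<close> as \<open>y0 + l p + s p *\<^sub>R (c - y0)\<close> with
  \<open>l p\<close> parallel to \<tau>. If \<open>s p\<close> is nonnegative, \<open>p\<close> is a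
  convex combination of \<open>c\<close> and a point of \<tau>. If it is negative, a point of \<tau>
  lies strictly between \<open>p\<close> and \<open>c\<close>, and the face property would put
  \<open>c\<close> into \<tau>.\<close>

lemma halfspace_near_facet:
  fixes \<sigma> \<tau> :: "(real ^ 'n) set"
  assumes "convex \<sigma>" "\<tau> face_of \<sigma>" "y0 \<in> rel_interior \<tau>" "c \<in> \<sigma>"
    and h: "\<And>v. v \<in> parallel_space \<sigma> \<Longrightarrow> h \<bullet> v = 0 \<longleftrightarrow> v \<in> parallel_space \<tau>"
    and k: "h \<bullet> (c - y0) \<noteq> 0"
  shows "\<exists>e>0. \<forall>p \<in> affine hull \<sigma>. dist p y0 < e \<longrightarrow>
           (p \<in> \<sigma> \<longleftrightarrow> 0 \<le> (h \<bullet> (p - y0)) * (h \<bullet> (c - y0)))"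
proof -
  define k where "k = h \<bullet> (c - y0)"
  define s where "s = (\<lambda>p. (h \<bullet> (p - y0)) / k)"
  define l where "l = (\<lambda>p. p - y0 - s p *\<^sub>R (c - y0))"
  have k0: "k \<noteq> 0" using k by (simp add: k_def)
  have y0: "y0 \<in> \<tau>" using assms(3) rel_interior_subset by blast
  have y0s: "y0 \<in> \<sigma>" using y0 assms(2) face_of_imp_subset by blast
  obtain \<delta> where \<delta>: "\<delta> > 0" "ball y0 \<delta> \<inter> affine hull \<tau> \<subseteq> \<tau>"
    using assms(3) mem_rel_interior_ball by blast
  \<comment> \<open>A bound of 1/2 on \<open>s p\<close> keeps the factor
    \<open>1 / (1 - s p)\<close> below 2, and then \<open>norm (l p) < \<delta>/2\<close> keeps the
    rescaled vector inside the ball on which \<tau> is known.\<close>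
  let ?O = "{p. norm (l p) < \<delta>/2} \<inter> {p. \<bar>s p\<bar> < 1/2}"
  have "open ?O"
    unfolding l_def s_def by (intro open_Int open_Collect_less continuous_intros) (use k0 in auto)
  moreover have "y0 \<in> ?O" using \<delta>(1) by (simp add: l_def s_def)
  ultimately obtain e where e: "e > 0" "ball y0 e \<subseteq> ?O"
    using open_contains_ball by blast
  have ctau: "c \<notin> \<tau>"
  proof
    assume "c \<in> \<tau>"
    then have "c - y0 \<in> parallel_space \<tau>"
      unfolding parallel_space_def using y0 by (intro span_base) auto
    moreover have "parallel_space \<tau> \<subseteq> parallel_space \<sigma>"
      using assms(2) face_of_imp_subset parallel_space_mono by blast
    ultimately show False using h k by auto
  qed
  have "p \<in> \<sigma> \<longleftrightarrow> 0 \<le> (h \<bullet> (p - y0)) * k" if p: "p \<in> affine hull \<sigma>" "dist p y0 < e" for p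
  proof -
    have sm: "norm (l p) < \<delta>/2" "\<bar>s p\<bar> < 1/2"
    proof -
      have "p \<in> ball y0 e" using p(2) by (simp add: dist_commute)
      then have "p \<in> ?O" using e(2) by blast
      then show "norm (l p) < \<delta>/2" "\<bar>s p\<bar> < 1/2" by simp_all
    qed
    have peq: "p = y0 + l p + s p *\<^sub>R (c - y0)" by (simp add: l_def)
    have "y0 \<in> affine hull \<sigma>" "c \<in> affine hull \<sigma>" using y0s assms(4) by (auto intro: hull_inc)
    then have "p - y0 \<in> parallel_space \<sigma>" "c - y0 \<in> parallel_space \<sigma>"
      using p(1) affine_hull_parallel_space by blast+
    then have "l p \<in> parallel_space \<sigma>"
      unfolding l_def by (meson subspace_diff subspace_scale subspace_parallel_space)
    moreover have "h \<bullet> l p = 0" using k0 by (simp add: l_def s_def inner_diff_right k_def)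
    ultimately have lt: "l p \<in> parallel_space \<tau>" using h by blast
    have inT: "y0 + r *\<^sub>R l p \<in> \<tau>" if "\<bar>r\<bar> \<le> 2" for r
    proof -
      have "norm (r *\<^sub>R l p) < \<delta>"
      proof -
        have "norm (r *\<^sub>R l p) \<le> 2 * norm (l p)" using that by (simp add: mult_right_mono)
        then show ?thesis using sm(1) by linarith
      qed
      moreover have "y0 + r *\<^sub>R l p \<in> affine hull \<tau>"
        using affine_hull_parallel_space[of y0 \<tau> "y0 + r *\<^sub>R l p"] lt y0
        by (simp add: hull_inc subspace_scale)
      ultimately show ?thesis using \<delta>(2) by (auto simp: dist_norm)
    qed
    have hs: "0 \<le> (h \<bullet> (p - y0)) * k \<longleftrightarrow> 0 \<le> s p"
      using k0 by (auto simp: s_def zero_le_mult_iff zero_le_divide_iff)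
    show ?thesis
    proof
      assume "0 \<le> (h \<bullet> (p - y0)) * k"
      then have s0: "0 \<le> s p" using hs by simp
      let ?r = "1 / (1 - s p)"
      have r: "\<bar>?r\<bar> \<le> 2" using sm(2) by (simp add: field_simps abs_if split: if_splits)
      have "(1 - s p) *\<^sub>R (y0 + ?r *\<^sub>R l p) + s p *\<^sub>R c \<in> \<sigma>"
        using inT[OF r] assms(2,4) face_of_imp_subset s0 sm(2)
        by (intro convexD[OF assms(1)]) auto
      moreover have "(1 - s p) *\<^sub>R (y0 + ?r *\<^sub>R l p) + s p *\<^sub>R c = p"
      proof -
        have "(1 - s p) *\<^sub>R (?r *\<^sub>R l p) = l p" using sm(2) by auto
        then have "(1 - s p) *\<^sub>R (y0 + ?r *\<^sub>R l p) = (1 - s p) *\<^sub>R y0 + l p"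
          by (simp only: scaleR_add_right)
        then show ?thesis by (simp add: l_def algebra_simps)
      qed
      ultimately show "p \<in> \<sigma>" by simp
    next
      assume ps: "p \<in> \<sigma>"
      show "0 \<le> (h \<bullet> (p - y0)) * k"
      proof (rule ccontr)
        assume "\<not> ?thesis"
        then have s0: "s p < 0" using hs by simp
        let ?r = "1 / (1 - s p)"
        let ?q = "y0 + ?r *\<^sub>R l p"
        have r: "\<bar>?r\<bar> \<le> 2" using s0 by (simp add: field_simps)
        \<comment> \<open>The weights are those for which the components along \<open>c - y0\<close>
          cancel: \<open>?q\<close> is the point where the segment from \<open>p\<close> to
          \<open>c\<close> crosses the affine hull of \<tau>.\<close>
        have q: "?q = (1 - (- s p) * ?r) *\<^sub>R p + ((- s p) * ?r) *\<^sub>R c"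
        proof -
          have "(1 - s p) *\<^sub>R ?q = (1 - s p) *\<^sub>R y0 + l p" using s0 by (simp add: algebra_simps)
          also have "\<dots> = p - s p *\<^sub>R c" by (simp add: l_def algebra_simps)
          finally have "?r *\<^sub>R ((1 - s p) *\<^sub>R ?q) = ?r *\<^sub>R (p - s p *\<^sub>R c)" by simp
          then have "?q = ?r *\<^sub>R (p - s p *\<^sub>R c)" using s0 by simp
          also have "\<dots> = ?r *\<^sub>R p + ((- s p) * ?r) *\<^sub>R c" by (simp add: algebra_simps)
          finally have "?q = ?r *\<^sub>R p + ((- s p) * ?r) *\<^sub>R c" .
          moreover have "1 - (- s p) * ?r = ?r" using s0 by (simp add: field_simps)
          ultimately show ?thesis by metis
        qed
        have "0 < (- s p) * ?r" "(- s p) * ?r < 1" using s0 by (auto simp: field_simps)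
        moreover have "p \<noteq> c"
        proof
          assume "p = c"
          then have "s p = 1" using k0 by (simp add: s_def k_def)
          then show False using s0 by simp
        qed
        ultimately have "?q \<in> open_segment p c" using q unfolding in_segment by blast
        then have "c \<in> \<tau>"
          using face_ofD[OF assms(2) _ ps assms(4)] inT[OF r] by blast
        then show False using ctau by simp
      qed
    qed
  qed
  then show ?thesis using e(1) unfolding k_def by blast
qed

lemma finite_closed_near:
  fixes y :: "'a::metric_space"
  assumes "finite F" "\<And>c. c \<in> F \<Longrightarrow> closed c"
  shows "\<exists>e>0. \<forall>c\<in>F. c \<inter> ball y e \<noteq> {} \<longrightarrow> y \<in> c"
proof -
  have "closed (\<Union>{c \<in> F. y \<notin> c})" using assms by (intro closed_Union) auto
  then have "open (- \<Union>{c \<in> F. y \<notin> c})" by (simp add: open_closed)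
  moreover have "y \<in> - \<Union>{c \<in> F. y \<notin> c}" by auto
  ultimately obtain e where "e > 0" "ball y e \<subseteq> - \<Union>{c \<in> F. y \<notin> c}"
    using open_contains_ball by blast
  then show ?thesis by (intro exI[of _ e]) auto
qed

definition is_normal :: "real ^ 'n \<Rightarrow> (real ^ 'n) set \<Rightarrow> bool" where
  "is_normal n \<sigma> \<longleftrightarrow> n \<noteq> 0 \<and> (\<forall>y\<in>parallel_space \<sigma>. n \<bullet> y = 0)"

lemma is_normal_uminus [simp]: "is_normal (- n) \<sigma> \<longleftrightarrow> is_normal n \<sigma>"
  by (simp add: is_normal_def)

lemma is_normal_scale: "is_normal n \<sigma> \<Longrightarrow> c \<noteq> 0 \<Longrightarrow> is_normal (c *\<^sub>R n) \<sigma>"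
  by (simp add: is_normal_def)

locale hypersurface_complex =
  fixes K :: "(real ^ 'n) set set"
  assumes polyhedral_complex: "polyhedral_complex K"
    and complex_dim: "has_complex_dim K (CARD('n) - 1)"
    and pure: "pure_complex (CARD('n) - 1) K"
begin

definition M where "M = max_cells (CARD('n) - 1) K"
definition Rd where "Rd = ridges (CARD('n) - 1) K"
abbreviation C where "C \<equiv> \<Union>K"

definition star :: "(real ^ 'n) set \<Rightarrow> (real ^ 'n) set set" where
  "star \<tau> = {\<sigma> \<in> M. \<tau> face_of \<sigma>}"

lemma int_card_pred: "int (CARD('n) - 1) = int CARD('n) - 1"
  by (simp add: of_nat_diff Suc_leI)

lemma finite_K [simp]: "finite K"
  using polyhedral_complex by (simp add: polyhedral_complex_def)

lemma cell:
  assumes "c \<in> K"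
  shows "polyhedron c" "convex c" "closed c" "c \<noteq> {}"
  using polyhedral_complex assms
  by (auto simp: polyhedral_complex_def intro: polyhedron_imp_convex polyhedron_imp_closed)

lemma face_in_K: "c \<in> K \<Longrightarrow> f face_of c \<Longrightarrow> f \<noteq> {} \<Longrightarrow> f \<in> K"
  using polyhedral_complex unfolding polyhedral_complex_def by blast

lemma M_K: "\<sigma> \<in> M \<Longrightarrow> \<sigma> \<in> K" by (simp add: M_def max_cells_def)
lemma Rd_K: "\<tau> \<in> Rd \<Longrightarrow> \<tau> \<in> K" by (simp add: Rd_def ridges_def)
lemma star_M: "\<sigma> \<in> star \<tau> \<Longrightarrow> \<sigma> \<in> M" by (simp add: star_def)

lemma finite_M [simp]: "finite M" by (simp add: M_def max_cells_def)
lemma finite_Rd [simp]: "finite Rd" by (simp add: Rd_def ridges_def)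
lemma finite_star [simp]: "finite (star \<tau>)" by (simp add: star_def)

lemma aff_dim_M: "\<sigma> \<in> M \<Longrightarrow> aff_dim \<sigma> = int CARD('n) - 1"
  by (simp add: M_def max_cells_def int_card_pred)

lemma aff_dim_Rd: "\<tau> \<in> Rd \<Longrightarrow> aff_dim \<tau> = int CARD('n) - 2"
  by (simp add: Rd_def ridges_def int_card_pred)

lemma aff_dim_K: "c \<in> K \<Longrightarrow> aff_dim c \<le> int CARD('n) - 1"
  using complex_dim by (simp add: has_complex_dim_def int_card_pred)

lemma aff_dim_nonmax:
  assumes "c \<in> K - M" shows "aff_dim c \<le> int CARD('n) - 2"
proof -
  have "aff_dim c \<noteq> int CARD('n) - 1" using assms by (auto simp: M_def max_cells_def int_card_pred)
  then show ?thesis using aff_dim_K[of c] assms by auto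
qed

lemma face_of_if_rel_interior:
  assumes "c1 \<in> K" "c2 \<in> K" "y \<in> rel_interior c1" "y \<in> c2"
  shows "c1 face_of c2"
proof -
  have f: "c1 \<inter> c2 face_of c1" "c1 \<inter> c2 face_of c2"
    using polyhedral_complex assms(1,2) unfolding polyhedral_complex_def by blast+
  have "c1 \<subseteq> c1 \<inter> c2"
    using subset_of_face_of[OF f(1), of c1] assms(3,4) rel_interior_subset by blast
  then have "c1 \<inter> c2 = c1" by blast
  then show ?thesis using f(2) by simp
qed

lemma max_cell_unique:
  assumes "\<sigma> \<in> M" "y \<in> rel_interior \<sigma>" "c \<in> K" "y \<in> c"
  shows "c = \<sigma>"
proof (rule ccontr)
  assume ne: "c \<noteq> \<sigma>"
  have "\<sigma> face_of c" using face_of_if_rel_interior assms M_K by blast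
  then have "aff_dim \<sigma> < aff_dim c" using face_of_aff_dim_lt cell(2) assms(3) ne by metis
  then show False using aff_dim_M[OF assms(1)] aff_dim_K[OF assms(3)] by simp
qed

text \<open>A face of least dimension among those containing \<open>y\<close> works: on its relative
  boundary, \<open>y\<close> would lie in a facet, which has smaller dimension.\<close>

lemma cell_rel_interior:
  assumes "c \<in> K" "y \<in> c"
  obtains c' where "c' \<in> K" "c' face_of c" "y \<in> rel_interior c'"
proof -
  let ?S = "{c' \<in> K. c' face_of c \<and> y \<in> c'}"
  have "finite ?S" "c \<in> ?S" using assms cell by (auto intro: face_of_refl)
  then obtain c' where c': "c' \<in> ?S" "\<And>b. b \<in> ?S \<Longrightarrow> aff_dim c' \<le> aff_dim b"
    using arg_min_least[where S = ?S and f = aff_dim] arg_min_if_finite(1)[where S = ?S and f = aff_dim]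
    by blast
  have "y \<in> rel_interior c'"
  proof (rule ccontr)
    assume "y \<notin> rel_interior c'"
    then have "y \<in> c' - rel_interior c'" using c'(1) by simp
    then obtain F where F: "F facet_of c'" "y \<in> F"
      using rel_boundary_of_polyhedron[OF cell(1)] c'(1) by blast
    then have "F \<in> K" "F face_of c"
      using face_in_K[of c' F] c'(1) by (auto simp: facet_of_def intro: face_of_trans)
    then have "aff_dim c' \<le> aff_dim F" using c'(2) F(2) by blast
    then show False using F(1) by (simp add: facet_of_def)
  qed
  then show ?thesis using that c'(1) by blast
qed

lemma C_eq_Union_M: "C = \<Union>M"
proof -
  have "\<exists>\<sigma>\<in>M. y \<in> \<sigma>" if "y \<in> c" "c \<in> K" for y c
  proof (cases "aff_dim c = int CARD('n) - 1")
    case True then show ?thesis using that by (auto simp: M_def max_cells_def int_card_pred)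
  next
    case False
    then have "aff_dim c < int (CARD('n) - 1)" using aff_dim_K[OF that(2)] by (simp add: int_card_pred)
    then show ?thesis using pure that unfolding pure_complex_def M_def
      by (meson face_of_imp_subset subset_eq)
  qed
  then show ?thesis using M_K by blast
qed

text \<open>By purity \<open>C\<close> is the union of its maximal cells, and a convex set lies in
  the closure of its relative interior.\<close>

lemma rel_interior_M_near:
  assumes "y \<in> C" "open W" "y \<in> W"
  obtains \<sigma> y' where "\<sigma> \<in> M" "y' \<in> rel_interior \<sigma>" "y' \<in> W"
proof -
  obtain \<sigma> where s: "\<sigma> \<in> M" "y \<in> \<sigma>" using assms(1) C_eq_Union_M by blast
  then have "y \<in> closure (rel_interior \<sigma>)"
    using convex_closure_rel_interior[OF cell(2)[OF M_K[OF s(1)]]] closure_subset by blast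
  then show ?thesis
    using that s(1) assms(2,3) open_Int_closure_eq_empty[of W "rel_interior \<sigma>"] by blast
qed

lemma M_nonempty: "M \<noteq> {}"
  using complex_dim by (auto simp: has_complex_dim_def M_def max_cells_def)

lemma closed_C: "closed C"
  using cell(3) by (intro closed_Union) auto

lemma open_avoids_C:
  assumes "open W" "W \<noteq> {}"
  obtains w where "w \<in> W" "w \<notin> C"
proof (rule open_avoids_lowdim[OF assms finite_K])
  show "aff_dim A < int DIM(real ^ 'n)" if "A \<in> K" for A using aff_dim_K[OF that] by simp
qed (use that in blast)

lemma cells_near: "\<exists>e>0. \<forall>c\<in>K. c \<inter> ball y e \<noteq> {} \<longrightarrow> y \<in> c"
  using finite_closed_near[of K y] cell(3) by auto

lemma exists_normal:
  assumes "\<sigma> \<in> M" obtains n where "is_normal n \<sigma>"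
proof -
  have "int (dim (parallel_space \<sigma>)) = int CARD('n) - 1"
    using aff_dim_parallel_space[OF cell(4)[OF M_K[OF assms]]] aff_dim_M[OF assms] by simp
  then have "dim (parallel_space \<sigma>) < DIM(real ^ 'n)" by simp
  then obtain a where "a \<noteq> 0" "span (parallel_space \<sigma>) \<subseteq> {x. a \<bullet> x = 0}"
    using lowdim_subset_hyperplane by blast
  then have "is_normal a \<sigma>" using span_superset unfolding is_normal_def by blast
  then show ?thesis using that by blast
qed

lemma parallel_space_M:
  assumes "\<sigma> \<in> M" "is_normal n \<sigma>" shows "v \<in> parallel_space \<sigma> \<longleftrightarrow> n \<bullet> v = 0"
  using parallel_space_eq_hyperplane[OF aff_dim_M[OF assms(1)] cell(4)[OF M_K[OF assms(1)]], of n] assms(2)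
  by (auto simp: is_normal_def)

lemma normals_collinear:
  assumes "\<sigma> \<in> M" "is_normal n \<sigma>" "is_normal m \<sigma>"
  obtains c where "c \<noteq> 0" "m = c *\<^sub>R n"
proof -
  have "m = ((m \<bullet> n) / (n \<bullet> n)) *\<^sub>R n"
    using orthogonal_hyperplane_collinear[of n m] parallel_space_M[OF assms(1,2)] assms(2,3)
    by (auto simp: is_normal_def)
  moreover from this have "(m \<bullet> n) / (n \<bullet> n) \<noteq> 0" using assms(3) by (auto simp: is_normal_def)
  ultimately show ?thesis using that by blast
qed

lemma affine_hull_M:
  assumes "\<sigma> \<in> M" "is_normal n \<sigma>" "a \<in> \<sigma>"
  shows "y \<in> affine hull \<sigma> \<longleftrightarrow> n \<bullet> (y - a) = 0"
  using affine_hull_parallel_space[of a \<sigma> y] parallel_space_M[OF assms(1,2)] assms(3)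
  by (simp add: hull_inc)

text \<open>Cells not containing \<open>y\<close> keep away from it, and \<sigma> is the only cell
  through \<open>y\<close>. So near \<open>y\<close> the set \<open>C\<close> is a relatively open
  piece of the affine hull of \<sigma>.\<close>

lemma near_rel_interior_M:
  assumes "\<sigma> \<in> M" "is_normal n \<sigma>" "y \<in> rel_interior \<sigma>"
  shows "\<exists>e>0. \<forall>y'\<in>ball y e. (y' \<in> C \<longleftrightarrow> n \<bullet> (y' - y) = 0) \<and> (y' \<in> C \<longrightarrow> y' \<in> rel_interior \<sigma>)"
proof -
  have ys: "y \<in> \<sigma>" using assms(3) rel_interior_subset by blast
  obtain e1 where e1: "e1 > 0" "\<forall>c\<in>K. c \<inter> ball y e1 \<noteq> {} \<longrightarrow> y \<in> c"
    using cells_near by blast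
  have "openin (top_of_set (affine hull \<sigma>)) (rel_interior \<sigma>)" by (rule openin_rel_interior)
  then obtain e2 where e2: "e2 > 0" "ball y e2 \<inter> affine hull \<sigma> \<subseteq> rel_interior \<sigma>"
    using assms(3) by (auto simp: openin_contains_ball)
  have "(y' \<in> C \<longleftrightarrow> n \<bullet> (y' - y) = 0) \<and> (y' \<in> C \<longrightarrow> y' \<in> rel_interior \<sigma>)"
    if "y' \<in> ball y (min e1 e2)" for y'
  proof -
    have "y' \<in> affine hull \<sigma>" if "y' \<in> C"
    proof -
      obtain c where c: "c \<in> K" "y' \<in> c" using \<open>y' \<in> C\<close> by blast
      moreover have "y' \<in> ball y e1" using \<open>y' \<in> ball y (min e1 e2)\<close> by simp
      ultimately have "y \<in> c" using e1(2) by blast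
      then have "c = \<sigma>" using max_cell_unique assms c by blast
      then show ?thesis using c by (simp add: hull_inc)
    qed
    moreover have "y' \<in> rel_interior \<sigma>" if "y' \<in> affine hull \<sigma>"
      using that e2 \<open>y' \<in> ball y (min e1 e2)\<close> by auto
    moreover have "y' \<in> C" if "y' \<in> rel_interior \<sigma>"
      using that rel_interior_subset M_K assms(1) by blast
    ultimately show ?thesis using affine_hull_M[OF assms(1,2) ys, of y'] by blast
  qed
  then show ?thesis using e1 e2 by (intro exI[of _ "min e1 e2"]) auto
qed

text \<open>If \<open>y\<close> is off this finite union of proper affine subspaces, the whole line
  through \<open>y\<close> in direction \<open>u\<close> meets \<open>C\<close> only in relative
  interiors of maximal cells. The set is invariant under translation along \<open>u\<close>.\<close>

definition T :: "real ^ 'n \<Rightarrow> (real ^ 'n) set" where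
  "T u = (\<Union>c\<in>K - M. sweep u c)"

lemma closed_T: "closed (T u)"
  unfolding T_def by (intro closed_UN) auto

lemma T_shift: "y \<in> T u \<Longrightarrow> y + s *\<^sub>R u \<in> T u"
  unfolding T_def using sweep_shift by blast

lemma T_sweepI: "c \<in> K - M \<Longrightarrow> y - s *\<^sub>R u \<in> affine hull c \<Longrightarrow> y \<in> T u"
  unfolding T_def using sweepI by blast

lemma open_avoids_T:
  assumes "open W" "W \<noteq> {}" "finite F" "\<And>A. A \<in> F \<Longrightarrow> aff_dim A < int CARD('n)"
  obtains w where "w \<in> W" "w \<notin> T u" "w \<notin> \<Union>F"
proof (rule open_avoids_lowdim[OF assms(1,2), of "sweep u ` (K - M) \<union> F"])
  show "aff_dim A < int DIM(real ^ 'n)" if "A \<in> sweep u ` (K - M) \<union> F" for A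
  proof -
    have "aff_dim (sweep u c) < int CARD('n)" if "c \<in> K - M" for c
      using aff_dim_nonmax[OF that] aff_dim_sweep_le[of u c] by linarith
    then show ?thesis using that assms(4) by auto
  qed
qed (use that assms(3) in \<open>auto simp: T_def\<close>)

lemma rel_interior_M_if_nonmax_avoided:
  assumes "y \<in> C" "\<And>c. c \<in> K - M \<Longrightarrow> y \<notin> affine hull c"
  obtains \<sigma> where "\<sigma> \<in> M" "y \<in> rel_interior \<sigma>"
proof -
  obtain c where "c \<in> K" "y \<in> c" using assms(1) by blast
  then obtain c' where c': "c' \<in> K" "y \<in> rel_interior c'" using cell_rel_interior by blast
  then have "y \<in> c'" using rel_interior_subset by blast
  then have "y \<in> affine hull c'" by (rule hull_inc)
  then have "c' \<in> M" using assms(2) c'(1) by blast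
  then show ?thesis using that c' by blast
qed

lemma notin_T_rel_interior:
  assumes "y \<in> C" "y \<notin> T u"
  obtains \<sigma> where "\<sigma> \<in> M" "y \<in> rel_interior \<sigma>"
  using rel_interior_M_if_nonmax_avoided[OF assms(1)] T_sweepI[of _ y 0 u] assms(2) by force

text \<open>Genericity cannot be sought inside \<sigma>, which is itself null. Instead a generic
  point \<open>a\<close> of an open neighbourhood of \<open>y\<close> is projected along
  \<open>u\<close> to the affine hull of \<sigma> by \<open>f\<close>; the sets to be avoided are
  unions of lines of direction \<open>u\<close>, so the projection avoids them too. The family
  \<open>F\<close> makes room for the cells of a second complex.\<close>

lemma generic_rel_interior_point:
  assumes "\<sigma> \<in> M" "is_normal n \<sigma>" "n \<bullet> u \<noteq> 0" "y \<in> rel_interior \<sigma>" "e > 0"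
    and "finite F" "\<And>A. A \<in> F \<Longrightarrow> aff_dim A < int CARD('n) - 1"
  obtains y' where "y' \<in> rel_interior \<sigma>" "dist y' y < e" "y' \<notin> T u" "y' \<notin> \<Union>(sweep u ` F)"
proof -
  define f where "f = (\<lambda>a. a - ((n \<bullet> (a - y)) / (n \<bullet> u)) *\<^sub>R u)"
  have ys: "y \<in> \<sigma>" using assms(4) rel_interior_subset by blast
  obtain d where d: "d > 0" "\<forall>y'\<in>ball y d. (y' \<in> C \<longleftrightarrow> n \<bullet> (y' - y) = 0) \<and> (y' \<in> C \<longrightarrow> y' \<in> rel_interior \<sigma>)"
    using near_rel_interior_M[OF assms(1,2,4)] by blast
  let ?W = "{a. dist y (f a) < min d e}"
  have "open ?W" unfolding f_def
    by (intro open_Collect_less continuous_intros) (use assms(3) in auto)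
  moreover have "y \<in> ?W" using d(1) assms(5) by (simp add: f_def)
  moreover have "finite (sweep u ` F)" using assms(6) by simp
  moreover have "aff_dim A < int CARD('n)" if "A \<in> sweep u ` F" for A
  proof -
    have "aff_dim (sweep u c) < int CARD('n)" if "c \<in> F" for c
      using assms(7)[OF that] aff_dim_sweep_le[of u c] by linarith
    then show ?thesis using that by auto
  qed
  ultimately obtain a where a: "a \<in> ?W" "a \<notin> T u" "a \<notin> \<Union>(sweep u ` F)"
    using open_avoids_T[of ?W "sweep u ` F" u] by blast
  have na: "n \<bullet> (f a - y) = 0" using assms(3) by (simp add: f_def inner_diff_right)
  have "f a \<in> ball y d" using a(1) by simp
  then have "f a \<in> rel_interior \<sigma>" using d(2) na by blast
  moreover have "dist (f a) y < e" using a(1) by (simp add: dist_commute)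
  moreover have "a = f a + ((n \<bullet> (a - y)) / (n \<bullet> u)) *\<^sub>R u" by (simp add: f_def)
  then have "f a \<notin> T u" using T_shift a(2) by metis
  moreover have "f a \<notin> \<Union>(sweep u ` F)"
    using a(3) sweep_shift[of "f a" u _ "(n \<bullet> (a - y)) / (n \<bullet> u)"] by (auto simp: f_def)
  ultimately show ?thesis using that by blast
qed

text \<open>The parallel space of \<tau> is contained in that of \<sigma> cut by the kernel of
  \<open>h\<close>. This cut is proper because of \<open>z\<close>, and the two parallel spaces
  differ by one dimension, so the containment is an equality.\<close>

lemma ridge_space:
  assumes "\<tau> \<in> Rd" "\<sigma> \<in> star \<tau>" "\<And>v. v \<in> parallel_space \<tau> \<Longrightarrow> h \<bullet> v = 0"
    "z \<in> parallel_space \<sigma>" "h \<bullet> z \<noteq> 0" "v \<in> parallel_space \<sigma>"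
  shows "h \<bullet> v = 0 \<longleftrightarrow> v \<in> parallel_space \<tau>"
proof -
  let ?V = "parallel_space \<sigma> \<inter> {v. h \<bullet> v = 0}"
  have sub: "parallel_space \<tau> \<subseteq> ?V"
  proof -
    have "\<tau> \<subseteq> \<sigma>" using assms(2) face_of_imp_subset unfolding star_def by blast
    then show ?thesis using parallel_space_mono[of \<tau> \<sigma>] assms(3) by blast
  qed
  have V: "subspace ?V" by (simp add: subspace_hyperplane subspace_inter)
  have "dim ?V < dim (parallel_space \<sigma>)"
    by (rule dim_psubset) (use V assms(4,5) in \<open>auto simp: span_eq_iff[THEN iffD2]\<close>)
  moreover have "int (dim (parallel_space \<sigma>)) = int CARD('n) - 1" "int (dim (parallel_space \<tau>)) = int CARD('n) - 2"
    using aff_dim_parallel_space cell(4) M_K Rd_K star_M assms(1,2) aff_dim_M aff_dim_Rd by metis+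
  ultimately have "dim ?V \<le> dim (parallel_space \<tau>)" by linarith
  then have "parallel_space \<tau> = ?V" using subspace_dim_equal[OF _ V sub] by simp
  then show ?thesis using assms(6) by blast
qed

text \<open>The point \<open>x + l *\<^sub>R z\<close> takes the part of \<open>c\<close> in
  \<open>halfspace_near_facet\<close>. As \<open>h\<close> vanishes along \<tau>, its value at that
  point relative to \<open>y0\<close> is \<open>l\<close> times \<open>h \<bullet> z\<close>, hence
  of the same sign.\<close>

lemma halfspace_near_ridge:
  assumes "\<tau> \<in> Rd" "\<sigma> \<in> star \<tau>" "y0 \<in> rel_interior \<tau>" "\<And>v. v \<in> parallel_space \<tau> \<Longrightarrow> h \<bullet> v = 0"
    "z \<in> parallel_space \<sigma>" "h \<bullet> z \<noteq> 0" "x \<in> \<tau>" "l > 0" "x + l *\<^sub>R z \<in> \<sigma>"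
  shows "\<exists>e>0. \<forall>p \<in> affine hull \<sigma>. dist p y0 < e \<longrightarrow> (p \<in> \<sigma> \<longleftrightarrow> 0 \<le> (h \<bullet> (p - y0)) * (h \<bullet> z))"
proof -
  have s: "\<sigma> \<in> M" "\<tau> face_of \<sigma>" using assms(2) by (auto simp: star_def)
  have "x - y0 \<in> parallel_space \<tau>"
    unfolding parallel_space_def using assms(3,7) rel_interior_subset by (intro span_base) blast
  then have hx: "h \<bullet> (x + l *\<^sub>R z - y0) = l * (h \<bullet> z)"
    using assms(4)[of "x - y0"] by (simp add: inner_diff_right inner_add_right)
  have "\<exists>e>0. \<forall>p \<in> affine hull \<sigma>. dist p y0 < e \<longrightarrow>
           (p \<in> \<sigma> \<longleftrightarrow> 0 \<le> (h \<bullet> (p - y0)) * (h \<bullet> (x + l *\<^sub>R z - y0)))"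
    by (rule halfspace_near_facet)
       (use s assms cell(2) M_K ridge_space[OF assms(1,2,4,5,6)] hx in auto)
  moreover have "0 \<le> a * (l * (h \<bullet> z)) \<longleftrightarrow> 0 \<le> a * (h \<bullet> z)" for a
  proof -
    have "a * (l * (h \<bullet> z)) = l * (a * (h \<bullet> z))" by simp
    then show ?thesis using assms(8) by (simp only: zero_le_mult_iff) simp
  qed
  ultimately show ?thesis unfolding hx by simp
qed

end

section \<open>Lattice normals and primitive normals\<close>

text \<open>Over the rationals, \<open>{a}\<close> extends to a basis of the reals, and the
  coordinate at \<open>a\<close> is such a functional. Applied coordinatewise, it turns real
  solutions of rational linear equations into rational ones while one chosen number stays
  nonzero.\<close>

lemma rational_linear_functional:
  fixes a :: real
  assumes "a \<noteq> 0"
  obtains \<phi> :: "real \<Rightarrow> real" where "\<And>x y. \<phi> (x + y) = \<phi> x + \<phi> y"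
    "\<And>r x. r \<in> \<rat> \<Longrightarrow> \<phi> (r * x) = r * \<phi> x" "\<And>x. \<phi> x \<in> \<rat>" "\<phi> a \<noteq> 0"
proof -
  interpret Q: vector_space "\<lambda>(r::rat) x::real. of_rat r * x"
    by unfold_locales (simp_all add: algebra_simps of_rat_add of_rat_mult)
  have ind: "Q.independent {a}" using assms by (simp add: Q.independent_insert)
  define B where "B = Q.extend_basis {a}"
  have B: "Q.independent B" "Q.span B = UNIV" "a \<in> B"
    using Q.independent_extend_basis[OF ind] Q.span_extend_basis[OF ind]
      Q.extend_basis_superset[OF ind] by (auto simp: B_def)
  let ?\<phi> = "\<lambda>x. real_of_rat (Q.representation B x a)"
  show ?thesis
  proof (rule that[of ?\<phi>])
    show "?\<phi> (x + y) = ?\<phi> x + ?\<phi> y" for x y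
      using B by (simp add: Q.representation_add of_rat_add)
    show "?\<phi> (r * x) = r * ?\<phi> x" if "r \<in> \<rat>" for r x
    proof -
      obtain q where "r = of_rat q" using \<open>r \<in> \<rat>\<close> by (rule Rats_cases)
      then show ?thesis using B by (simp add: Q.representation_scale of_rat_mult)
    qed
    show "?\<phi> a \<noteq> 0" using B by (simp add: Q.representation_basis)
  qed auto
qed

lemma rational_linear_sum:
  fixes \<phi> :: "real \<Rightarrow> real"
  assumes "\<And>x y. \<phi> (x + y) = \<phi> x + \<phi> y"
  shows "\<phi> (\<Sum>i\<in>A. f i) = (\<Sum>i\<in>A. \<phi> (f i))"
proof -
  have "\<phi> 0 = 0" using assms[of 0 0] by simp
  then show ?thesis using assms by (induction A rule: infinite_finite_induct) auto
qed

lemma common_denominator: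
  fixes f :: "'a \<Rightarrow> real"
  assumes "finite F" "\<And>i. i \<in> F \<Longrightarrow> f i \<in> \<rat>"
  shows "\<exists>N::nat. N > 0 \<and> (\<forall>i\<in>F. real N * f i \<in> \<int>)"
  using assms
proof (induction F rule: finite_induct)
  case (insert i F)
  then obtain N where N: "N > 0" "\<forall>i\<in>F. real N * f i \<in> \<int>" by auto
  have "f i \<in> \<rat>" using insert by simp
  then obtain m n where mn: "n \<noteq> 0" "\<bar>f i\<bar> = real m / real n" by (rule Rats_abs_nat_div_natE)
  have "real n * f i \<in> \<int>"
  proof (cases "f i \<ge> 0")
    case True then have "real n * f i = real m" using mn by simp
    then show ?thesis by simp
  next
    case False
    then have "f i = - (real m / real n)" using mn(2) by linarith
    then have "real n * f i = - real m" using mn by simp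
    then show ?thesis by simp
  qed
  then have "real N * (real n * f i) \<in> \<int>" by (metis Ints_mult Ints_of_nat)
  moreover have "real n * (real N * f j) \<in> \<int>" if "j \<in> F" for j using N that by (metis Ints_mult Ints_of_nat)
  ultimately have "\<forall>j\<in>insert i F. real (N * n) * f j \<in> \<int>"
    by (auto simp: algebra_simps)
  then show ?case using N(1) mn(1) by (intro exI[of _ "N * n"]) simp
qed (auto intro: exI[of _ 1])

section \<open>Integer vectors and primitive normals of cells\<close>

lemma integer_points_diff: "x \<in> integer_points \<Longrightarrow> y \<in> integer_points \<Longrightarrow> x - y \<in> integer_points"
  by (simp add: integer_points_def)

lemma integer_points_scale: "c \<in> \<int> \<Longrightarrow> x \<in> integer_points \<Longrightarrow> c *\<^sub>R x \<in> integer_points"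
  by (simp add: integer_points_def)

lemma integer_points_inner: "x \<in> integer_points \<Longrightarrow> y \<in> integer_points \<Longrightarrow> x \<bullet> y \<in> \<int>"
  unfolding integer_points_def inner_vec_def by (intro Ints_sum) auto

lemma axis_integer_points: "axis i 1 \<in> integer_points"
  by (simp add: integer_points_def axis_def)

lemma vec_eq_0_if_orthogonal_integer:
  assumes "\<And>b. b \<in> integer_points \<Longrightarrow> x \<bullet> b = 0" shows "x = 0"
proof -
  have "x $ i = 0" for i using assms[OF axis_integer_points[of i]] by (simp add: inner_axis)
  then show ?thesis by (simp add: vec_eq_iff)
qed

text \<open>A crossing vector without its orientation: with a vector, its negative qualifies as
  well.\<close>

definition primitive_normal :: "real ^ 'n \<Rightarrow> (real ^ 'n) set \<Rightarrow> bool" where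
  "primitive_normal x \<sigma> \<longleftrightarrow>
     x \<in> perp_integer_points \<sigma> \<and> (\<forall>y\<in>perp_integer_points \<sigma>. norm x \<le> norm y)"

lemma primitive_normal_is_normal: "primitive_normal x \<sigma> \<Longrightarrow> is_normal x \<sigma>"
  by (auto simp: primitive_normal_def perp_integer_points_def is_normal_def)

lemma primitive_normal_integer: "primitive_normal x \<sigma> \<Longrightarrow> x \<in> integer_points"
  by (auto simp: primitive_normal_def perp_integer_points_def)

text \<open>Squared lengths of integer vectors are natural numbers, so a minimum is
  attained.\<close>

lemma primitive_normal_exists:
  assumes "perp_integer_points \<sigma> \<noteq> {}" obtains x where "primitive_normal x \<sigma>"
proof -
  let ?m = "\<lambda>x::real^'n. nat \<lfloor>x \<bullet> x\<rfloor>"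
  obtain x where x: "x \<in> perp_integer_points \<sigma>" "\<And>y. y \<in> perp_integer_points \<sigma> \<Longrightarrow> ?m x \<le> ?m y"
    using ex_has_least_nat[of "\<lambda>x. x \<in> perp_integer_points \<sigma>" _ ?m] assms by blast
  have eq: "real (?m y) = y \<bullet> y" if "y \<in> perp_integer_points \<sigma>" for y
  proof -
    have "y \<bullet> y \<in> \<int>" using that integer_points_inner by (auto simp: perp_integer_points_def)
    then show ?thesis by (metis Ints_cases floor_of_int inner_ge_zero int_nat_eq of_int_0_le_iff of_int_of_nat_eq)
  qed
  have "norm x \<le> norm y" if "y \<in> perp_integer_points \<sigma>" for y
    using x(2)[OF that] eq[OF that] eq[OF x(1)] by (metis norm_le of_nat_le_iff)
  then show ?thesis using that x(1) by (auto simp: primitive_normal_def)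
qed

text \<open>The least positive value \<open>g\<close> of \<open>x \<bullet> b\<close> on integer
  vectors divides all the others, so it is the gcd of the coordinates of \<open>x\<close>. Then
  \<open>x\<close> divided by \<open>g\<close> is again an integer normal, and minimality of the
  norm gives \<open>g = 1\<close>.\<close>

lemma primitive_normal_bezout:
  assumes "primitive_normal x \<sigma>"
  obtains b where "b \<in> integer_points" "x \<bullet> b = 1"
proof -
  have xi: "x \<in> integer_points" and x0: "x \<noteq> 0" and perp: "\<And>y. y \<in> parallel_space \<sigma> \<Longrightarrow> x \<bullet> y = 0"
    using assms by (auto simp: primitive_normal_def perp_integer_points_def)
  let ?S = "\<lambda>k::nat. k > 0 \<and> (\<exists>b\<in>integer_points. x \<bullet> b = real k)"
  have "\<exists>k. ?S k"
  proof -
    obtain m where m: "x \<bullet> x = of_int m" using integer_points_inner[OF xi xi] by (auto elim: Ints_cases)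
    moreover have "x \<bullet> x > 0" using x0 by simp
    ultimately have "m > 0" by simp
    then have "?S (nat m)" using m xi by auto
    then show ?thesis by blast
  qed
  then have L: "?S (LEAST k. ?S k)" by (rule LeastI_ex)
  define g where "g = (LEAST k. ?S k)"
  obtain b0 where b0: "b0 \<in> integer_points" "x \<bullet> b0 = real g" and g0: "g > 0"
    using L unfolding g_def by blast
  have dvd: "\<exists>k::int. x \<bullet> b = real g * of_int k" if bi: "b \<in> integer_points" for b
  proof -
    obtain m where m: "x \<bullet> b = of_int m" using integer_points_inner[OF xi bi] by (auto elim: Ints_cases)
    let ?b = "b - of_int (m div int g) *\<^sub>R b0"
    have "?b \<in> integer_points" using bi b0 by (intro integer_points_diff integer_points_scale) auto
    have "x \<bullet> ?b = of_int m - of_int (m div int g) * of_int (int g)"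
      by (simp add: inner_diff_right m b0)
    also have "\<dots> = of_int (m - (m div int g) * int g)" by simp
    also have "m - (m div int g) * int g = m mod int g" by (simp add: minus_div_mult_eq_mod)
    finally have xb: "x \<bullet> ?b = real (nat (m mod int g))" using g0 by simp
    have "m mod int g = 0"
    proof (rule ccontr)
      assume "m mod int g \<noteq> 0"
      then have pos: "nat (m mod int g) > 0"
        using g0 by (smt (verit) of_nat_0_less_iff pos_mod_sign zero_less_nat_eq)
      then have "?S (nat (m mod int g))" using xb \<open>?b \<in> integer_points\<close> by blast
      then have "g \<le> nat (m mod int g)" unfolding g_def by (rule Least_le)
      moreover have "nat (m mod int g) < g" using g0 by (simp add: nat_less_iff)
      ultimately show False by simp
    qed
    then have "m = int g * (m div int g)" by (metis add.right_neutral mult_div_mod_eq)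
    then have "x \<bullet> b = real g * of_int (m div int g)" using m by (metis of_int_mult of_int_of_nat_eq)
    then show ?thesis by blast
  qed
  let ?y = "(1 / real g) *\<^sub>R x"
  have "?y $ i \<in> \<int>" for i
  proof -
    obtain k :: int where "x \<bullet> axis i 1 = real g * of_int k" using dvd axis_integer_points by blast
    then have "?y $ i = of_int k" using g0 by (simp add: inner_axis)
    then show ?thesis by simp
  qed
  then have "?y \<in> perp_integer_points \<sigma>"
    using x0 g0 perp by (auto simp: perp_integer_points_def integer_points_def)
  then have "norm x \<le> norm ?y" using assms unfolding primitive_normal_def by blast
  then have "norm x * real g \<le> norm x" using g0 by (simp add: field_simps)
  then have "g \<le> 1" using x0 by simp
  then have "x \<bullet> b0 = 1" using g0 b0 by simp
  then show ?thesis using that b0 by blast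
qed

locale rational_hypersurface_complex = hypersurface_complex K for K :: "(real ^ 'n) set set" +
  assumes rational: "rational_complex (CARD('n) - 1) K"
begin

text \<open>By rationality the lattice of \<sigma> spans its parallel space, so orthogonality need
  only be tested on integer vectors, and there it survives applying \<phi> to the coordinates of a
  real normal. Choosing \<phi> nonzero at a nonzero coordinate keeps the vector nonzero; clearing
  denominators makes it integral.\<close>

lemma integer_normal_exists:
  assumes "\<sigma> \<in> M" shows "perp_integer_points \<sigma> \<noteq> {}"
proof -
  have ne: "\<sigma> \<noteq> {}" using assms M_K cell(4) by blast
  have "int (dim (cell_lattice \<sigma>)) = aff_dim \<sigma>"
    using rational assms by (auto simp: rational_complex_def M_def)
  then have dimeq: "dim (parallel_space \<sigma>) = dim (cell_lattice \<sigma>)"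
    using aff_dim_parallel_space[OF ne] by simp
  have "span (cell_lattice \<sigma>) = span (parallel_space \<sigma>)"
    by (rule dim_eq_span) (auto simp: cell_lattice_def dimeq)
  then have span: "span (cell_lattice \<sigma>) = parallel_space \<sigma>"
    by (simp add: span_eq_iff[THEN iffD2])
  obtain n where n: "is_normal n \<sigma>" using exists_normal assms by blast
  then obtain j where j: "n $ j \<noteq> 0" by (auto simp: is_normal_def vec_eq_iff)
  obtain \<phi> where \<phi>: "\<And>x y. \<phi> (x + y) = \<phi> x + \<phi> y" "\<And>r x. r \<in> \<rat> \<Longrightarrow> \<phi> (r * x) = r * \<phi> x"
    "\<And>x. \<phi> x \<in> \<rat>" "\<phi> (n $ j) \<noteq> 0" using rational_linear_functional[OF j] by blast
  define x :: "real ^ 'n" where "x = (\<chi> i. \<phi> (n $ i))"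
  have "x \<bullet> b = 0" if "b \<in> cell_lattice \<sigma>" for b
  proof -
    have b: "b \<in> integer_points" "n \<bullet> b = 0" using that n by (auto simp: cell_lattice_def is_normal_def)
    have "\<phi> (n $ i * b $ i) = \<phi> (n $ i) * b $ i" for i
      using \<phi>(2)[of "b $ i" "n $ i"] b(1) Ints_subset_Rats by (auto simp: integer_points_def mult.commute)
    then have "\<phi> (n \<bullet> b) = x \<bullet> b"
      by (simp add: inner_vec_def x_def rational_linear_sum[of \<phi>, OF \<phi>(1)])
    moreover have "\<phi> 0 = 0" using \<phi>(1)[of 0 0] by simp
    ultimately show ?thesis using b(2) by simp
  qed
  then have perp: "x \<bullet> b = 0" if "b \<in> parallel_space \<sigma>" for b
    using that span_induct[of b "cell_lattice \<sigma>" "\<lambda>b. x \<bullet> b = 0"] subspace_hyperplane[of x] span by auto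
  obtain N where N: "N > 0" "\<forall>i\<in>UNIV. real N * \<phi> (n $ i) \<in> \<int>"
    using common_denominator[of UNIV "\<lambda>i. \<phi> (n $ i)"] \<phi>(3) by auto
  have "x $ j \<noteq> 0" using \<phi>(4) by (simp add: x_def)
  then have "x \<noteq> 0" by auto
  then have "real N *\<^sub>R x \<in> perp_integer_points \<sigma>"
    using N perp by (simp add: perp_integer_points_def integer_points_def x_def)
  then show ?thesis by blast
qed

lemma star_nonempty: assumes "\<tau> \<in> Rd" shows "star \<tau> \<noteq> {}"
proof -
  have "aff_dim \<tau> < int (CARD('n) - 1)" using aff_dim_Rd[OF assms] by (simp add: int_card_pred)
  then obtain \<sigma> where "\<sigma> \<in> M" "\<tau> face_of \<sigma>"
    using pure Rd_K[OF assms] unfolding pure_complex_def M_def by blast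
  then show ?thesis by (auto simp: star_def)
qed

lemma star_parallel: "\<sigma> \<in> star \<tau> \<Longrightarrow> v \<in> parallel_space \<tau> \<Longrightarrow> v \<in> parallel_space \<sigma>"
  using parallel_space_mono[OF face_of_imp_subset] unfolding star_def by blast

text \<open>Modulo the lattice of the ridge, the integer lattice has rank two; \<open>\<alpha>\<close> and \<open>\<beta>\<close> are
  coordinates on the quotient, and there the primitive normal of a cell is its lattice normal
  rotated by a right angle.\<close>

lemma ridge_coordinates:
  assumes "\<tau> \<in> Rd" and z: "\<And>\<sigma>. \<sigma> \<in> star \<tau> \<Longrightarrow> lattice_normal \<tau> \<sigma> (z \<sigma>)"
    and X: "\<And>\<sigma>. \<sigma> \<in> star \<tau> \<Longrightarrow> primitive_normal (X \<sigma>) \<sigma>"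
  obtains \<alpha> \<beta> where "\<And>v. v \<in> parallel_space \<tau> \<longleftrightarrow> \<alpha> \<bullet> v = 0 \<and> \<beta> \<bullet> v = 0"
    "\<And>a b. a *\<^sub>R \<alpha> + b *\<^sub>R \<beta> = 0 \<Longrightarrow> a = 0 \<and> b = 0"
    "\<And>\<sigma>. \<sigma> \<in> star \<tau> \<Longrightarrow> X \<sigma> = (\<beta> \<bullet> z \<sigma>) *\<^sub>R \<alpha> - (\<alpha> \<bullet> z \<sigma>) *\<^sub>R \<beta> \<or>
       X \<sigma> = - ((\<beta> \<bullet> z \<sigma>) *\<^sub>R \<alpha> - (\<alpha> \<bullet> z \<sigma>) *\<^sub>R \<beta>)"
proof -
  have lat: "cell_lattice \<sigma> = {y + of_int m *\<^sub>R z \<sigma> |y (m::int). y \<in> cell_lattice \<tau>}"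
    and zl: "z \<sigma> \<in> integer_points" "z \<sigma> \<in> parallel_space \<sigma>" if "\<sigma> \<in> star \<tau>" for \<sigma>
    using z[OF that] unfolding lattice_normal_def cell_lattice_def by auto
  have perp: "X \<sigma> \<bullet> v = 0 \<longleftrightarrow> v \<in> parallel_space \<sigma>" if "\<sigma> \<in> star \<tau>" for \<sigma> v
    using parallel_space_M[OF star_M[OF that] primitive_normal_is_normal[OF X[OF that]]] by simp
  obtain \<sigma>0 where s0: "\<sigma>0 \<in> star \<tau>" using star_nonempty assms(1) by blast
  \<comment> \<open>One cell of the star serves as reference: its primitive normal is the first
    coordinate on the quotient, and its lattice normal one of the two generators.\<close>
  define \<alpha> z0 where "\<alpha> = X \<sigma>0" and "z0 = z \<sigma>0"
  obtain b0 where b0: "b0 \<in> integer_points" "\<alpha> \<bullet> b0 = 1"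
    using primitive_normal_bezout[OF X[OF s0]] unfolding \<alpha>_def by blast
  have \<alpha>i: "\<alpha> \<in> integer_points" using primitive_normal_integer[OF X[OF s0]] by (simp add: \<alpha>_def)
  have \<alpha>z0: "\<alpha> \<bullet> z0 = 0" using perp[OF s0] zl[OF s0] by (simp add: \<alpha>_def z0_def)
  have z0i: "z0 \<in> integer_points" using zl[OF s0] by (simp add: z0_def)
  have \<alpha>\<tau>: "\<alpha> \<bullet> v = 0" if "v \<in> parallel_space \<tau>" for v
    using perp[OF s0] star_parallel[OF s0 that] by (simp add: \<alpha>_def)
  \<comment> \<open>Otherwise the whole lattice of \<open>\<sigma>0\<close> would lie in the
    parallel space of \<tau>, too small for its rank.\<close>
  have z0\<tau>: "z0 \<notin> parallel_space \<tau>"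
  proof
    assume "z0 \<in> parallel_space \<tau>"
    then have "cell_lattice \<sigma>0 \<subseteq> parallel_space \<tau>"
      using lat[OF s0] by (auto simp: z0_def cell_lattice_def intro!: subspace_add subspace_scale)
    then have "dim (cell_lattice \<sigma>0) \<le> dim (parallel_space \<tau>)" by (rule dim_subset)
    moreover have "int (dim (cell_lattice \<sigma>0)) = aff_dim \<sigma>0"
      using rational star_M[OF s0] by (auto simp: rational_complex_def M_def)
    ultimately show False
      using aff_dim_parallel_space[OF cell(4)[OF Rd_K[OF assms(1)]]] aff_dim_Rd[OF assms(1)]
        aff_dim_M[OF star_M[OF s0]] by simp
  qed
  obtain \<beta>0 where \<beta>0: "\<beta>0 \<bullet> z0 = 1" "\<And>v. v \<in> parallel_space \<tau> \<Longrightarrow> \<beta>0 \<bullet> v = 0"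
  proof -
    obtain y w where yw: "y \<in> span (parallel_space \<tau>)" "\<And>v. v \<in> span (parallel_space \<tau>) \<Longrightarrow> orthogonal w v" "z0 = y + w"
      using orthogonal_subspace_decomp_exists[of "parallel_space \<tau>" z0] by blast
    have sp: "span (parallel_space \<tau>) = parallel_space \<tau>" by (simp add: span_eq_iff[THEN iffD2])
    have "w \<noteq> 0" using yw z0\<tau> sp by auto
    moreover have "w \<bullet> z0 = w \<bullet> w" using yw by (simp add: inner_add_right orthogonal_def)
    ultimately show ?thesis
      using that[of "(1 / (w \<bullet> w)) *\<^sub>R w"] yw(2) sp by (simp add: orthogonal_def)
  qed
  \<comment> \<open>The multiple of \<alpha> is subtracted to make the pair \<alpha>, \<beta> dual
    to the pair \<open>b0\<close>, \<open>z0\<close>.\<close>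
  define \<beta> where "\<beta> = \<beta>0 - (\<beta>0 \<bullet> b0) *\<^sub>R \<alpha>"
  have \<beta>: "\<beta> \<bullet> z0 = 1" "\<beta> \<bullet> b0 = 0" "\<And>v. v \<in> parallel_space \<tau> \<Longrightarrow> \<beta> \<bullet> v = 0"
    using \<beta>0 \<alpha>z0 b0 \<alpha>\<tau> by (auto simp: \<beta>_def inner_diff_left)
  \<comment> \<open>\<open>z0\<close> and \<open>b0\<close> generate the integer vectors modulo the
    parallel space of \<tau>: a multiple of \<open>b0\<close> brings \<open>b\<close> into the
    lattice of \<open>\<sigma>0\<close>, where the defining property of the lattice normal
    applies.\<close>
  have decomp: "\<exists>y m n. b = y + of_int m *\<^sub>R z0 + of_int n *\<^sub>R b0 \<and> y \<in> parallel_space \<tau> \<and>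
       \<alpha> \<bullet> b = of_int n \<and> \<beta> \<bullet> b = of_int m" if b: "b \<in> integer_points" for b
  proof -
    obtain n where n: "\<alpha> \<bullet> b = of_int n" using integer_points_inner[OF \<alpha>i b] by (auto elim: Ints_cases)
    let ?w = "b - of_int n *\<^sub>R b0"
    have "?w \<in> integer_points" using b b0 by (intro integer_points_diff integer_points_scale) auto
    moreover have "X \<sigma>0 \<bullet> ?w = 0" using n b0 by (simp add: inner_diff_right flip: \<alpha>_def)
    ultimately have "?w \<in> cell_lattice \<sigma>0" using perp[OF s0] by (simp add: cell_lattice_def)
    then obtain y m where y: "?w = y + of_int m *\<^sub>R z0" "y \<in> cell_lattice \<tau>"
      using lat[OF s0] by (auto simp: z0_def)
    then have beq: "b = y + of_int m *\<^sub>R z0 + of_int n *\<^sub>R b0" by (simp add: algebra_simps)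
    have yt: "y \<in> parallel_space \<tau>" using y(2) by (simp add: cell_lattice_def)
    have "\<beta> \<bullet> b = of_int m" using \<beta> yt by (simp add: beq inner_add_right)
    then show ?thesis using beq yt n by blast
  qed
  show ?thesis
  proof (rule that[of \<alpha> \<beta>])
    show "v \<in> parallel_space \<tau> \<longleftrightarrow> \<alpha> \<bullet> v = 0 \<and> \<beta> \<bullet> v = 0" for v
    proof -
      have "v \<in> parallel_space \<tau>" if "\<alpha> \<bullet> v = 0" "\<beta> \<bullet> v = 0"
      proof -
        have "v \<in> parallel_space \<sigma>0" using perp[OF s0] that by (simp add: \<alpha>_def)
        then show ?thesis
          using ridge_space[OF assms(1) s0, of \<beta> z0 v] \<beta> zl[OF s0] that(2) by (simp add: z0_def)
      qed
      then show ?thesis using \<alpha>\<tau> \<beta>(3) by blast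
    qed
    show "a = 0 \<and> b = 0" if "a *\<^sub>R \<alpha> + b *\<^sub>R \<beta> = 0" for a b
    proof -
      have "(a *\<^sub>R \<alpha> + b *\<^sub>R \<beta>) \<bullet> z0 = b" "(a *\<^sub>R \<alpha> + b *\<^sub>R \<beta>) \<bullet> b0 = a"
        using \<beta> \<alpha>z0 b0 by (simp_all add: inner_add_left)
      then show ?thesis using that by (metis inner_zero_left)
    qed
    fix \<sigma> assume s: "\<sigma> \<in> star \<tau>"
    have Xi: "X \<sigma> \<in> integer_points" using primitive_normal_integer[OF X[OF s]] .
    obtain b where b: "b \<in> integer_points" "X \<sigma> \<bullet> b = 1" using primitive_normal_bezout[OF X[OF s]] .
    obtain s' where s': "X \<sigma> \<bullet> z0 = of_int s'" using integer_points_inner[OF Xi z0i] by (auto elim: Ints_cases)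
    obtain t where t: "X \<sigma> \<bullet> b0 = of_int t" using integer_points_inner[OF Xi b0(1)] by (auto elim: Ints_cases)
    have X\<tau>: "X \<sigma> \<bullet> v = 0" if "v \<in> parallel_space \<tau>" for v
      using perp[OF s] star_parallel[OF s that] by simp
    have Xint: "X \<sigma> \<bullet> c = of_int s' * (\<beta> \<bullet> c) + of_int t * (\<alpha> \<bullet> c)" if "c \<in> integer_points" for c
    proof -
      obtain y m n where c: "c = y + of_int m *\<^sub>R z0 + of_int n *\<^sub>R b0" "y \<in> parallel_space \<tau>"
        "\<alpha> \<bullet> c = of_int n" "\<beta> \<bullet> c = of_int m" using decomp \<open>c \<in> integer_points\<close> by blast
      have "X \<sigma> \<bullet> c = of_int m * of_int s' + of_int n * of_int t"
        by (subst c(1)) (simp add: inner_add_right X\<tau>[OF c(2)] s' t)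
      then show ?thesis using c(3,4) by simp
    qed
    have Xeq: "X \<sigma> = of_int s' *\<^sub>R \<beta> + of_int t *\<^sub>R \<alpha>"
    proof -
      have "X \<sigma> - (of_int s' *\<^sub>R \<beta> + of_int t *\<^sub>R \<alpha>) = 0"
        by (rule vec_eq_0_if_orthogonal_integer) (simp add: inner_diff_left inner_add_left Xint)
      then show ?thesis by simp
    qed
    obtain m n where mn: "\<alpha> \<bullet> z \<sigma> = of_int n" "\<beta> \<bullet> z \<sigma> = of_int m" using decomp[OF zl(1)[OF s]] by blast
    obtain m' n' where mn': "\<alpha> \<bullet> b = of_int n'" "\<beta> \<bullet> b = of_int m'" using decomp[OF b(1)] by blast
    have one: "s' * m' + t * n' = 1"
    proof -
      have "real_of_int (s' * m' + t * n') = 1" using Xint[OF b(1)] b(2) mn' by simp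
      then show ?thesis by linarith
    qed
    \<comment> \<open>In the coordinates \<alpha>, \<beta> this is \<open>X \<sigma>\<close> turned
      by a right angle. It lies in the lattice of \<sigma>, so modulo the parallel space of \<tau>
      it is an integer multiple \<open>k\<close> of \<open>z \<sigma>\<close>; the relation
      \<open>X \<sigma> \<bullet> b = 1\<close> then forces \<open>k\<close> to be a unit.\<close>
    let ?w = "of_int t *\<^sub>R z0 - of_int s' *\<^sub>R b0"
    have "?w \<in> integer_points" using z0i b0 by (intro integer_points_diff integer_points_scale) auto
    moreover have "X \<sigma> \<bullet> ?w = 0" by (simp add: inner_diff_right s' t)
    ultimately have "?w \<in> cell_lattice \<sigma>" using perp[OF s] by (simp add: cell_lattice_def)
    then obtain y k where yk: "?w = y + of_int k *\<^sub>R z \<sigma>" "y \<in> cell_lattice \<tau>" using lat[OF s] by auto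
    have y\<tau>: "y \<in> parallel_space \<tau>" using yk(2) by (simp add: cell_lattice_def)
    have "\<alpha> \<bullet> ?w = of_int (k * n)" by (simp add: yk(1) inner_add_right \<alpha>\<tau>[OF y\<tau>] mn)
    moreover have "\<alpha> \<bullet> ?w = of_int (- s')" by (simp add: inner_diff_right \<alpha>z0 b0)
    ultimately have e1: "s' = - (k * n)" by (metis add.inverse_inverse of_int_eq_iff)
    have "\<beta> \<bullet> ?w = of_int (k * m)" by (simp add: yk(1) inner_add_right \<beta>(3)[OF y\<tau>] mn)
    moreover have "\<beta> \<bullet> ?w = of_int t" by (simp add: inner_diff_right \<beta>)
    ultimately have e2: "t = k * m" by (metis of_int_eq_iff)
    have "k * (m * n' - n * m') = 1" using one e1 e2 by (simp add: algebra_simps)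
    then have "k = 1 \<or> k = - 1" by (metis zmult_eq_1_iff)
    moreover have "X \<sigma> = of_int k *\<^sub>R ((\<beta> \<bullet> z \<sigma>) *\<^sub>R \<alpha> - (\<alpha> \<bullet> z \<sigma>) *\<^sub>R \<beta>)"
      by (simp add: Xeq e1 e2 mn algebra_simps)
    ultimately show "X \<sigma> = (\<beta> \<bullet> z \<sigma>) *\<^sub>R \<alpha> - (\<alpha> \<bullet> z \<sigma>) *\<^sub>R \<beta> \<or>
       X \<sigma> = - ((\<beta> \<bullet> z \<sigma>) *\<^sub>R \<alpha> - (\<alpha> \<bullet> z \<sigma>) *\<^sub>R \<beta>)" by auto
  qed
qed

text \<open>\<open>D \<sigma>\<close> is the image of \<open>z \<sigma>\<close> under a linear map
  that is injective modulo the parallel space of \<tau>, so balancing says that the weighted sum of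
  the \<open>D \<sigma>\<close> vanishes. The vector \<open>h\<close> is chosen with
  \<open>h \<bullet> z \<sigma> = D \<sigma> \<bullet> u\<close>: orienting
  \<open>X \<sigma>\<close> along \<open>u\<close> amounts to multiplying \<open>D \<sigma>\<close>
  by the sign of this number, and the vanishing sum splits into two equal ones.\<close>

lemma balanced_iff_sides:
  assumes "\<tau> \<in> Rd" and z: "\<And>\<sigma>. \<sigma> \<in> star \<tau> \<Longrightarrow> lattice_normal \<tau> \<sigma> (z \<sigma>)"
    and X: "\<And>\<sigma>. \<sigma> \<in> star \<tau> \<Longrightarrow> primitive_normal (X \<sigma>) \<sigma>"
    and u: "\<And>\<sigma>. \<sigma> \<in> star \<tau> \<Longrightarrow> X \<sigma> \<bullet> u \<noteq> 0"
  obtains h where "\<And>v. v \<in> parallel_space \<tau> \<Longrightarrow> h \<bullet> v = 0" "h \<bullet> u = 0"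
    "\<And>v. h \<bullet> v = 0 \<Longrightarrow> \<exists>s. v - s *\<^sub>R u \<in> parallel_space \<tau>"
    "\<And>\<sigma>. \<sigma> \<in> star \<tau> \<Longrightarrow> h \<bullet> z \<sigma> \<noteq> 0"
    "\<And>\<omega>. (\<Sum>\<sigma>\<in>star \<tau>. \<omega> \<sigma> *\<^sub>R z \<sigma>) \<in> parallel_space \<tau> \<longleftrightarrow>
       (\<Sum>\<sigma> | \<sigma> \<in> star \<tau> \<and> h \<bullet> z \<sigma> > 0. \<omega> \<sigma> *\<^sub>R sgn (X \<sigma> \<bullet> u) *\<^sub>R X \<sigma>) =
       (\<Sum>\<sigma> | \<sigma> \<in> star \<tau> \<and> h \<bullet> z \<sigma> < 0. \<omega> \<sigma> *\<^sub>R sgn (X \<sigma> \<bullet> u) *\<^sub>R X \<sigma>)"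
proof -
  obtain \<alpha> \<beta> where ab: "\<And>v. v \<in> parallel_space \<tau> \<longleftrightarrow> \<alpha> \<bullet> v = 0 \<and> \<beta> \<bullet> v = 0"
    "\<And>a b. a *\<^sub>R \<alpha> + b *\<^sub>R \<beta> = 0 \<Longrightarrow> a = 0 \<and> b = 0"
    "\<And>\<sigma>. \<sigma> \<in> star \<tau> \<Longrightarrow> X \<sigma> = (\<beta> \<bullet> z \<sigma>) *\<^sub>R \<alpha> - (\<alpha> \<bullet> z \<sigma>) *\<^sub>R \<beta> \<or>
       X \<sigma> = - ((\<beta> \<bullet> z \<sigma>) *\<^sub>R \<alpha> - (\<alpha> \<bullet> z \<sigma>) *\<^sub>R \<beta>)"
    using ridge_coordinates[of \<tau> z X] assms(1-3) by blast
  define D where "D = (\<lambda>\<sigma>. (\<beta> \<bullet> z \<sigma>) *\<^sub>R \<alpha> - (\<alpha> \<bullet> z \<sigma>) *\<^sub>R \<beta>)"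
  define h where "h = (\<alpha> \<bullet> u) *\<^sub>R \<beta> - (\<beta> \<bullet> u) *\<^sub>R \<alpha>"
  have XD: "X \<sigma> = D \<sigma> \<or> X \<sigma> = - D \<sigma>" if "\<sigma> \<in> star \<tau>" for \<sigma> using ab(3)[OF that] by (simp add: D_def)
  have hz: "h \<bullet> z \<sigma> = D \<sigma> \<bullet> u" for \<sigma> by (simp add: h_def D_def inner_diff_left)
  have hz0: "h \<bullet> z \<sigma> \<noteq> 0" if "\<sigma> \<in> star \<tau>" for \<sigma>
    using u[OF that] XD[OF that] hz by auto
  have sX: "sgn (X \<sigma> \<bullet> u) *\<^sub>R X \<sigma> = sgn (h \<bullet> z \<sigma>) *\<^sub>R D \<sigma>" if "\<sigma> \<in> star \<tau>" for \<sigma>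
    using XD[OF that] hz[of \<sigma>] by (auto simp: sgn_minus)
  show ?thesis
  proof (rule that[of h])
    show "h \<bullet> v = 0" if "v \<in> parallel_space \<tau>" for v using that ab(1) by (simp add: h_def inner_diff_left)
    show "h \<bullet> u = 0" by (simp add: h_def inner_diff_left)
    show "\<exists>s. v - s *\<^sub>R u \<in> parallel_space \<tau>" if v: "h \<bullet> v = 0" for v
    proof -
      \<comment> \<open>The coordinates of \<open>v\<close> are proportional to those of
        \<open>u\<close>, which are not both zero, so subtracting one multiple of \<open>u\<close>
        kills both.\<close>
      have eq: "(\<alpha> \<bullet> u) * (\<beta> \<bullet> v) = (\<beta> \<bullet> u) * (\<alpha> \<bullet> v)" using v by (simp add: h_def inner_diff_left)
      obtain \<sigma> where "\<sigma> \<in> star \<tau>" using star_nonempty assms(1) by blast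
      then have "D \<sigma> \<bullet> u \<noteq> 0" using hz0 hz by simp
      then have "\<alpha> \<bullet> u \<noteq> 0 \<or> \<beta> \<bullet> u \<noteq> 0" by (auto simp: D_def inner_diff_left)
      then show ?thesis
      proof
        assume a: "\<alpha> \<bullet> u \<noteq> 0"
        then have "v - ((\<alpha> \<bullet> v) / (\<alpha> \<bullet> u)) *\<^sub>R u \<in> parallel_space \<tau>"
          unfolding ab(1) using eq by (simp add: inner_diff_right field_simps)
        then show ?thesis by blast
      next
        assume a: "\<beta> \<bullet> u \<noteq> 0"
        then have "v - ((\<beta> \<bullet> v) / (\<beta> \<bullet> u)) *\<^sub>R u \<in> parallel_space \<tau>"
          unfolding ab(1) using eq by (simp add: inner_diff_right field_simps)
        then show ?thesis by blast
      qed
    qed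
    show "h \<bullet> z \<sigma> \<noteq> 0" if "\<sigma> \<in> star \<tau>" for \<sigma> using hz0 that .
    fix \<omega> :: "(real ^ 'n) set \<Rightarrow> real"
    let ?P = "{\<sigma> \<in> star \<tau>. h \<bullet> z \<sigma> > 0}" and ?N = "{\<sigma> \<in> star \<tau>. h \<bullet> z \<sigma> < 0}"
    have un: "star \<tau> = ?P \<union> ?N" using hz0 by force
    let ?S = "\<Sum>\<sigma>\<in>star \<tau>. \<omega> \<sigma> *\<^sub>R z \<sigma>"
    have "(\<Sum>\<sigma>\<in>star \<tau>. \<omega> \<sigma> *\<^sub>R D \<sigma>) = (\<beta> \<bullet> ?S) *\<^sub>R \<alpha> + (- (\<alpha> \<bullet> ?S)) *\<^sub>R \<beta>"
      by (simp add: D_def inner_sum_right scaleR_sum_left scaleR_diff_right sum_subtractf)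
    then have 1: "?S \<in> parallel_space \<tau> \<longleftrightarrow> (\<Sum>\<sigma>\<in>star \<tau>. \<omega> \<sigma> *\<^sub>R D \<sigma>) = 0"
      using ab(1)[of ?S] ab(2)[of "\<beta> \<bullet> ?S" "- (\<alpha> \<bullet> ?S)"] by auto
    have "(\<Sum>\<sigma>\<in>star \<tau>. \<omega> \<sigma> *\<^sub>R D \<sigma>) = (\<Sum>\<sigma>\<in>?P. \<omega> \<sigma> *\<^sub>R D \<sigma>) + (\<Sum>\<sigma>\<in>?N. \<omega> \<sigma> *\<^sub>R D \<sigma>)"
      by (subst un, rule sum.union_disjoint) auto
    also have "(\<Sum>\<sigma>\<in>?P. \<omega> \<sigma> *\<^sub>R D \<sigma>) = (\<Sum>\<sigma>\<in>?P. \<omega> \<sigma> *\<^sub>R sgn (X \<sigma> \<bullet> u) *\<^sub>R X \<sigma>)"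
      using sX by (intro sum.cong) auto
    also have "(\<Sum>\<sigma>\<in>?N. \<omega> \<sigma> *\<^sub>R D \<sigma>) = - (\<Sum>\<sigma>\<in>?N. \<omega> \<sigma> *\<^sub>R sgn (X \<sigma> \<bullet> u) *\<^sub>R X \<sigma>)"
      unfolding sum_negf[symmetric] using sX by (intro sum.cong) auto
    finally show "?S \<in> parallel_space \<tau> \<longleftrightarrow>
       (\<Sum>\<sigma>\<in>?P. \<omega> \<sigma> *\<^sub>R sgn (X \<sigma> \<bullet> u) *\<^sub>R X \<sigma>) = (\<Sum>\<sigma>\<in>?N. \<omega> \<sigma> *\<^sub>R sgn (X \<sigma> \<bullet> u) *\<^sub>R X \<sigma>)"
      using 1 by simp
  qed
qed

end

section \<open>The potential of a balanced complex\<close>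

context hypersurface_complex
begin

definition hit :: "real ^ 'n \<Rightarrow> (real ^ 'n) set \<Rightarrow> real ^ 'n \<Rightarrow> bool" where
  "hit u \<sigma> y \<longleftrightarrow> (\<exists>t>0. y - t *\<^sub>R u \<in> \<sigma>)"

definition potential :: "real ^ 'n \<Rightarrow> ((real ^ 'n) set \<Rightarrow> real ^ 'n) \<Rightarrow> real ^ 'n \<Rightarrow> real ^ 'n" where
  "potential u n y = (\<Sum>\<sigma>\<in>M. if hit u \<sigma> y then n \<sigma> else 0)"

text \<open>Lengths are left free so that the normals can carry the weights.\<close>

definition crossing_normals :: "real ^ 'n \<Rightarrow> ((real ^ 'n) set \<Rightarrow> real ^ 'n) \<Rightarrow> bool" where
  "crossing_normals u n \<longleftrightarrow> (\<forall>\<sigma>\<in>M. is_normal (n \<sigma>) \<sigma> \<and> n \<sigma> \<bullet> u > 0)"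

text \<open>The hyperplane \<open>h\<^sup>\<bottom>\<close> through the ridge contains the direction \<open>u\<close>, and \<open>z \<sigma>\<close> points from the
  ridge into \<open>\<sigma>\<close>: the normals of the cells on both sides of this hyperplane have equal sums.\<close>

definition sides_balanced :: "real ^ 'n \<Rightarrow> ((real ^ 'n) set \<Rightarrow> real ^ 'n) \<Rightarrow> (real ^ 'n) set \<Rightarrow>
    real ^ 'n \<Rightarrow> ((real ^ 'n) set \<Rightarrow> real ^ 'n) \<Rightarrow> bool" where
  "sides_balanced u n \<tau> h z \<longleftrightarrow>
     (\<forall>v\<in>parallel_space \<tau>. h \<bullet> v = 0) \<and> h \<bullet> u = 0 \<and>
     (\<forall>v. h \<bullet> v = 0 \<longrightarrow> (\<exists>s. v - s *\<^sub>R u \<in> parallel_space \<tau>)) \<and>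
     (\<forall>\<sigma>\<in>star \<tau>. z \<sigma> \<in> parallel_space \<sigma> \<and> h \<bullet> z \<sigma> \<noteq> 0 \<and> (\<exists>x\<in>\<tau>. \<exists>l>0. x + l *\<^sub>R z \<sigma> \<in> \<sigma>)) \<and>
     (\<Sum>\<sigma> | \<sigma> \<in> star \<tau> \<and> h \<bullet> z \<sigma> > 0. n \<sigma>) = (\<Sum>\<sigma> | \<sigma> \<in> star \<tau> \<and> h \<bullet> z \<sigma> < 0. n \<sigma>)"

definition crossing_balanced :: "real ^ 'n \<Rightarrow> ((real ^ 'n) set \<Rightarrow> real ^ 'n) \<Rightarrow> bool" where
  "crossing_balanced u n \<longleftrightarrow> (\<forall>\<tau>\<in>Rd. \<exists>h z. sides_balanced u n \<tau> h z)"

lemma transversal_unique: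
  assumes "\<sigma> \<in> M" "is_normal n \<sigma>" "n \<bullet> u \<noteq> 0" "y - t *\<^sub>R u \<in> \<sigma>" "y - t' *\<^sub>R u \<in> \<sigma>"
  shows "t = t'"
proof -
  have "n \<bullet> ((y - t *\<^sub>R u) - (y - t' *\<^sub>R u)) = 0"
    using affine_hull_M[OF assms(1,2,5), of "y - t *\<^sub>R u"] assms(4) by (simp add: hull_inc)
  then show ?thesis using assms(3) by (auto simp: inner_diff_right)
qed

lemma eventually_nhds_open_vimage:
  assumes "continuous_on UNIV f" "open S" "f y \<in> S"
  shows "eventually (\<lambda>x. f x \<in> S) (nhds y)"
  unfolding eventually_nhds using open_vimage[OF assms(2,1)] assms(3)
  by (intro exI[of _ "f -` S"]) auto

text \<open>By transversality the line through \<open>y\<close> in direction \<open>u\<close> meets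
  the affine hull of \<sigma> exactly once, in \<open>p y\<close> at time \<open>t y\<close>. Both
  depend continuously on \<open>y\<close>, which reduces hitting to the sign of \<open>t y\<close>
  and the position of \<open>p y\<close>.\<close>

lemma hit_coordinates:
  assumes "\<sigma> \<in> M" "is_normal n \<sigma>" "n \<bullet> u \<noteq> 0" "a \<in> \<sigma>"
  obtains t p where "continuous_on UNIV t" "continuous_on UNIV p" "\<And>y. p y \<in> affine hull \<sigma>"
    "\<And>y. hit u \<sigma> y \<longleftrightarrow> 0 < t y \<and> p y \<in> \<sigma>"
    "\<And>y. t y = (n \<bullet> (y - a)) / (n \<bullet> u)" "\<And>y. p y = y - t y *\<^sub>R u"
proof -
  define t where "t = (\<lambda>y. (n \<bullet> (y - a)) / (n \<bullet> u))"
  define p where "p = (\<lambda>y. y - t y *\<^sub>R u)"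
  have ct: "continuous_on UNIV t" unfolding t_def by (intro continuous_intros) (use assms(3) in auto)
  have cp: "continuous_on UNIV p" unfolding p_def by (intro continuous_intros ct)
  have pa: "p y \<in> affine hull \<sigma>" for y
    unfolding affine_hull_M[OF assms(1,2,4)] using assms(3) by (simp add: p_def t_def inner_diff_right)
  have "s = t y" if "y - s *\<^sub>R u \<in> \<sigma>" for s y
  proof -
    have "n \<bullet> (y - s *\<^sub>R u - a) = 0"
      using affine_hull_M[OF assms(1,2,4), of "y - s *\<^sub>R u"] that by (simp add: hull_inc)
    then show ?thesis using assms(3) by (simp add: t_def inner_diff_right inner_add_right field_simps)
  qed
  then have "hit u \<sigma> y \<longleftrightarrow> 0 < t y \<and> p y \<in> \<sigma>" for y unfolding hit_def p_def by blast
  then show ?thesis using that[OF ct cp pa] by (simp add: t_def p_def)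
qed

text \<open>Hitting can change only where the ray starts on \<sigma> or meets its relative boundary;
  the assumption \<open>st\<close> excludes both.\<close>

lemma hit_eventually_const:
  assumes "\<sigma> \<in> M" "is_normal n \<sigma>" "n \<bullet> u \<noteq> 0"
    and st: "\<And>t. y - t *\<^sub>R u \<in> \<sigma> \<Longrightarrow> t < 0 \<or> (t \<noteq> 0 \<and> y - t *\<^sub>R u \<in> rel_interior \<sigma>)"
  shows "eventually (\<lambda>y'. hit u \<sigma> y' \<longleftrightarrow> hit u \<sigma> y) (nhds y)"
proof -
  obtain a where "a \<in> \<sigma>" using cell(4) M_K assms(1) by blast
  then obtain t p where ct: "continuous_on UNIV t" and cp: "continuous_on UNIV p"
    and pa: "\<And>y. p y \<in> affine hull \<sigma>" and hit: "\<And>y. hit u \<sigma> y \<longleftrightarrow> 0 < t y \<and> p y \<in> \<sigma>"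
    and p: "\<And>y. p y = y - t y *\<^sub>R u" using hit_coordinates[OF assms(1-3)] by metis
  have "p y \<notin> \<sigma> \<or> t y < 0 \<or> (0 < t y \<and> p y \<in> rel_interior \<sigma>)" using st[of "t y"] p[of y] by fastforce
  then consider "p y \<notin> \<sigma>" | "t y < 0" | "0 < t y" "p y \<in> rel_interior \<sigma>" by blast
  then show ?thesis
  proof cases
    case 1
    have "open (- \<sigma>)" using cell(3) M_K assms(1) by blast
    then have "eventually (\<lambda>y'. p y' \<in> - \<sigma>) (nhds y)"
      using 1 by (intro eventually_nhds_open_vimage[OF cp]) auto
    then show ?thesis by (rule eventually_mono) (use 1 hit in auto)
  next
    case 2
    then have "eventually (\<lambda>y'. t y' \<in> {..<0}) (nhds y)"
      by (intro eventually_nhds_open_vimage[OF ct]) auto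
    then show ?thesis by (rule eventually_mono) (use 2 hit in auto)
  next
    case 3
    obtain O' where O': "open O'" "rel_interior \<sigma> = affine hull \<sigma> \<inter> O'"
      using openin_rel_interior[of \<sigma>] by (auto simp: openin_open)
    have "eventually (\<lambda>y'. p y' \<in> O') (nhds y)"
      using 3 O' by (intro eventually_nhds_open_vimage[OF cp]) auto
    moreover have "eventually (\<lambda>y'. t y' \<in> {0<..}) (nhds y)"
      using 3 by (intro eventually_nhds_open_vimage[OF ct]) auto
    ultimately show ?thesis
    proof eventually_elim
      case (elim y')
      then have "p y' \<in> rel_interior \<sigma>" using O'(2) pa by blast
      then show ?case using hit elim 3 rel_interior_subset by (metis greaterThan_iff subsetD)
    qed
  qed
qed

lemma hit_near_cell:
  assumes "\<sigma> \<in> M" "is_normal n \<sigma>" "n \<bullet> u > 0" "y \<in> rel_interior \<sigma>"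
  shows "eventually (\<lambda>y'. hit u \<sigma> y' \<longleftrightarrow> n \<bullet> (y' - y) > 0) (nhds y)"
proof -
  have ys: "y \<in> \<sigma>" using assms(4) rel_interior_subset by blast
  have nu: "n \<bullet> u \<noteq> 0" using assms(3) by simp
  obtain t p where cp: "continuous_on UNIV p" and pa: "\<And>y. p y \<in> affine hull \<sigma>"
    and hit: "\<And>y. hit u \<sigma> y \<longleftrightarrow> 0 < t y \<and> p y \<in> \<sigma>"
    and t: "\<And>y'. t y' = (n \<bullet> (y' - y)) / (n \<bullet> u)" and p: "\<And>y. p y = y - t y *\<^sub>R u"
    using hit_coordinates[OF assms(1,2) nu ys] by metis
  obtain O' where O': "open O'" "rel_interior \<sigma> = affine hull \<sigma> \<inter> O'"
    using openin_rel_interior[of \<sigma>] by (auto simp: openin_open)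
  have "p y = y" by (simp add: p t)
  then have "eventually (\<lambda>y'. p y' \<in> O') (nhds y)"
    using assms(4) O' by (intro eventually_nhds_open_vimage[OF cp]) auto
  then show ?thesis
  proof (rule eventually_mono)
    fix y' assume "p y' \<in> O'"
    then have "p y' \<in> \<sigma>" using O'(2) pa rel_interior_subset by blast
    then show "hit u \<sigma> y' \<longleftrightarrow> n \<bullet> (y' - y) > 0" using hit assms(3) by (simp add: t zero_less_divide_iff)
  qed
qed

text \<open>Projection along \<open>u\<close> does not change the value of \<open>h\<close>, because
  \<open>h \<bullet> u = 0\<close>. So the half-space description of \<sigma> near the ridge can be
  pulled back to the points near \<open>y\<close>.\<close>

lemma hit_near_ridge:
  assumes "\<sigma> \<in> M" "is_normal n \<sigma>" "n \<bullet> u \<noteq> 0"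
    and \<tau>: "\<tau> \<in> Rd" "\<sigma> \<in> star \<tau>" "t0 > 0" "y - t0 *\<^sub>R u \<in> rel_interior \<tau>"
    and h: "\<And>v. v \<in> parallel_space \<tau> \<Longrightarrow> h \<bullet> v = 0" "h \<bullet> u = 0"
    and z: "z \<in> parallel_space \<sigma>" "h \<bullet> z \<noteq> 0" "x \<in> \<tau>" "l > 0" "x + l *\<^sub>R z \<in> \<sigma>"
  shows "eventually (\<lambda>y'. hit u \<sigma> y' \<longleftrightarrow> 0 \<le> (h \<bullet> (y' - y)) * (h \<bullet> z)) (nhds y)"
proof -
  let ?y0 = "y - t0 *\<^sub>R u"
  have y0: "?y0 \<in> \<sigma>"
    using \<tau>(2,4) rel_interior_subset face_of_imp_subset unfolding star_def by blast
  obtain t p where ct: "continuous_on UNIV t" and cp: "continuous_on UNIV p"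
    and pa: "\<And>y. p y \<in> affine hull \<sigma>" and hit: "\<And>y. hit u \<sigma> y \<longleftrightarrow> 0 < t y \<and> p y \<in> \<sigma>"
    and t: "\<And>y'. t y' = (n \<bullet> (y' - ?y0)) / (n \<bullet> u)" and p: "\<And>y. p y = y - t y *\<^sub>R u"
    using hit_coordinates[OF assms(1-3) y0] by metis
  have ty: "t y = t0" using assms(3) by (simp add: t)
  have py: "p y = ?y0" by (simp add: p ty)
  obtain e where e: "e > 0" "\<And>p. p \<in> affine hull \<sigma> \<Longrightarrow> dist p ?y0 < e \<Longrightarrow>
      (p \<in> \<sigma> \<longleftrightarrow> 0 \<le> (h \<bullet> (p - ?y0)) * (h \<bullet> z))"
    using halfspace_near_ridge[OF \<tau>(1,2,4) h(1) z] by blast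
  have "eventually (\<lambda>y'. t y' \<in> {0<..}) (nhds y)"
    using ty \<tau>(3) by (intro eventually_nhds_open_vimage[OF ct]) auto
  moreover have "eventually (\<lambda>y'. p y' \<in> ball ?y0 e) (nhds y)"
    using py e(1) by (intro eventually_nhds_open_vimage[OF cp]) auto
  ultimately show ?thesis
  proof eventually_elim
    case (elim y')
    have "p y' \<in> \<sigma> \<longleftrightarrow> 0 \<le> (h \<bullet> (p y' - ?y0)) * (h \<bullet> z)"
      using e(2)[OF pa] elim by (simp add: dist_commute)
    also have "h \<bullet> (p y' - ?y0) = h \<bullet> (y' - y)"
      using h(2) by (simp add: p inner_diff_right inner_add_right)
    finally show ?case using hit elim by simp
  qed
qed

text \<open>Off \<open>T u\<close> the line through \<open>y\<close> meets the other maximal cells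
  only in their relative interiors, and none of them at \<open>y\<close> itself. They contribute the
  constant \<open>q\<close>, and only \<sigma> is switched on or off.\<close>

lemma potential_near_cell:
  assumes n: "crossing_normals u n" and "\<sigma> \<in> M" "y \<in> rel_interior \<sigma>" "y \<notin> T u"
  shows "\<exists>q. eventually (\<lambda>y'. potential u n y' = q + (if n \<sigma> \<bullet> (y' - y) > 0 then n \<sigma> else 0)) (nhds y)"
proof -
  have nn: "is_normal (n \<sigma>) \<sigma>" "n \<sigma> \<bullet> u > 0" if "\<sigma> \<in> M" for \<sigma>
    using n that by (auto simp: crossing_normals_def)
  have ev1: "eventually (\<lambda>y'. hit u \<sigma>' y' \<longleftrightarrow> hit u \<sigma>' y) (nhds y)" if s': "\<sigma>' \<in> M - {\<sigma>}" for \<sigma>'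
  proof (rule hit_eventually_const)
    show "\<sigma>' \<in> M" "is_normal (n \<sigma>') \<sigma>'" "n \<sigma>' \<bullet> u \<noteq> 0" using s' nn[of \<sigma>'] by auto
    fix t assume t: "y - t *\<^sub>R u \<in> \<sigma>'"
    have "t \<noteq> 0"
    proof
      assume "t = 0"
      then have "\<sigma>' = \<sigma>" using max_cell_unique[OF assms(2,3), of \<sigma>'] t s' M_K by auto
      then show False using s' by simp
    qed
    obtain c where c: "c \<in> K" "c face_of \<sigma>'" "y - t *\<^sub>R u \<in> rel_interior c"
      using cell_rel_interior[OF M_K t] s' by blast
    have "c \<in> M"
    proof (rule ccontr)
      assume "c \<notin> M"
      then have "y \<in> T u"
        using T_sweepI[of c y t u] c(1) hull_inc[OF subsetD[OF rel_interior_subset c(3)]] by blast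
      then show False using assms(4) by simp
    qed
    then have "\<sigma>' = c"
      using max_cell_unique[OF _ c(3), of \<sigma>'] t s' M_K by blast
    then show "t < 0 \<or> t \<noteq> 0 \<and> y - t *\<^sub>R u \<in> rel_interior \<sigma>'" using c(3) \<open>t \<noteq> 0\<close> by simp
  qed
  have "eventually (\<lambda>y'. \<forall>\<sigma>'\<in>M - {\<sigma>}. hit u \<sigma>' y' \<longleftrightarrow> hit u \<sigma>' y) (nhds y)"
    using ev1 by (intro eventually_ball_finite) auto
  moreover have "eventually (\<lambda>y'. hit u \<sigma> y' \<longleftrightarrow> n \<sigma> \<bullet> (y' - y) > 0) (nhds y)"
    using hit_near_cell assms(2,3) nn by blast
  ultimately have "eventually (\<lambda>y'. potential u n y' =
     (\<Sum>\<sigma>'\<in>M - {\<sigma>}. if hit u \<sigma>' y then n \<sigma>' else 0) + (if n \<sigma> \<bullet> (y' - y) > 0 then n \<sigma> else 0)) (nhds y)"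
  proof eventually_elim
    case (elim y')
    have "potential u n y' = (if hit u \<sigma> y' then n \<sigma> else 0) + (\<Sum>\<sigma>'\<in>M - {\<sigma>}. if hit u \<sigma>' y' then n \<sigma>' else 0)"
      unfolding potential_def by (rule sum.remove) (use assms(2) in auto)
    also have "(\<Sum>\<sigma>'\<in>M - {\<sigma>}. if hit u \<sigma>' y' then n \<sigma>' else 0) = (\<Sum>\<sigma>'\<in>M - {\<sigma>}. if hit u \<sigma>' y then n \<sigma>' else 0)"
      using elim(1) by (intro sum.cong) auto
    finally show ?case using elim(2) by (simp add: add.commute)
  qed
  then show ?thesis by blast
qed

text \<open>Only the cells below the ridges are swept, which leaves codimension at least two, so an
  open connected set stays connected without them. Swept ridges would cut it apart and are excluded
  here.\<close>

definition low_sweeps :: "real ^ 'n \<Rightarrow> (real ^ 'n) set set" where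
  "low_sweeps u = sweep u ` {c \<in> K. aff_dim c < int CARD('n) - 2}"

text \<open>Cells with no ridge on the ray are hit stably. Around a ridge \<tau> on the ray, the
  cells hit from \<open>a\<close> are those on the side of the hyperplane of \<open>h \<tau>\<close>
  where \<open>a\<close> lies, and the normals on both sides have the same sum.\<close>

lemma potential_locally_const:
  assumes n: "crossing_normals u n" and bal: "crossing_balanced u n"
    and "y \<notin> C" "y \<notin> \<Union>(low_sweeps u)"
  shows "\<exists>q. eventually (\<lambda>a. a \<notin> T u \<longrightarrow> potential u n a = q) (nhds y)"
proof -
  have nn: "is_normal (n \<sigma>) \<sigma>" "n \<sigma> \<bullet> u > 0" "n \<sigma> \<bullet> u \<noteq> 0" if "\<sigma> \<in> M" for \<sigma>
    using n that by (auto simp: crossing_normals_def)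
  obtain h z where "\<forall>\<tau>\<in>Rd. sides_balanced u n \<tau> (h \<tau>) (z \<tau>)"
    using bal unfolding crossing_balanced_def by metis
  then have hz: "\<And>\<tau>. \<tau> \<in> Rd \<Longrightarrow> (\<forall>v\<in>parallel_space \<tau>. h \<tau> \<bullet> v = 0) \<and> h \<tau> \<bullet> u = 0 \<and>
     (\<forall>v. h \<tau> \<bullet> v = 0 \<longrightarrow> (\<exists>s. v - s *\<^sub>R u \<in> parallel_space \<tau>)) \<and>
     (\<forall>\<sigma>\<in>star \<tau>. z \<tau> \<sigma> \<in> parallel_space \<sigma> \<and> h \<tau> \<bullet> z \<tau> \<sigma> \<noteq> 0 \<and> (\<exists>x\<in>\<tau>. \<exists>l>0. x + l *\<^sub>R z \<tau> \<sigma> \<in> \<sigma>)) \<and>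
     (\<Sum>\<sigma> | \<sigma> \<in> star \<tau> \<and> h \<tau> \<bullet> z \<tau> \<sigma> > 0. n \<sigma>) = (\<Sum>\<sigma> | \<sigma> \<in> star \<tau> \<and> h \<tau> \<bullet> z \<tau> \<sigma> < 0. n \<sigma>)"
    unfolding sides_balanced_def by blast
  define \<Theta> where "\<Theta> = {\<tau> \<in> Rd. \<exists>t>0. y - t *\<^sub>R u \<in> rel_interior \<tau>}"
  define A where "A = (\<Union>\<tau>\<in>\<Theta>. star \<tau>)"
  have fin: "finite \<Theta>" by (simp add: \<Theta>_def)
  have AM: "A \<subseteq> M" unfolding A_def using star_M by blast
  \<comment> \<open>The ray meets a transversal cell only once, and faces of one cell with a common
    relative interior point coincide; so the contributions of different ridges do not
    overlap.\<close>
  have disj: "star \<tau>1 \<inter> star \<tau>2 = {}" if t12: "\<tau>1 \<in> \<Theta>" "\<tau>2 \<in> \<Theta>" "\<tau>1 \<noteq> \<tau>2" for \<tau>1 \<tau>2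
  proof (rule ccontr)
    assume "star \<tau>1 \<inter> star \<tau>2 \<noteq> {}"
    then obtain \<sigma> where s: "\<sigma> \<in> M" "\<tau>1 face_of \<sigma>" "\<tau>2 face_of \<sigma>" by (auto simp: star_def)
    obtain t1 t2 where t: "y - t1 *\<^sub>R u \<in> rel_interior \<tau>1" "y - t2 *\<^sub>R u \<in> rel_interior \<tau>2"
      using t12 by (auto simp: \<Theta>_def)
    then have "y - t1 *\<^sub>R u \<in> \<sigma>" "y - t2 *\<^sub>R u \<in> \<sigma>"
      using s face_of_imp_subset rel_interior_subset by blast+
    then have "t1 = t2" using transversal_unique[OF s(1) nn(1,3)[OF s(1)]] by blast
    then have "\<tau>1 = \<tau>2" using face_of_eq[OF s(2,3)] t by blast
    then show False using t12(3) by simp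
  qed
  have ev1: "eventually (\<lambda>a. \<forall>\<sigma>\<in>M - A. hit u \<sigma> a \<longleftrightarrow> hit u \<sigma> y) (nhds y)"
  proof (intro eventually_ball_finite ballI)
    fix \<sigma> assume s: "\<sigma> \<in> M - A"
    then have sM: "\<sigma> \<in> M" by simp
    show "eventually (\<lambda>a. hit u \<sigma> a \<longleftrightarrow> hit u \<sigma> y) (nhds y)"
    proof (rule hit_eventually_const[OF sM nn(1,3)[OF sM]])
      fix t assume t: "y - t *\<^sub>R u \<in> \<sigma>"
      have "t \<noteq> 0" using t assms(3) M_K[OF sM] by auto
      obtain c where c: "c \<in> K" "c face_of \<sigma>" "y - t *\<^sub>R u \<in> rel_interior c"
        using cell_rel_interior[OF M_K[OF sM] t] by blast
      have ch: "y - t *\<^sub>R u \<in> affine hull c" using hull_inc[OF subsetD[OF rel_interior_subset c(3)]] .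
      have "y - t *\<^sub>R u \<in> rel_interior \<sigma>" if "t > 0"
      proof (cases "c = \<sigma>")
        case False
        then have lt: "aff_dim c < int CARD('n) - 1"
          using face_of_aff_dim_lt[OF cell(2)[OF M_K[OF sM]] c(2)] aff_dim_M[OF sM] by simp
        have "\<not> aff_dim c < int CARD('n) - 2"
          using assms(4) sweepI[OF ch] c(1) by (auto simp: low_sweeps_def)
        then have "c \<in> Rd" using lt c(1) by (simp add: Rd_def ridges_def int_card_pred)
        then have "c \<in> \<Theta>" using c(3) that by (auto simp: \<Theta>_def)
        then have "\<sigma> \<in> A" using c(2) sM by (auto simp: A_def star_def)
        then show ?thesis using s by simp
      qed (use c in simp)
      then show "t < 0 \<or> t \<noteq> 0 \<and> y - t *\<^sub>R u \<in> rel_interior \<sigma>" using \<open>t \<noteq> 0\<close> by (cases "t > 0") auto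
    qed
  qed simp
  have ev2: "eventually (\<lambda>a. \<forall>\<tau>\<in>\<Theta>. \<forall>\<sigma>\<in>star \<tau>. hit u \<sigma> a \<longleftrightarrow> 0 \<le> (h \<tau> \<bullet> (a - y)) * (h \<tau> \<bullet> z \<tau> \<sigma>)) (nhds y)"
  proof (intro eventually_ball_finite ballI)
    fix \<tau> \<sigma> assume ts: "\<tau> \<in> \<Theta>" "\<sigma> \<in> star \<tau>"
    then have sM: "\<sigma> \<in> M" using star_M by blast
    have tR: "\<tau> \<in> Rd" using ts(1) by (simp add: \<Theta>_def)
    obtain t0 where t0: "t0 > 0" "y - t0 *\<^sub>R u \<in> rel_interior \<tau>" using ts(1) by (auto simp: \<Theta>_def)
    obtain x l where xl: "x \<in> \<tau>" "l > 0" "x + l *\<^sub>R z \<tau> \<sigma> \<in> \<sigma>" using hz[OF tR] ts(2) by blast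
    show "eventually (\<lambda>a. hit u \<sigma> a \<longleftrightarrow> 0 \<le> (h \<tau> \<bullet> (a - y)) * (h \<tau> \<bullet> z \<tau> \<sigma>)) (nhds y)"
      by (rule hit_near_ridge[OF sM nn(1,3)[OF sM] tR ts(2) t0 _ _ _ _ xl]) (use hz[OF tR] ts(2) in auto)
  qed (use fin in auto)
  \<comment> \<open>For each ridge the positive side stands for both sides.\<close>
  define q where "q = (\<Sum>\<sigma>\<in>M - A. if hit u \<sigma> y then n \<sigma> else 0) +
     (\<Sum>\<tau>\<in>\<Theta>. \<Sum>\<sigma> | \<sigma> \<in> star \<tau> \<and> h \<tau> \<bullet> z \<tau> \<sigma> > 0. n \<sigma>)"
  have "eventually (\<lambda>a. a \<notin> T u \<longrightarrow> potential u n a = q) (nhds y)"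
    using ev1 ev2
  proof eventually_elim
    case (elim a)
    show ?case
    proof
      assume aT: "a \<notin> T u"
      let ?f = "\<lambda>\<sigma>. if hit u \<sigma> a then n \<sigma> else 0"
      have "potential u n a = sum ?f (M - A) + sum ?f A"
        unfolding potential_def by (rule sum.subset_diff) (use AM in auto)
      also have "sum ?f (M - A) = (\<Sum>\<sigma>\<in>M - A. if hit u \<sigma> y then n \<sigma> else 0)"
        using elim(1) by (intro sum.cong) auto
      also have "sum ?f A = (\<Sum>\<tau>\<in>\<Theta>. sum ?f (star \<tau>))"
        unfolding A_def by (rule sum.UNION_disjoint) (use fin disj in auto)
      also have "\<dots> = (\<Sum>\<tau>\<in>\<Theta>. \<Sum>\<sigma> | \<sigma> \<in> star \<tau> \<and> h \<tau> \<bullet> z \<tau> \<sigma> > 0. n \<sigma>)"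
      proof (rule sum.cong[OF refl])
        fix \<tau> assume t: "\<tau> \<in> \<Theta>"
        then have tR: "\<tau> \<in> Rd" by (simp add: \<Theta>_def)
        obtain t0 where t0: "t0 > 0" "y - t0 *\<^sub>R u \<in> rel_interior \<tau>" using t by (auto simp: \<Theta>_def)
        \<comment> \<open>Otherwise the line through \<open>a\<close> in direction \<open>u\<close>
          would meet the affine hull of the ridge, putting \<open>a\<close> into
          \<open>T u\<close>.\<close>
        have ha: "h \<tau> \<bullet> (a - y) \<noteq> 0"
        proof
          assume "h \<tau> \<bullet> (a - y) = 0"
          then obtain s where s: "a - y - s *\<^sub>R u \<in> parallel_space \<tau>" using hz[OF tR] by blast
          have y0: "y - t0 *\<^sub>R u \<in> affine hull \<tau>" using hull_inc[OF subsetD[OF rel_interior_subset t0(2)]] .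
          have "a - (t0 + s) *\<^sub>R u - (y - t0 *\<^sub>R u) = a - y - s *\<^sub>R u" by (simp add: algebra_simps)
          then have "a - (t0 + s) *\<^sub>R u \<in> affine hull \<tau>"
            using affine_hull_parallel_space[OF y0] s by metis
          moreover have "\<tau> \<in> K - M" using Rd_K[OF tR] aff_dim_Rd[OF tR] aff_dim_M by fastforce
          ultimately show False using T_sweepI aT by blast
        qed
        have "sum ?f (star \<tau>) = (\<Sum>\<sigma> | \<sigma> \<in> star \<tau> \<and> hit u \<sigma> a. n \<sigma>)"
          by (simp add: sum.inter_filter)
        also have "\<dots> = (\<Sum>\<sigma> | \<sigma> \<in> star \<tau> \<and> h \<tau> \<bullet> z \<tau> \<sigma> > 0. n \<sigma>)"
        proof (cases "h \<tau> \<bullet> (a - y) > 0")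
          case True
          have "hit u \<sigma> a \<longleftrightarrow> h \<tau> \<bullet> z \<tau> \<sigma> > 0" if s: "\<sigma> \<in> star \<tau>" for \<sigma>
          proof -
            have "h \<tau> \<bullet> z \<tau> \<sigma> \<noteq> 0" using hz[OF tR] s by blast
            moreover have "hit u \<sigma> a \<longleftrightarrow> 0 \<le> (h \<tau> \<bullet> (a - y)) * (h \<tau> \<bullet> z \<tau> \<sigma>)" using elim(2) t s by blast
            ultimately show ?thesis using True by (auto simp: zero_le_mult_iff)
          qed
          then show ?thesis by (intro sum.cong) auto
        next
          case False
          then have neg: "h \<tau> \<bullet> (a - y) < 0" using ha by simp
          have "hit u \<sigma> a \<longleftrightarrow> h \<tau> \<bullet> z \<tau> \<sigma> < 0" if s: "\<sigma> \<in> star \<tau>" for \<sigma>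
          proof -
            have "h \<tau> \<bullet> z \<tau> \<sigma> \<noteq> 0" using hz[OF tR] s by blast
            moreover have "hit u \<sigma> a \<longleftrightarrow> 0 \<le> (h \<tau> \<bullet> (a - y)) * (h \<tau> \<bullet> z \<tau> \<sigma>)" using elim(2) t s by blast
            ultimately show ?thesis using neg by (auto simp: zero_le_mult_iff)
          qed
          then have "(\<Sum>\<sigma> | \<sigma> \<in> star \<tau> \<and> hit u \<sigma> a. n \<sigma>) = (\<Sum>\<sigma> | \<sigma> \<in> star \<tau> \<and> h \<tau> \<bullet> z \<tau> \<sigma> < 0. n \<sigma>)"
            by (intro sum.cong) auto
          then show ?thesis using hz[OF tR] by simp
        qed
        finally show "sum ?f (star \<tau>) = (\<Sum>\<sigma> | \<sigma> \<in> star \<tau> \<and> h \<tau> \<bullet> z \<tau> \<sigma> > 0. n \<sigma>)" .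
      qed
      finally show "potential u n a = q" by (simp add: q_def)
    qed
  qed
  then show ?thesis by blast
qed

lemma low_sweeps_subset_T: "\<Union>(low_sweeps u) \<subseteq> T u"
proof -
  have "c \<in> K - M" if "c \<in> K" "aff_dim c < int CARD('n) - 2" for c
    using that aff_dim_M by fastforce
  then show ?thesis by (auto simp: low_sweeps_def T_def)
qed

text \<open>Removing \<open>low_sweeps u\<close> leaves \<open>U\<close> connected. On what remains
  the potential is locally constant along the dense complement of \<open>T u\<close>, also near
  swept ridges.\<close>

lemma potential_const:
  assumes n: "crossing_normals u n" and bal: "crossing_balanced u n"
    and U: "open U" "connected U" "U \<inter> C = {}" and ab: "a \<in> U" "b \<in> U" "a \<notin> T u" "b \<notin> T u"
  shows "potential u n a = potential u n b"
proof -
  let ?S = "U - \<Union>(low_sweeps u)"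
  have fin: "finite (low_sweeps u)" by (simp add: low_sweeps_def)
  have "connected ?S"
  proof (rule connected_open_minus_affines[OF U(1,2) fin])
    fix A assume "A \<in> low_sweeps u"
    then obtain c where c: "A = sweep u c" "aff_dim c < int CARD('n) - 2" by (auto simp: low_sweeps_def)
    then show "affine A \<and> aff_dim A < int DIM(real ^ 'n) - 1" using aff_dim_sweep_le[of u c] by simp
  qed
  have opS: "open ?S"
    using U(1) fin by (intro open_Diff closed_Union) (auto simp: low_sweeps_def)
  show ?thesis
  proof (rule locally_constant_imp_constant[OF \<open>connected ?S\<close> opS, where P = "\<lambda>x. x \<notin> T u" and f = "potential u n"])
    show "\<exists>z\<in>V. z \<notin> T u" if "open V" "V \<noteq> {}" for V
      using open_avoids_T[OF that, of "{}" u] by auto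
    show "\<exists>q. eventually (\<lambda>y. y \<notin> T u \<longrightarrow> potential u n y = q) (nhds x)" if "x \<in> ?S" for x
      using potential_locally_const[OF n bal] that U(3) by blast
  qed (use ab low_sweeps_subset_T in auto)
qed

text \<open>The ray from \<open>b\<close> contains the ray from \<open>a\<close>, so whatever is hit
  from \<open>a\<close> is hit from \<open>b\<close>. A cell meeting the segment would be hit from
  \<open>b\<close> only, and as all normals have positive product with \<open>b - a\<close>, the
  potential would strictly increase in that direction, although it takes the same value at both
  ends.\<close>

lemma generic_segment_avoids_C:
  assumes n: "crossing_normals (b - a) n" and bal: "crossing_balanced (b - a) n"
    and U: "open U" "connected U" "U \<inter> C = {}" and ab: "a \<in> U" "b \<in> U" "a \<notin> T (b - a)"
  shows "closed_segment a b \<inter> C = {}"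
proof (rule ccontr)
  assume "closed_segment a b \<inter> C \<noteq> {}"
  then obtain x where "x \<in> closed_segment a b" "x \<in> C" by blast
  then obtain s where s: "0 \<le> s" "s \<le> 1" "(1 - s) *\<^sub>R a + s *\<^sub>R b \<in> C" unfolding in_segment by blast
  let ?u = "b - a"
  have nn: "is_normal (n \<sigma>) \<sigma>" "n \<sigma> \<bullet> ?u > 0" "n \<sigma> \<bullet> ?u \<noteq> 0" if "\<sigma> \<in> M" for \<sigma>
    using n that by (auto simp: crossing_normals_def)
  have "b \<notin> T ?u" using T_shift[of b ?u "-1"] ab(3) by auto
  then have Qeq: "potential ?u n a = potential ?u n b" using potential_const[OF n bal U ab(1,2,3)] by blast
  obtain \<sigma> where \<sigma>: "\<sigma> \<in> M" "(1 - s) *\<^sub>R a + s *\<^sub>R b \<in> \<sigma>" using s(3) C_eq_Union_M by blast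
  have s1: "s < 1"
  proof (rule ccontr)
    assume "\<not> s < 1"
    then have "s = 1" using s(2) by simp
    then show False using s(3) ab(2) U(3) by auto
  qed
  have eq: "(1 - s) *\<^sub>R a + s *\<^sub>R b = b - (1 - s) *\<^sub>R ?u" "(1 - s) *\<^sub>R a + s *\<^sub>R b = a - (- s) *\<^sub>R ?u"
    by (simp_all add: algebra_simps)
  have hb: "hit ?u \<sigma> b" unfolding hit_def using \<sigma>(2) s1 eq(1) by (intro exI[of _ "1 - s"]) simp
  have ha: "\<not> hit ?u \<sigma> a"
  proof
    assume "hit ?u \<sigma> a"
    then obtain t where t: "t > 0" "a - t *\<^sub>R ?u \<in> \<sigma>" by (auto simp: hit_def)
    then have "t = - s" using transversal_unique[OF \<sigma>(1) nn(1,3)[OF \<sigma>(1)] t(2)] \<sigma>(2) eq(2) by metis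
    then show False using t s by simp
  qed
  have mono: "hit ?u \<sigma>' b" if "hit ?u \<sigma>' a" for \<sigma>'
  proof -
    obtain t where t: "t > 0" "a - t *\<^sub>R ?u \<in> \<sigma>'" using \<open>hit ?u \<sigma>' a\<close> by (auto simp: hit_def)
    have "b - (t + 1) *\<^sub>R ?u = a - t *\<^sub>R ?u" by (simp add: algebra_simps)
    then show ?thesis unfolding hit_def using t by (intro exI[of _ "t + 1"]) simp
  qed
  have "potential ?u n a \<bullet> ?u < potential ?u n b \<bullet> ?u"
    unfolding potential_def inner_sum_left
  proof (rule sum_strict_mono_ex1)
    show "\<forall>\<sigma>\<in>M. (if hit ?u \<sigma> a then n \<sigma> else 0) \<bullet> ?u \<le> (if hit ?u \<sigma> b then n \<sigma> else 0) \<bullet> ?u"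
      using mono nn(2) by (auto simp: less_imp_le)
    show "\<exists>\<sigma>\<in>M. (if hit ?u \<sigma> a then n \<sigma> else 0) \<bullet> ?u < (if hit ?u \<sigma> b then n \<sigma> else 0) \<bullet> ?u"
      using \<sigma>(1) ha hb nn(2)[OF \<sigma>(1)] by (intro bexI[of _ \<sigma>]) auto
  qed simp
  then show False using Qeq by simp
qed

end

section \<open>Potentials of balanced weightings\<close>

locale balanced_complex = rational_hypersurface_complex K for K :: "(real ^ 'n) set set" +
  fixes \<omega> :: "(real ^ 'n) set \<Rightarrow> nat"
  assumes balanced: "balanced_weighting (CARD('n) - 1) K \<omega>"
begin

definition X :: "(real ^ 'n) set \<Rightarrow> real ^ 'n" where "X \<sigma> = (SOME x. primitive_normal x \<sigma>)"

text \<open>The sign undoes the arbitrary choice between the two primitive normals made by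
  \<open>X\<close>.\<close>

definition oriented :: "real ^ 'n \<Rightarrow> (real ^ 'n) set \<Rightarrow> real ^ 'n" where
  "oriented u \<sigma> = real (\<omega> \<sigma>) *\<^sub>R sgn (X \<sigma> \<bullet> u) *\<^sub>R X \<sigma>"

definition transversal :: "real ^ 'n \<Rightarrow> bool" where
  "transversal u \<longleftrightarrow> (\<forall>\<sigma>\<in>M. X \<sigma> \<bullet> u \<noteq> 0)"

lemma primitive_X: "\<sigma> \<in> M \<Longrightarrow> primitive_normal (X \<sigma>) \<sigma>"
  unfolding X_def using primitive_normal_exists[OF integer_normal_exists] someI_ex by metis

lemma normal_X: "\<sigma> \<in> M \<Longrightarrow> is_normal (X \<sigma>) \<sigma>"
  using primitive_X primitive_normal_is_normal by blast

lemma weight_pos: "\<sigma> \<in> M \<Longrightarrow> \<omega> \<sigma> > 0"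
  using balanced by (simp add: balanced_weighting_def M_def)

lemma ridge_lattice_normals:
  assumes "\<tau> \<in> Rd"
  obtains z where "\<And>\<sigma>. \<sigma> \<in> star \<tau> \<Longrightarrow> lattice_normal \<tau> \<sigma> (z \<sigma>)"
    "(\<Sum>\<sigma>\<in>star \<tau>. real (\<omega> \<sigma>) *\<^sub>R z \<sigma>) \<in> parallel_space \<tau>"
  using balanced assms unfolding balanced_weighting_def Rd_def star_def M_def by blast

lemma crossing_normals_oriented:
  assumes "transversal u" shows "crossing_normals u (oriented u)"
  unfolding crossing_normals_def
proof
  fix \<sigma> assume s: "\<sigma> \<in> M"
  have x: "X \<sigma> \<bullet> u \<noteq> 0" using assms s by (simp add: transversal_def)
  have "is_normal ((real (\<omega> \<sigma>) * sgn (X \<sigma> \<bullet> u)) *\<^sub>R X \<sigma>) \<sigma>"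
    using is_normal_scale[OF normal_X[OF s]] weight_pos[OF s] x by (simp add: sgn_zero_iff)
  moreover have "sgn (X \<sigma> \<bullet> u) * (X \<sigma> \<bullet> u) > 0" using x by (simp add: sgn_if)
  then have "real (\<omega> \<sigma>) * (sgn (X \<sigma> \<bullet> u) * (X \<sigma> \<bullet> u)) > 0"
    using weight_pos[OF s] by (metis mult_pos_pos of_nat_0_less_iff)
  ultimately show "is_normal (oriented u \<sigma>) \<sigma> \<and> oriented u \<sigma> \<bullet> u > 0"
    by (simp add: oriented_def mult.assoc)
qed

lemma crossing_balanced_oriented:
  assumes "transversal u" shows "crossing_balanced u (oriented u)"
  unfolding crossing_balanced_def
proof
  fix \<tau> assume t: "\<tau> \<in> Rd"
  obtain z where z: "\<And>\<sigma>. \<sigma> \<in> star \<tau> \<Longrightarrow> lattice_normal \<tau> \<sigma> (z \<sigma>)"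
    "(\<Sum>\<sigma>\<in>star \<tau>. real (\<omega> \<sigma>) *\<^sub>R z \<sigma>) \<in> parallel_space \<tau>" using ridge_lattice_normals[OF t] by blast
  have X: "primitive_normal (X \<sigma>) \<sigma>" "X \<sigma> \<bullet> u \<noteq> 0" if "\<sigma> \<in> star \<tau>" for \<sigma>
    using primitive_X star_M[OF that] assms by (auto simp: transversal_def)
  have zs: "z \<sigma> \<in> parallel_space \<sigma> \<and> (\<exists>x\<in>\<tau>. \<exists>l>0. x + l *\<^sub>R z \<sigma> \<in> \<sigma>)" if "\<sigma> \<in> star \<tau>" for \<sigma>
    using z(1)[OF that] by (simp add: lattice_normal_def cell_lattice_def)
  show "\<exists>h z. sides_balanced u (oriented u) \<tau> h z"
  proof (rule balanced_iff_sides[OF t, of z X u])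
    fix h assume h: "\<And>v. v \<in> parallel_space \<tau> \<Longrightarrow> h \<bullet> v = 0" "h \<bullet> u = 0"
    "\<And>v. h \<bullet> v = 0 \<Longrightarrow> \<exists>s. v - s *\<^sub>R u \<in> parallel_space \<tau>"
    "\<And>\<sigma>. \<sigma> \<in> star \<tau> \<Longrightarrow> h \<bullet> z \<sigma> \<noteq> 0"
    "\<And>\<omega>. (\<Sum>\<sigma>\<in>star \<tau>. \<omega> \<sigma> *\<^sub>R z \<sigma>) \<in> parallel_space \<tau> \<longleftrightarrow>
       (\<Sum>\<sigma> | \<sigma> \<in> star \<tau> \<and> h \<bullet> z \<sigma> > 0. \<omega> \<sigma> *\<^sub>R sgn (X \<sigma> \<bullet> u) *\<^sub>R X \<sigma>) =
       (\<Sum>\<sigma> | \<sigma> \<in> star \<tau> \<and> h \<bullet> z \<sigma> < 0. \<omega> \<sigma> *\<^sub>R sgn (X \<sigma> \<bullet> u) *\<^sub>R X \<sigma>)"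
    have "sides_balanced u (oriented u) \<tau> h z"
      unfolding sides_balanced_def oriented_def
      using h(1-4) h(5)[of "\<lambda>\<sigma>. real (\<omega> \<sigma>)"] z(2) zs by blast
    then show ?thesis by blast
  qed (use z X in auto)
qed

lemmas oriented_potential_const =
  potential_const[OF crossing_normals_oriented crossing_balanced_oriented]

end

section \<open>Regions and their dual graph\<close>

text \<open>Moving \<open>affine hull A\<close> along \<open>u\<close> gives an affine set that
  contains both generating translates, so the hull is no larger.\<close>

lemma sweepE:
  fixes u :: "'a::real_vector"
  assumes "y \<in> sweep u A" obtains s where "y - s *\<^sub>R u \<in> affine hull A"
proof -
  let ?S = "{y. \<exists>s. y - s *\<^sub>R u \<in> affine hull A}"
  have "affine ?S"
  proof (rule affine_def[THEN iffD2], intro ballI allI impI)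
    fix x y :: 'a and a b :: real assume xy: "x \<in> ?S" "y \<in> ?S" and ab: "a + b = 1"
    obtain s t where st: "x - s *\<^sub>R u \<in> affine hull A" "y - t *\<^sub>R u \<in> affine hull A" using xy by blast
    have "a *\<^sub>R (x - s *\<^sub>R u) + b *\<^sub>R (y - t *\<^sub>R u) \<in> affine hull A"
      using st ab by (intro mem_affine) auto
    moreover have "a *\<^sub>R (x - s *\<^sub>R u) + b *\<^sub>R (y - t *\<^sub>R u) = a *\<^sub>R x + b *\<^sub>R y - (a * s + b * t) *\<^sub>R u"
      by (simp add: algebra_simps)
    ultimately show "a *\<^sub>R x + b *\<^sub>R y \<in> ?S" by (metis (mono_tags, lifting) mem_Collect_eq)
  qed
  moreover have "A \<union> (+) u ` A \<subseteq> ?S"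
  proof -
    have "b - 0 *\<^sub>R u \<in> affine hull A" "(u + b) - 1 *\<^sub>R u \<in> affine hull A" if "b \<in> A" for b
      using that by (auto intro: hull_inc)
    then show ?thesis by blast
  qed
  ultimately have "sweep u A \<subseteq> ?S" unfolding sweep_def by (rule hull_minimal[rotated])
  then show ?thesis using assms that by blast
qed

lemma exists_small_scale:
  fixes v :: "'a::real_normed_vector"
  assumes "e > 0" obtains t where "t > 0" "norm (t *\<^sub>R v) < e"
proof -
  have "eventually (\<lambda>v. norm v < e) (nhds (0::'a))"
    using assms by (auto simp: eventually_nhds_metric)
  from eventually_ray[OF this, of v] show ?thesis using that by (auto elim: eventually_at_right_0_ex)
qed

context hypersurface_complex
begin

lemma component_props:
  assumes "U \<in> components (- C)"
  shows "open U" "connected U" "U \<inter> C = {}" "U \<noteq> {}"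
  using open_components[OF _ assms] closed_C in_components_connected[OF assms]
    in_components_subset[OF assms] in_components_nonempty[OF assms] by auto

lemma component_eqI:
  assumes "U \<in> components (- C)" "W \<in> components (- C)" "x \<in> U" "x \<in> W" shows "U = W"
  using components_nonoverlap[OF assms(1,2)] assms(3,4) by blast

lemma component_of:
  assumes "x \<notin> C" obtains U where "U \<in> components (- C)" "x \<in> U"
  using assms by (metis ComplI Union_components UnionE)

lemma closure_component:
  assumes "U \<in> components (- C)" "y \<in> closure U" "y \<notin> C" shows "y \<in> U"
proof -
  obtain W where W: "W \<in> components (- C)" "y \<in> W" using component_of[OF assms(3)] by blast
  then have "W \<inter> U \<noteq> {}" using assms(2) component_props(1)[OF W(1)] open_Int_closure_eq_empty by blast
  then show ?thesis using component_eqI[OF W(1) assms(1)] W(2) by blast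
qed

text \<open>The radius may depend on the point, since other cells can come arbitrarily close near
  the relative boundary of \<sigma>.\<close>

definition is_side :: "(real ^ 'n) set \<Rightarrow> real ^ 'n \<Rightarrow> (real ^ 'n) set \<Rightarrow> bool" where
  "is_side \<sigma> n U \<longleftrightarrow> U \<in> components (- C) \<and>
     (\<forall>y\<in>rel_interior \<sigma>. \<exists>e>0. \<forall>y'\<in>ball y e. n \<bullet> (y' - y) > 0 \<longrightarrow> y' \<in> U)"

definition side :: "(real ^ 'n) set \<Rightarrow> real ^ 'n \<Rightarrow> (real ^ 'n) set" where
  "side \<sigma> n = (SOME U. is_side \<sigma> n U)"

lemma rel_interior_M_nonempty: "\<sigma> \<in> M \<Longrightarrow> rel_interior \<sigma> \<noteq> {}"
  using cell(2,4)[OF M_K] rel_interior_eq_empty by metis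

lemma half_ball_component:
  assumes "\<sigma> \<in> M" "is_normal n \<sigma>" "y \<in> rel_interior \<sigma>"
  shows "\<exists>U e. U \<in> components (- C) \<and> e > 0 \<and> (\<forall>y'\<in>ball y e. n \<bullet> (y' - y) > 0 \<longrightarrow> y' \<in> U)"
proof -
  obtain e where e: "e > 0" "\<forall>y'\<in>ball y e. (y' \<in> C \<longleftrightarrow> n \<bullet> (y' - y) = 0) \<and> (y' \<in> C \<longrightarrow> y' \<in> rel_interior \<sigma>)"
    using near_rel_interior_M[OF assms] by blast
  let ?H = "ball y e \<inter> {y'. n \<bullet> y' > n \<bullet> y}"
  have "connected ?H" by (intro convex_connected convex_Int convex_ball convex_halfspace_gt)
  moreover have "?H \<subseteq> - C" using e(2) by (auto simp: inner_diff_right)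
  moreover have "- C \<noteq> {}" using open_avoids_C[OF open_UNIV UNIV_not_empty] by blast
  ultimately obtain U where "U \<in> components (- C)" "?H \<subseteq> U" using exists_component_superset by metis
  then show ?thesis using e(1) by (intro exI[of _ U] exI[of _ e]) (auto simp: inner_diff_right)
qed

text \<open>Half-balls at two points lie in the same component: the segment between the points,
  pushed off by a small multiple of \<open>n\<close>, leaves the affine hull of \<sigma> and stays
  within the positive distance of the segment from all other cells.\<close>

lemma is_side_side:
  assumes "\<sigma> \<in> M" "is_normal n \<sigma>" shows "is_side \<sigma> n (side \<sigma> n)"
proof -
  obtain y1 where y1: "y1 \<in> rel_interior \<sigma>" using rel_interior_M_nonempty assms(1) by blast
  have n0: "n \<noteq> 0" using assms(2) by (simp add: is_normal_def)
  obtain U e1 where U: "U \<in> components (- C)" "e1 > 0" "\<forall>y'\<in>ball y1 e1. n \<bullet> (y' - y1) > 0 \<longrightarrow> y' \<in> U"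
    using half_ball_component[OF assms y1] by blast
  have "\<exists>e>0. \<forall>y'\<in>ball y2 e. n \<bullet> (y' - y2) > 0 \<longrightarrow> y' \<in> U" if y2: "y2 \<in> rel_interior \<sigma>" for y2
  proof -
    obtain W e2 where W: "W \<in> components (- C)" "e2 > 0" "\<forall>y'\<in>ball y2 e2. n \<bullet> (y' - y2) > 0 \<longrightarrow> y' \<in> W"
      using half_ball_component[OF assms y2] by blast
    have seg: "closed_segment y1 y2 \<subseteq> rel_interior \<sigma>"
      using y1 y2 cell(2)[OF M_K[OF assms(1)]] by (intro closed_segment_subset convex_rel_interior)
    let ?D = "\<Union>(K - {\<sigma>})"
    have "closed ?D" using cell(3) by (intro closed_Union) auto
    moreover have "closed_segment y1 y2 \<inter> ?D = {}" using seg max_cell_unique[OF assms(1)] by blast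
    ultimately have "\<exists>\<delta>>0. \<forall>p\<in>closed_segment y1 y2. \<forall>x\<in>?D. \<delta> \<le> dist p x"
      by (intro separate_compact_closed compact_segment)
    then obtain \<delta> where \<delta>: "\<delta> > 0" "\<forall>p\<in>closed_segment y1 y2. \<forall>x\<in>?D. \<delta> \<le> dist p x" by (elim exE conjE)
    obtain t where t: "t > 0" "norm (t *\<^sub>R n) < \<delta>" "norm (t *\<^sub>R n) < e1" "norm (t *\<^sub>R n) < e2"
      using exists_small_scale[of "min \<delta> (min e1 e2)" n] \<delta>(1) U(2) W(2) by auto
    have nt: "n \<bullet> (t *\<^sub>R n) > 0" using t(1) n0 by simp
    let ?S = "(\<lambda>x. t *\<^sub>R n + x) ` closed_segment y1 y2"
    have "connected ?S" by (intro connected_continuous_image continuous_intros) auto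
    moreover have "?S \<subseteq> - C"
    proof
      fix x assume "x \<in> ?S"
      then obtain p where p: "p \<in> closed_segment y1 y2" "x = t *\<^sub>R n + p" by blast
      have ps: "p \<in> \<sigma>" using p(1) seg rel_interior_subset by blast
      have "x \<notin> \<sigma>"
      proof
        assume "x \<in> \<sigma>"
        then have "n \<bullet> (x - p) = 0" using affine_hull_M[OF assms ps, of x] by (simp add: hull_inc)
        then show False using nt unfolding p(2) by (metis add_diff_cancel_right' less_irrefl)
      qed
      moreover have "x \<notin> ?D"
      proof
        assume "x \<in> ?D"
        then have "\<delta> \<le> dist p x" using \<delta>(2)[rule_format, OF p(1)] by simp
        then show False using t(2) by (simp add: p(2) dist_norm)
      qed
      ultimately show "x \<in> - C" by blast
    qed
    moreover have 1: "t *\<^sub>R n + y1 \<in> U"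
    proof -
      have "t *\<^sub>R n + y1 \<in> ball y1 e1" "n \<bullet> (t *\<^sub>R n + y1 - y1) > 0" using t(3) nt by (auto simp: dist_norm)
      then show ?thesis using U(3) by blast
    qed
    moreover have "t *\<^sub>R n + y1 \<in> ?S" by simp
    ultimately have "?S \<subseteq> U" using components_maximal[OF U(1)] by blast
    then have "t *\<^sub>R n + y2 \<in> U" by auto
    moreover have "t *\<^sub>R n + y2 \<in> W"
    proof -
      have "t *\<^sub>R n + y2 \<in> ball y2 e2" "n \<bullet> (t *\<^sub>R n + y2 - y2) > 0" using t(4) nt by (auto simp: dist_norm)
      then show ?thesis using W(3) by blast
    qed
    ultimately have "U = W" using component_eqI U(1) W(1) by blast
    then show ?thesis using W by blast
  qed
  then have "is_side \<sigma> n U" using U(1) by (simp add: is_side_def)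
  then show ?thesis unfolding side_def by (rule someI)
qed

lemma side_component: "\<sigma> \<in> M \<Longrightarrow> is_normal n \<sigma> \<Longrightarrow> side \<sigma> n \<in> components (- C)"
  using is_side_side by (simp add: is_side_def)

lemma side_scale: assumes "c > 0" shows "side \<sigma> (c *\<^sub>R n) = side \<sigma> n"
proof -
  have "is_side \<sigma> (c *\<^sub>R n) = is_side \<sigma> n"
    using assms by (auto simp: is_side_def fun_eq_iff zero_less_mult_iff)
  then show ?thesis by (simp add: side_def)
qed

lemma side_ball:
  assumes "\<sigma> \<in> M" "is_normal n \<sigma>" "y \<in> rel_interior \<sigma>"
  obtains e where "e > 0" "\<And>y'. dist y' y < e \<Longrightarrow> n \<bullet> (y' - y) > 0 \<Longrightarrow> y' \<in> side \<sigma> n"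
    "\<And>y'. dist y' y < e \<Longrightarrow> n \<bullet> (y' - y) < 0 \<Longrightarrow> y' \<in> side \<sigma> (- n)"
    "\<And>y'. dist y' y < e \<Longrightarrow> y' \<in> C \<longleftrightarrow> n \<bullet> (y' - y) = 0"
proof -
  have n': "is_normal (- n) \<sigma>" using assms(2) by simp
  obtain e1 where e1: "e1 > 0" "\<forall>y'\<in>ball y e1. n \<bullet> (y' - y) > 0 \<longrightarrow> y' \<in> side \<sigma> n"
    using is_side_side[OF assms(1,2)] assms(3) unfolding is_side_def by blast
  obtain e2 where e2: "e2 > 0" "\<forall>y'\<in>ball y e2. (- n) \<bullet> (y' - y) > 0 \<longrightarrow> y' \<in> side \<sigma> (- n)"
    using is_side_side[OF assms(1) n'] assms(3) unfolding is_side_def by blast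
  obtain e3 where e3: "e3 > 0" "\<forall>y'\<in>ball y e3. (y' \<in> C \<longleftrightarrow> n \<bullet> (y' - y) = 0) \<and> (y' \<in> C \<longrightarrow> y' \<in> rel_interior \<sigma>)"
    using near_rel_interior_M[OF assms] by blast
  show ?thesis
  proof (rule that[of "min e1 (min e2 e3)"])
    fix y' assume "dist y' y < min e1 (min e2 e3)"
    then have b: "y' \<in> ball y e1" "y' \<in> ball y e2" "y' \<in> ball y e3" by (auto simp: dist_commute)
    show "n \<bullet> (y' - y) > 0 \<Longrightarrow> y' \<in> side \<sigma> n" using b(1) e1(2) by blast
    show "n \<bullet> (y' - y) < 0 \<Longrightarrow> y' \<in> side \<sigma> (- n)" using b(2) e2(2) by auto
    show "y' \<in> C \<longleftrightarrow> n \<bullet> (y' - y) = 0" using b(3) e3(2) by blast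
  qed (use e1 e2 e3 in auto)
qed

lemma side_ray:
  assumes "\<sigma> \<in> M" "is_normal n \<sigma>" "y \<in> rel_interior \<sigma>"
  shows "eventually (\<lambda>t. y + t *\<^sub>R n \<in> side \<sigma> n \<and> y - t *\<^sub>R n \<in> side \<sigma> (- n)) (at_right 0)"
proof -
  obtain e where e: "e > 0" "\<And>y'. dist y' y < e \<Longrightarrow> n \<bullet> (y' - y) > 0 \<Longrightarrow> y' \<in> side \<sigma> n"
    "\<And>y'. dist y' y < e \<Longrightarrow> n \<bullet> (y' - y) < 0 \<Longrightarrow> y' \<in> side \<sigma> (- n)"
    using side_ball[OF assms] by metis
  have nn: "n \<bullet> n > 0" using assms(2) by (simp add: is_normal_def)
  have "eventually (\<lambda>y'. dist y' y < e) (nhds y)" using e(1) by (auto simp: eventually_nhds_metric)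
  from eventually_ray[OF this, of n] eventually_at_right_less[of "0::real"] show ?thesis
  proof eventually_elim
    case (elim t)
    then show ?case using e(2)[of "y + t *\<^sub>R n"] e(3)[of "y - t *\<^sub>R n"] nn by auto
  qed
qed

lemma cell_subset_closure_side:
  assumes "\<sigma> \<in> M" "is_normal n \<sigma>" shows "\<sigma> \<subseteq> closure (side \<sigma> n)"
proof -
  have "y \<in> closure (side \<sigma> n)" if y: "y \<in> rel_interior \<sigma>" for y
  proof (unfold closure_approachable, intro allI impI)
    fix e :: real assume "e > 0"
    then have "eventually (\<lambda>y'. dist y' y < e) (nhds y)" by (auto simp: eventually_nhds_metric)
    from eventually_conj[OF side_ray[OF assms y] eventually_ray[OF this, of n]]
    show "\<exists>x\<in>side \<sigma> n. dist x y < e" by (rule eventually_at_right_0_ex) blast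
  qed
  then have "closure (rel_interior \<sigma>) \<subseteq> closure (side \<sigma> n)" by (intro closure_minimal) auto
  then show ?thesis
    using convex_closure_rel_interior[OF cell(2)[OF M_K[OF assms(1)]]] closure_subset by blast
qed

end

section \<open>Convexity of regions, and cells as witnesses of edges\<close>

context balanced_complex
begin

text \<open>Each maximal cell forbids only the hyperplane through \<open>a\<close> parallel to it.
  The base point allows directions from a point that is already fixed.\<close>

lemma transversal_avoiding:
  assumes "open W" "W \<noteq> {}" "finite F" "\<And>A. A \<in> F \<Longrightarrow> aff_dim A < int CARD('n)"
  obtains u where "u \<in> W" "transversal (u - a)" "u \<notin> \<Union>F"
proof -
  let ?H = "\<lambda>\<sigma>. {u. X \<sigma> \<bullet> u = X \<sigma> \<bullet> a}"
  have "aff_dim A < int DIM(real ^ 'n)" if "A \<in> F \<union> ?H ` M" for A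
    using that assms(4) normal_X by (auto simp: aff_dim_hyperplane is_normal_def)
  then obtain u where u: "u \<in> W" "u \<notin> \<Union>(F \<union> ?H ` M)"
    using open_avoids_lowdim[OF assms(1,2), of "F \<union> ?H ` M"] assms(3) by auto
  then show ?thesis using that[of u] by (auto simp: transversal_def inner_diff_right)
qed

lemma transversal_normal:
  assumes "transversal u" "\<sigma> \<in> M" "is_normal n \<sigma>" shows "n \<bullet> u \<noteq> 0"
  using parallel_space_M[OF assms(2,3), of u] parallel_space_M[OF assms(2) normal_X[OF assms(2)], of u]
    assms(1,2) by (simp add: transversal_def)

text \<open>Stated for all small \<open>t\<close>, so that it can be combined with membership in the
  two sides of \<sigma>.\<close>

lemma potential_jump:
  assumes "transversal u" "\<sigma> \<in> M" "y \<in> rel_interior \<sigma>" "y \<notin> T u"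
  obtains m where "is_normal m \<sigma>"
    "eventually (\<lambda>t. y + t *\<^sub>R m \<notin> T u \<and> y - t *\<^sub>R m \<notin> T u \<and>
       potential u (oriented u) (y + t *\<^sub>R m) - potential u (oriented u) (y - t *\<^sub>R m) = m) (at_right 0)"
proof -
  define m where "m = oriented u \<sigma>"
  have m: "is_normal m \<sigma>"
    using crossing_normals_oriented[OF assms(1)] assms(2) by (simp add: crossing_normals_def m_def)
  then have mm: "m \<bullet> m > 0" by (simp add: is_normal_def)
  obtain q where "eventually (\<lambda>y'. potential u (oriented u) y' = q + (if m \<bullet> (y' - y) > 0 then m else 0)) (nhds y)"
    using potential_near_cell[OF crossing_normals_oriented[OF assms(1)] assms(2-4)] unfolding m_def by blast
  moreover have "eventually (\<lambda>y'. y' \<in> - T u) (nhds y)"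
    using closed_T assms(4) by (intro eventually_nhds_in_open) auto
  ultimately have "eventually (\<lambda>y'. y' \<notin> T u \<and> potential u (oriented u) y' = q + (if m \<bullet> (y' - y) > 0 then m else 0)) (nhds y)"
    by eventually_elim auto
  from eventually_ray[OF this, of m] eventually_at_right_less[of "0::real"]
  have "eventually (\<lambda>t. y + t *\<^sub>R m \<notin> T u \<and> y - t *\<^sub>R m \<notin> T u \<and>
       potential u (oriented u) (y + t *\<^sub>R m) - potential u (oriented u) (y - t *\<^sub>R m) = m) (at_right 0)"
  proof eventually_elim
    case (elim t)
    have "t * (m \<bullet> m) > 0" using elim(2) mm by (intro mult_pos_pos)
    then have "m \<bullet> (y + t *\<^sub>R m - y) > 0" "\<not> m \<bullet> (y - t *\<^sub>R m - y) > 0" by auto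
    then show ?case using elim(1) by simp
  qed
  then show ?thesis using that m by blast
qed

text \<open>The potential is constant on a component but changes by a nonzero normal across
  \<sigma>. Without balancing one component could lie on both sides, as around a cell with a free
  ridge.\<close>

lemma sides_distinct:
  assumes "\<sigma> \<in> M" "is_normal n \<sigma>" shows "side \<sigma> n \<noteq> side \<sigma> (- n)"
proof
  assume eq: "side \<sigma> n = side \<sigma> (- n)"
  obtain u where u: "transversal u" using transversal_avoiding[of UNIV "{}" 0] by auto
  obtain y0 where "y0 \<in> rel_interior \<sigma>" using rel_interior_M_nonempty assms(1) by blast
  then obtain y where y: "y \<in> rel_interior \<sigma>" "y \<notin> T u"
    using generic_rel_interior_point[OF assms transversal_normal[OF u assms], of y0 1 "{}"] by auto
  obtain m where m: "is_normal m \<sigma>"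
    "eventually (\<lambda>t. y + t *\<^sub>R m \<notin> T u \<and> y - t *\<^sub>R m \<notin> T u \<and>
       potential u (oriented u) (y + t *\<^sub>R m) - potential u (oriented u) (y - t *\<^sub>R m) = m) (at_right 0)"
    using potential_jump[OF u assms(1) y] by blast
  obtain t where t: "y + t *\<^sub>R m \<notin> T u" "y - t *\<^sub>R m \<notin> T u"
    "potential u (oriented u) (y + t *\<^sub>R m) - potential u (oriented u) (y - t *\<^sub>R m) = m"
    "y + t *\<^sub>R m \<in> side \<sigma> m" "y - t *\<^sub>R m \<in> side \<sigma> (- m)"
    using eventually_conj[OF m(2) side_ray[OF assms(1) m(1) y(1)]] by (auto elim: eventually_at_right_0_ex)
  obtain c where c: "c \<noteq> 0" "m = c *\<^sub>R n" using normals_collinear[OF assms m(1)] .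
  have "side \<sigma> m = side \<sigma> n \<and> side \<sigma> (- m) = side \<sigma> n"
  proof (cases "c > 0")
    case True then show ?thesis using side_scale[of c \<sigma> n] side_scale[of c \<sigma> "- n"] c(2) eq by simp
  next
    case False
    then have "- c > 0" using c(1) by simp
    then show ?thesis using side_scale[of "- c" \<sigma> n] side_scale[of "- c" \<sigma> "- n"] c(2) eq by simp
  qed
  then have "potential u (oriented u) (y + t *\<^sub>R m) = potential u (oriented u) (y - t *\<^sub>R m)"
    using t by (intro oriented_potential_const[OF u u component_props(1-3)[OF side_component[OF assms]]]) simp_all
  then show False using t(3) m(1) by (simp add: is_normal_def)
qed

text \<open>For the closure it suffices to join approximations \<open>a\<close> and \<open>b\<close>
  of two given points inside \<open>U\<close>. These are chosen one after the other so that
  \<open>b - a\<close> is transversal and the line through them misses the affine hulls of all lower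
  cells, as \<open>generic_segment_avoids_C\<close> requires.\<close>

lemma convex_closure_component:
  assumes "U \<in> components (- C)" shows "convex (closure U)"
proof -
  note U = component_props[OF assms]
  have near: "\<exists>a\<in>U. \<exists>b\<in>U. dist a x < e \<and> dist b y < e \<and> closed_segment a b \<subseteq> U"
    if xy: "x \<in> closure U" "y \<in> closure U" "e > 0" for x y e
  proof -
    have ne: "U \<inter> ball z e \<noteq> {}" if "z \<in> closure U" for z
    proof -
      have "z \<in> ball z e \<inter> closure U" using that \<open>e > 0\<close> by simp
      then show ?thesis using open_Int_closure_eq_empty[of "ball z e" U] by blast
    qed
    have op: "open (U \<inter> ball z e)" for z using U(1) by auto
    have nm: "aff_dim c < int CARD('n) - 1" if "c \<in> K - M" for c using aff_dim_nonmax[OF that] by simp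
    obtain a where a: "a \<in> U \<inter> ball x e" "a \<notin> \<Union>((\<lambda>c. affine hull c) ` (K - M))"
    proof (rule open_avoids_lowdim[OF op ne[OF xy(1)], of "(\<lambda>c. affine hull c) ` (K - M)"])
      show "aff_dim A < int DIM(real ^ 'n)" if "A \<in> (\<lambda>c. affine hull c) ` (K - M)" for A
        using that nm by force
    qed auto
    have d: "aff_dim A < int CARD('n)" if "A \<in> (\<lambda>c. affine hull (insert a c)) ` (K - M)" for A
    proof -
      obtain c where c: "c \<in> K - M" "A = affine hull (insert a c)"
        using \<open>A \<in> (\<lambda>c. affine hull (insert a c)) ` (K - M)\<close> by blast
      then show ?thesis using nm[OF c(1)] by (simp add: aff_dim_insert)
    qed
    obtain b where b: "b \<in> U \<inter> ball y e" "transversal (b - a)"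
        "b \<notin> \<Union>((\<lambda>c. affine hull (insert a c)) ` (K - M))"
      by (rule transversal_avoiding[OF op ne[OF xy(2)] _ d]) auto
    \<comment> \<open>A point of this line in the affine hull of a lower cell \<open>c\<close> would
      differ from \<open>a\<close>, so \<open>b\<close> would lie in the affine hull of
      \<open>a\<close> and \<open>c\<close>, which its choice excludes.\<close>
    have "a \<notin> T (b - a)"
    proof
      assume "a \<in> T (b - a)"
      then obtain c where c: "c \<in> K - M" "a \<in> sweep (b - a) c" by (auto simp: T_def)
      obtain s where s: "a - s *\<^sub>R (b - a) \<in> affine hull c" using sweepE[OF c(2)] .
      have "s \<noteq> 0" using s a(2) c(1) by auto
      let ?H = "affine hull (insert a c)"
      have "affine hull c \<subseteq> ?H" by (intro hull_mono) auto
      then have "a - s *\<^sub>R (b - a) \<in> ?H" using s by blast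
      moreover have "a \<in> ?H" by (simp add: hull_inc)
      ultimately have "a + (- 1 / s) *\<^sub>R ((a - s *\<^sub>R (b - a)) - a) \<in> ?H"
        by (intro mem_affine_3_minus) auto
      moreover have "a + (- 1 / s) *\<^sub>R ((a - s *\<^sub>R (b - a)) - a) = b" using \<open>s \<noteq> 0\<close> by simp
      ultimately show False using b(3) c(1) by auto
    qed
    then have "closed_segment a b \<inter> C = {}"
      using generic_segment_avoids_C[OF crossing_normals_oriented[OF b(2)] crossing_balanced_oriented[OF b(2)] U(1-3)]
        a(1) b(1) by blast
    then have "closed_segment a b \<subseteq> U"
      using components_maximal[OF assms, of "closed_segment a b"] a(1) by auto
    then show ?thesis using a(1) b(1) by (auto simp: dist_commute)
  qed
  show ?thesis
  proof (rule convexI)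
    fix x y and s t :: real assume xy: "x \<in> closure U" "y \<in> closure U" and st: "0 \<le> s" "0 \<le> t" "s + t = 1"
    show "s *\<^sub>R x + t *\<^sub>R y \<in> closure U"
    proof (unfold closure_approachable, intro allI impI)
      fix e :: real assume "e > 0"
      then obtain a b where ab: "a \<in> U" "b \<in> U" "dist a x < e" "dist b y < e" "closed_segment a b \<subseteq> U"
        using near[OF xy] by blast
      have "s *\<^sub>R a + t *\<^sub>R b \<in> closed_segment a b" unfolding in_segment using st by (intro exI[of _ t]) auto
      then have "s *\<^sub>R a + t *\<^sub>R b \<in> U" using ab(5) by blast
      moreover have "dist (s *\<^sub>R a + t *\<^sub>R b) (s *\<^sub>R x + t *\<^sub>R y) < e"
      proof -
        have "(s *\<^sub>R a + t *\<^sub>R b) - (s *\<^sub>R x + t *\<^sub>R y) = s *\<^sub>R (a - x) + t *\<^sub>R (b - y)" by (simp add: algebra_simps)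
        then have "dist (s *\<^sub>R a + t *\<^sub>R b) (s *\<^sub>R x + t *\<^sub>R y) \<le> s * dist a x + t * dist b y"
          using norm_triangle_ineq[of "s *\<^sub>R (a - x)" "t *\<^sub>R (b - y)"] st by (simp add: dist_norm)
        also have "\<dots> < e" using convex_bound_lt[OF ab(3,4) st] by simp
        finally show ?thesis .
      qed
      ultimately show "\<exists>z\<in>U. dist z (s *\<^sub>R x + t *\<^sub>R y) < e" by blast
    qed
  qed
qed

text \<open>A point of \<open>C\<close> in the interior of the closure would have a cell nearby with
  \<open>U\<close> on both sides. Consequently components and regions determine each other.\<close>

lemma interior_closure_component:
  assumes "U \<in> components (- C)" shows "interior (closure U) = U"
proof
  note U = component_props[OF assms]
  show "U \<subseteq> interior (closure U)" using U(1) by (simp add: closure_subset interior_maximal)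
  show "interior (closure U) \<subseteq> U"
  proof
    fix y assume y: "y \<in> interior (closure U)"
    show "y \<in> U"
    proof (cases "y \<in> C")
      case False then show ?thesis using closure_component[OF assms] y interior_subset by blast
    next
      case True
      then obtain \<sigma> y' where s: "\<sigma> \<in> M" and y': "y' \<in> rel_interior \<sigma>" "y' \<in> interior (closure U)"
        using rel_interior_M_near[OF _ open_interior y] by blast
      have int: "eventually (\<lambda>x. x \<in> interior (closure U)) (nhds y')"
        using y'(2) by (intro eventually_nhds_in_open) auto
      have "side \<sigma> n = U" if n: "is_normal n \<sigma>" for n
      proof -
        obtain t where t: "y' + t *\<^sub>R n \<in> side \<sigma> n" "y' + t *\<^sub>R n \<in> interior (closure U)"
          using eventually_conj[OF side_ray[OF s n y'(1)] eventually_ray[OF int, of n]]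
          by (auto elim: eventually_at_right_0_ex)
        have "y' + t *\<^sub>R n \<notin> C" using t(1) component_props(3)[OF side_component[OF s n]] by blast
        then have "y' + t *\<^sub>R n \<in> U" using closure_component[OF assms] t(2) interior_subset by blast
        then show ?thesis using component_eqI[OF side_component[OF s n] assms t(1)] by blast
      qed
      then have "side \<sigma> (X \<sigma>) = side \<sigma> (- X \<sigma>)" using normal_X[OF s] by simp
      then show ?thesis using sides_distinct[OF s normal_X[OF s]] by blast
    qed
  qed
qed

lemma closure_component_inject:
  assumes "U \<in> components (- C)" "W \<in> components (- C)" "closure U = closure W" shows "U = W"
  using interior_closure_component assms by metis

lemma convex_component: "U \<in> components (- C) \<Longrightarrow> convex U"
  using convex_interior[OF convex_closure_component] interior_closure_component by metis

lemma disjoint_components: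
  assumes "U \<in> components (- C)" "W \<in> components (- C)" "U \<noteq> W"
  shows "U \<inter> W = {}" "closure U \<inter> closure W \<subseteq> C"
  using component_eqI[OF assms(1,2)] closure_component[OF assms(1)] closure_component[OF assms(2)] assms(3)
  by blast+

text \<open>The two closures are closures of disjoint components, so their convex intersection has
  empty interior; as it contains \<sigma>, its dimension is one less than full. Equality of
  dimensions then identifies the parallel spaces.\<close>

lemma cell_sides_edge:
  assumes "\<sigma> \<in> M" "is_normal n \<sigma>"
  shows "{closure (side \<sigma> n), closure (side \<sigma> (- n))} \<in> dual_edges C"
    "parallel_space (closure (side \<sigma> n) \<inter> closure (side \<sigma> (- n))) = parallel_space \<sigma>"
proof -
  have n': "is_normal (- n) \<sigma>" using assms(2) by simp
  let ?U = "side \<sigma> n" and ?W = "side \<sigma> (- n)"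
  let ?S = "closure ?U \<inter> closure ?W"
  have U: "?U \<in> components (- C)" and W: "?W \<in> components (- C)" and UW: "?U \<noteq> ?W"
    using side_component assms n' sides_distinct by blast+
  have sub: "\<sigma> \<subseteq> ?S" using cell_subset_closure_side assms n' by blast
  have ne: "\<sigma> \<noteq> {}" using cell(4) M_K assms(1) by blast
  have conv: "convex ?S" using convex_closure_component U W by (simp add: convex_Int)
  have "interior ?S = {}"
    using interior_closure_component[OF U] interior_closure_component[OF W] disjoint_components(1)[OF U W UW] by simp
  have "aff_dim ?S \<noteq> int CARD('n)"
  proof
    assume "aff_dim ?S = int CARD('n)"
    then have "affine hull ?S = UNIV" using aff_dim_eq_full[of ?S] by simp
    then have "rel_interior ?S = {}" using rel_interior_interior \<open>interior ?S = {}\<close> by blast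
    then show False using rel_interior_eq_empty[OF conv] sub ne by blast
  qed
  moreover have "aff_dim ?S \<le> int CARD('n)" using aff_dim_le_DIM[of ?S] by simp
  moreover have "aff_dim \<sigma> \<le> aff_dim ?S" using sub aff_dim_subset by blast
  ultimately have dim: "aff_dim ?S = int CARD('n) - 1" using aff_dim_M[OF assms(1)] by linarith
  moreover have "closure ?U \<noteq> closure ?W" using closure_component_inject[OF U W] UW by blast
  moreover have "closure ?U \<in> regions C" "closure ?W \<in> regions C" using U W by (auto simp: regions_def)
  ultimately show "{closure ?U, closure ?W} \<in> dual_edges C" unfolding dual_edges_def by blast
  have "?S \<noteq> {}" using sub ne by blast
  then have "int (dim (parallel_space ?S)) = int (dim (parallel_space \<sigma>))"
    using aff_dim_parallel_space[of ?S] aff_dim_parallel_space[OF ne] dim aff_dim_M[OF assms(1)] by simp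
  then show "parallel_space ?S = parallel_space \<sigma>"
    using subspace_dim_equal[of "parallel_space \<sigma>" "parallel_space ?S"] parallel_space_mono[OF sub] by simp
qed

text \<open>The orientation of \<open>x\<close> is tested at some point \<open>s\<close> of the edge
  that need not lie in \<sigma>. If it were opposite at a point \<open>y\<close> of \<sigma>, then
  \<open>?U\<close> would contain \<open>s + t *\<^sub>R x\<close> and
  \<open>y - t *\<^sub>R x\<close>, while \<open>?W\<close> would contain
  \<open>s - t *\<^sub>R x\<close> and \<open>y + t *\<^sub>R x\<close>; both pairs have the same
  midpoint, and the components are convex and disjoint.\<close>

lemma crossing_vector_side:
  assumes "\<sigma> \<in> M" "is_normal n \<sigma>" "crossing_vector (closure (side \<sigma> n)) (closure (side \<sigma> (- n))) x"
  shows "primitive_normal x \<sigma>" "side \<sigma> x = side \<sigma> n" "side \<sigma> (- x) = side \<sigma> (- n)"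
proof -
  let ?U = "side \<sigma> n" and ?W = "side \<sigma> (- n)"
  have n': "is_normal (- n) \<sigma>" using assms(2) by simp
  have U: "?U \<in> components (- C)" and W: "?W \<in> components (- C)" and UW: "?U \<noteq> ?W"
    using side_component assms n' sides_distinct by blast+
  have "perp_integer_points (closure ?U \<inter> closure ?W) = perp_integer_points \<sigma>"
    using cell_sides_edge(2)[OF assms(1,2)] by (simp add: perp_integer_points_def)
  then show px: "primitive_normal x \<sigma>"
    using assms(3) by (simp add: crossing_vector_def primitive_normal_def)
  then have nx: "is_normal x \<sigma>" by (rule primitive_normal_is_normal)
  obtain c where c: "c \<noteq> 0" "x = c *\<^sub>R n" using normals_collinear[OF assms(1,2) nx] .
  have "c > 0"
  proof (rule ccontr)
    assume "\<not> c > 0"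
    then have c0: "- c > 0" using c(1) by simp
    have sx: "side \<sigma> x = ?W" "side \<sigma> (- x) = ?U"
      using side_scale[OF c0, of \<sigma> n] side_scale[OF c0, of \<sigma> "- n"] c(2) by simp_all
    obtain s e where se: "e > 0" "\<And>t. 0 < t \<and> t < e \<Longrightarrow> s - t *\<^sub>R x \<in> ?W \<and> s + t *\<^sub>R x \<in> ?U"
      using assms(3) unfolding crossing_vector_def interior_closure_component[OF U] interior_closure_component[OF W]
      by blast
    obtain y where y: "y \<in> rel_interior \<sigma>" using rel_interior_M_nonempty assms(1) by blast
    have "eventually (\<lambda>t. 0 < t \<and> t < e) (at_right 0)"
      using se(1) by (auto simp: eventually_at_right_field)
    from eventually_conj[OF side_ray[OF assms(1) nx y] this]
    obtain t where t: "y + t *\<^sub>R x \<in> side \<sigma> x" "y - t *\<^sub>R x \<in> side \<sigma> (- x)" "0 < t" "t < e"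
      by (auto elim: eventually_at_right_0_ex)
    have in4: "s + t *\<^sub>R x \<in> ?U" "y - t *\<^sub>R x \<in> ?U" "s - t *\<^sub>R x \<in> ?W" "y + t *\<^sub>R x \<in> ?W"
      using se(2)[of t] t sx by auto
    have "(1/2) *\<^sub>R (s + t *\<^sub>R x) + (1/2) *\<^sub>R (y - t *\<^sub>R x) \<in> ?U"
      by (rule convexD[OF convex_component[OF U] in4(1,2)]) auto
    moreover have "(1/2) *\<^sub>R (s - t *\<^sub>R x) + (1/2) *\<^sub>R (y + t *\<^sub>R x) \<in> ?W"
      by (rule convexD[OF convex_component[OF W] in4(3,4)]) auto
    moreover have "(1/2) *\<^sub>R (s + t *\<^sub>R x) + (1/2) *\<^sub>R (y - t *\<^sub>R x) = (1/2) *\<^sub>R (s - t *\<^sub>R x) + (1/2) *\<^sub>R (y + t *\<^sub>R x)"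
      by (simp add: algebra_simps)
    ultimately show False using disjoint_components(1)[OF U W UW] by auto
  qed
  then show "side \<sigma> x = ?U" "side \<sigma> (- x) = ?W"
    using side_scale[of c \<sigma> n] side_scale[of c \<sigma> "- n"] c(2) by simp_all
qed

text \<open>The edge may consist of several cells of \<open>K\<close>. A generic point of it lies in
  the relative interior of a maximal cell, near which there are only the two sides, so these are the
  given components.\<close>

lemma edge_is_cell:
  assumes "{v, w} \<in> dual_edges C" "crossing_vector v w x"
  obtains \<sigma> where "\<sigma> \<in> M" "primitive_normal x \<sigma>" "v = closure (side \<sigma> x)" "w = closure (side \<sigma> (- x))"
proof -
  have vw: "v \<in> regions C" "w \<in> regions C" "v \<noteq> w" "aff_dim (v \<inter> w) = int CARD('n) - 1"
    using assms(1) by (auto simp: dual_edges_def doubleton_eq_iff Int_commute)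
  obtain U W where U: "U \<in> components (- C)" "v = closure U" and W: "W \<in> components (- C)" "w = closure W"
    using vw by (auto simp: regions_def)
  have UW: "U \<noteq> W" using vw(3) U W by blast
  let ?S = "v \<inter> w"
  have SC: "?S \<subseteq> C" using disjoint_components(2)[OF U(1) W(1) UW] U(2) W(2) by simp
  obtain s where s: "s \<in> rel_interior ?S" using assms(2) by (auto simp: crossing_vector_def)
  have sS: "s \<in> ?S" using s rel_interior_subset by blast
  have x: "x \<noteq> 0" "\<And>y. y \<in> parallel_space ?S \<Longrightarrow> x \<bullet> y = 0"
    using assms(2) by (auto simp: crossing_vector_def perp_integer_points_def)
  have par: "parallel_space ?S = {y. x \<bullet> y = 0}"
    using parallel_space_eq_hyperplane[OF vw(4) _ x] sS by blast
  obtain \<delta> where \<delta>: "\<delta> > 0" "ball s \<delta> \<inter> affine hull ?S \<subseteq> ?S" using s mem_rel_interior_ball by blast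
  \<comment> \<open>Projection along \<open>x\<close> to the affine hull of \<open>?S\<close>:
    genericity is obtained in an open set and carried over, since \<open>T x\<close> is invariant
    along \<open>x\<close>.\<close>
  define f where "f = (\<lambda>a. a - ((x \<bullet> (a - s)) / (x \<bullet> x)) *\<^sub>R x)"
  let ?O = "{a. dist s (f a) < \<delta>}"
  have "open ?O" unfolding f_def by (intro open_Collect_less continuous_intros) (use x(1) in auto)
  moreover have "s \<in> ?O" using \<delta>(1) by (simp add: f_def)
  ultimately obtain a where a: "a \<in> ?O" "a \<notin> T x" using open_avoids_T[of ?O "{}" x] by auto
  have "x \<bullet> (f a - s) = 0" using x(1) by (simp add: f_def inner_diff_right)
  then have "f a \<in> affine hull ?S" using affine_hull_parallel_space[of s ?S "f a"] sS par by (simp add: hull_inc)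
  then have fS: "f a \<in> ?S" using \<delta>(2) a(1) by auto
  have "a = f a + ((x \<bullet> (a - s)) / (x \<bullet> x)) *\<^sub>R x" by (simp add: f_def)
  then have "f a \<notin> T x" using T_shift a(2) by metis
  then obtain \<sigma> where \<sigma>: "\<sigma> \<in> M" "f a \<in> rel_interior \<sigma>" using notin_T_rel_interior[of "f a" x] SC fS by blast
  define n where "n = X \<sigma>"
  have n: "is_normal n \<sigma>" using normal_X[OF \<sigma>(1)] by (simp add: n_def)
  obtain e where e: "e > 0" "\<And>y'. dist y' (f a) < e \<Longrightarrow> n \<bullet> (y' - f a) > 0 \<Longrightarrow> y' \<in> side \<sigma> n"
    "\<And>y'. dist y' (f a) < e \<Longrightarrow> n \<bullet> (y' - f a) < 0 \<Longrightarrow> y' \<in> side \<sigma> (- n)"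
    "\<And>y'. dist y' (f a) < e \<Longrightarrow> y' \<in> C \<longleftrightarrow> n \<bullet> (y' - f a) = 0" using side_ball[OF \<sigma>(1) n \<sigma>(2)] by blast
  have comp: "V = side \<sigma> n \<or> V = side \<sigma> (- n)" if V: "V \<in> components (- C)" "f a \<in> closure V" for V
  proof -
    obtain y' where y': "y' \<in> V" "dist y' (f a) < e" using V(2) e(1) by (auto simp: closure_approachable)
    have "n \<bullet> (y' - f a) \<noteq> 0" using e(4)[OF y'(2)] component_props(3)[OF V(1)] y'(1) by blast
    then consider "y' \<in> side \<sigma> n" | "y' \<in> side \<sigma> (- n)" using e(2,3)[OF y'(2)] by linarith
    then show ?thesis
      using component_eqI[OF V(1) _ y'(1)] side_component[OF \<sigma>(1)] n is_normal_uminus by cases blast+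
  qed
  have "U = side \<sigma> n \<or> U = side \<sigma> (- n)" "W = side \<sigma> n \<or> W = side \<sigma> (- n)"
    using comp[OF U(1)] comp[OF W(1)] fS U(2) W(2) by auto
  then obtain n' where n': "is_normal n' \<sigma>" "U = side \<sigma> n'" "W = side \<sigma> (- n')"
    using UW n by (metis add.inverse_inverse is_normal_uminus)
  have "crossing_vector (closure (side \<sigma> n')) (closure (side \<sigma> (- n'))) x" using assms(2) U W n' by simp
  note cv = crossing_vector_side[OF \<sigma>(1) n'(1) this]
  show ?thesis using that[OF \<sigma>(1) cv(1)] cv(2,3) U(2) W(2) n'(2,3) by simp
qed

end

section \<open>Rigidity implies extremality\<close>

lemma tropical_hypersurface_complex:
  fixes C :: "(real ^ 'n) set"
  assumes "tropical_variety (CARD('n) - 1) C"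
  obtains K \<omega> where "balanced_complex K \<omega>" "\<Union>K = C"
proof -
  obtain K \<omega> where K: "polyhedral_complex K" "has_complex_dim K (CARD('n) - 1)" "pure_complex (CARD('n) - 1) K"
    "rational_complex (CARD('n) - 1) K" "\<Union>K = C" "balanced_weighting (CARD('n) - 1) K \<omega>"
    using assms unfolding tropical_variety_def by blast
  then have "balanced_complex K \<omega>" by unfold_locales
  then show ?thesis using that K(5) by blast
qed

lemma closed_tropical_variety:
  assumes "tropical_variety k C" shows "closed C"
proof -
  obtain K where K: "polyhedral_complex K" "\<Union>K = C" using assms unfolding tropical_variety_def by blast
  then have "closed (\<Union>K)"
    by (intro closed_Union) (auto simp: polyhedral_complex_def intro: polyhedron_imp_closed)
  then show ?thesis using K(2) by simp
qed

text \<open>Off the closed set \<open>C2\<close>, the set \<open>C1\<close> must cover a relatively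
  open piece of a maximal cell, which finitely many cells of smaller dimension cannot do. Full
  dimension is impossible because \<open>C\<close> has empty interior.\<close>

lemma (in hypersurface_complex) component_variety_dim:
  assumes "tropical_variety k C1" "closed C2" "C2 \<noteq> C" "C = C1 \<union> C2"
  shows "k = CARD('n) - 1"
proof -
  obtain K1 where K1: "polyhedral_complex K1" "has_complex_dim K1 k" "\<Union>K1 = C1"
    using assms(1) unfolding tropical_variety_def by blast
  have fin: "finite K1" using K1(1) by (simp add: polyhedral_complex_def)
  have "int CARD('n) - 1 \<le> int k"
  proof (rule ccontr)
    assume "\<not> int CARD('n) - 1 \<le> int k"
    then have low: "aff_dim A < int CARD('n) - 1" if "A \<in> K1" for A
      using K1(2) that unfolding has_complex_dim_def by fastforce
    obtain y where y: "y \<in> C" "y \<notin> C2" using assms(3,4) by blast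
    have "open (- C2)" using assms(2) by (rule open_Compl)
    then obtain \<sigma> y' where s: "\<sigma> \<in> M" and y': "y' \<in> rel_interior \<sigma>" "y' \<in> - C2"
      using rel_interior_M_near[OF y(1)] y(2) by blast
    obtain e where e: "e > 0" "ball y' e \<subseteq> - C2" using \<open>open (- C2)\<close> y'(2) open_contains_ball by blast
    obtain n where n: "is_normal n \<sigma>" using exists_normal s by blast
    then have nn: "n \<bullet> n \<noteq> 0" by (simp add: is_normal_def)
    obtain y'' where y'': "y'' \<in> rel_interior \<sigma>" "dist y'' y' < e" "y'' \<notin> \<Union>(sweep n ` K1)"
      using generic_rel_interior_point[OF s n nn y'(1) e(1) fin low] by metis
    have "y'' \<in> ball y' e" using y''(2) by (simp add: dist_commute)
    then have "y'' \<notin> C2" using e(2) by blast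
    moreover have "y'' \<in> C" using y''(1) rel_interior_subset M_K s by blast
    ultimately have "y'' \<in> C1" using assms(4) by blast
    then obtain c where c: "c \<in> K1" "y'' \<in> c" using K1(3) by blast
    have "y'' \<in> sweep n c" by (rule subsetD[OF affine_hull_subset_sweep hull_inc[OF c(2)]])
    then show False using y''(3) c(1) by blast
  qed
  moreover have "int k \<le> int CARD('n) - 1"
  proof (rule ccontr)
    assume a: "\<not> int k \<le> int CARD('n) - 1"
    obtain c where c: "c \<in> K1" "aff_dim c = int k" using K1(2) unfolding has_complex_dim_def by blast
    have cv: "convex c" "c \<noteq> {}"
      using K1(1) c(1) polyhedron_imp_convex unfolding polyhedral_complex_def by blast+
    have "aff_dim c = int CARD('n)" using a c(2) aff_dim_le_DIM[of c] by simp
    then have "affine hull c = UNIV" using aff_dim_eq_full[of c] by simp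
    then have "interior c \<noteq> {}" using rel_interior_interior rel_interior_eq_empty cv by metis
    then obtain w where "w \<in> interior c" "w \<notin> C" using open_avoids_C[OF open_interior] by blast
    then show False using interior_subset c(1) K1(3) assms(4) by blast
  qed
  ultimately show ?thesis using int_card_pred by linarith
qed

text \<open>The cells of the two complexes need not match. But \<open>q\<close> depends on the
  regions only, so its jump across a cell of \<open>K\<close> may be computed at any single point of
  that cell which is also generic for \<open>K1\<close>.\<close>

lemma not_rigid_if_proper_subhypersurface:
  fixes K K1 :: "(real ^ 'n) set set"
  assumes "balanced_complex K \<omega>" "balanced_complex K1 \<omega>1" and sub: "\<Union>K1 \<subset> \<Union>K"
    and rd: "reciprocal_diagram (\<Union>K) p"
  shows "\<not> direction_rigid (regions (\<Union>K)) (dual_edges (\<Union>K)) p"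
proof
  assume rigid: "direction_rigid (regions (\<Union>K)) (dual_edges (\<Union>K)) p"
  interpret A: balanced_complex K \<omega> by fact
  interpret B: balanced_complex K1 \<omega>1 by fact
  \<comment> \<open>Avoiding these hyperplanes as well gives one direction transversal to both
    complexes.\<close>
  let ?F = "(\<lambda>\<sigma>. {u. B.X \<sigma> \<bullet> u = 0}) ` B.M"
  have F: "aff_dim H < int CARD('n)" if "H \<in> ?F" for H
    using that B.normal_X by (auto simp: aff_dim_hyperplane is_normal_def)
  have "\<exists>u. A.transversal u \<and> B.transversal u"
  proof (rule A.transversal_avoiding[OF open_UNIV UNIV_not_empty, of ?F 0])
    show "finite ?F" by simp
    show "aff_dim H < int CARD('n)" if "H \<in> ?F" for H using F[OF that] .
    fix u assume "A.transversal (u - 0)" "u \<notin> \<Union>?F"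
    then show ?thesis by (intro exI[of _ u]) (auto simp: B.transversal_def)
  qed
  then obtain u where uA: "A.transversal u" and uB: "B.transversal u" by blast
  define P where "P = B.potential u (B.oriented u)"
  \<comment> \<open>Any generic point of the region may be picked: a component of the complement of
    \<open>\<Union>K\<close> misses \<open>\<Union>K1\<close>, so the potential of \<open>K1\<close>
    is constant on it.\<close>
  define q where "q = (\<lambda>v. P (SOME y. y \<in> interior v \<and> y \<notin> B.T u))"
  have qval: "q (closure U) = P y" if U: "U \<in> components (- \<Union>K)" "y \<in> U" "y \<notin> B.T u" for U y
  proof -
    note Up = A.component_props[OF U(1)]
    have iU: "interior (closure U) = U" using A.interior_closure_component[OF U(1)] .
    have "\<exists>y. y \<in> interior (closure U) \<and> y \<notin> B.T u" using U iU by blast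
    then have s: "(SOME y. y \<in> interior (closure U) \<and> y \<notin> B.T u) \<in> U"
      "(SOME y. y \<in> interior (closure U) \<and> y \<notin> B.T u) \<notin> B.T u"
      using iU by (metis (mono_tags, lifting) someI_ex)+
    have "U \<inter> \<Union>K1 = {}" using Up(3) sub by blast
    then show ?thesis unfolding q_def P_def
      using B.oriented_potential_const[OF uB uB Up(1,2)] s U(2,3) by blast
  qed
  have q_same: "q (closure (A.side \<sigma> n)) = q (closure (A.side \<sigma> (- n)))"
    if s: "\<sigma> \<in> A.M" "y \<in> rel_interior \<sigma>" "y \<notin> B.T u" "y \<notin> \<Union>K1" "is_normal n \<sigma>" for \<sigma> y n
  proof -
    have "open (- (\<Union>K1 \<union> B.T u))" using B.closed_C B.closed_T by (intro open_Compl closed_Un)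
    then obtain e where e: "e > 0" "ball y e \<subseteq> - (\<Union>K1 \<union> B.T u)"
      using s(3,4) open_contains_ball by (metis ComplI UnE)
    have "eventually (\<lambda>x. x \<in> ball y e) (nhds y)" using e(1) by (intro eventually_nhds_in_open) auto
    from eventually_conj[OF A.side_ray[OF s(1,5,2)] eventually_ray[OF this, of n]]
    obtain t where t: "y + t *\<^sub>R n \<in> A.side \<sigma> n" "y - t *\<^sub>R n \<in> A.side \<sigma> (- n)"
      and b: "y + t *\<^sub>R n \<in> ball y e" "y - t *\<^sub>R n \<in> ball y e" by (rule eventually_at_right_0_ex) blast
    have n': "is_normal (- n) \<sigma>" using s(5) by simp
    have nT: "y + t *\<^sub>R n \<notin> B.T u" "y - t *\<^sub>R n \<notin> B.T u" using e(2) b by blast+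
    have "ball y e \<inter> \<Union>K1 = {}" using e(2) by blast
    then have "P (y + t *\<^sub>R n) = P (y - t *\<^sub>R n)" unfolding P_def
      by (rule B.oriented_potential_const[OF uB uB open_ball connected_ball _ b nT])
    moreover have "q (closure (A.side \<sigma> n)) = P (y + t *\<^sub>R n)"
      by (rule qval[OF A.side_component[OF s(1,5)] t(1) nT(1)])
    moreover have "q (closure (A.side \<sigma> (- n))) = P (y - t *\<^sub>R n)"
      by (rule qval[OF A.side_component[OF s(1) n'] t(2) nT(2)])
    ultimately show ?thesis by simp
  qed
  have q_jump: "\<exists>m. is_normal m \<sigma> \<and> q (closure (A.side \<sigma> m)) - q (closure (A.side \<sigma> (- m))) = m"
    if s: "\<sigma> \<in> A.M" "y \<in> rel_interior \<sigma>" "y \<notin> B.T u" "y \<in> \<Union>K1" for \<sigma> y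
  proof -
    obtain \<sigma>1 where s1: "\<sigma>1 \<in> B.M" "y \<in> rel_interior \<sigma>1" using B.notin_T_rel_interior[OF s(4,3)] by blast
    obtain m where m: "is_normal m \<sigma>1" "eventually (\<lambda>t. y + t *\<^sub>R m \<notin> B.T u \<and> y - t *\<^sub>R m \<notin> B.T u \<and>
        P (y + t *\<^sub>R m) - P (y - t *\<^sub>R m) = m) (at_right 0)"
      using B.potential_jump[OF uB s1 s(3)] unfolding P_def by blast
    define n where "n = A.X \<sigma>"
    have n: "is_normal n \<sigma>" using A.normal_X[OF s(1)] by (simp add: n_def)
    obtain e1 where e1: "e1 > 0" "\<And>y'. dist y' y < e1 \<Longrightarrow> y' \<in> \<Union>K \<longleftrightarrow> n \<bullet> (y' - y) = 0"
      using A.side_ball[OF s(1) n s(2)] by metis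
    obtain e2 where e2: "e2 > 0" "\<And>y'. dist y' y < e2 \<Longrightarrow> y' \<in> \<Union>K1 \<longleftrightarrow> m \<bullet> (y' - y) = 0"
      using B.side_ball[OF s1(1) m(1) s1(2)] by metis
    \<comment> \<open>Near \<open>y\<close> both sets are hyperplanes and one contains the other, so
      their normals are collinear.\<close>
    have nv: "n \<bullet> v = 0" if v: "m \<bullet> v = 0" for v
    proof -
      obtain t where t: "t > 0" "norm (t *\<^sub>R v) < e1" "norm (t *\<^sub>R v) < e2"
        using exists_small_scale[of "min e1 e2" v] e1(1) e2(1) by auto
      have "y + t *\<^sub>R v \<in> \<Union>K1" using e2(2)[of "y + t *\<^sub>R v"] t(3) v by (simp add: dist_norm)
      then have "y + t *\<^sub>R v \<in> \<Union>K" using sub by blast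
      then show ?thesis using e1(2)[of "y + t *\<^sub>R v"] t(1,2) by (simp add: dist_norm)
    qed
    have m0: "m \<noteq> 0" using m(1) by (simp add: is_normal_def)
    define c where "c = (n \<bullet> m) / (m \<bullet> m)"
    have nc: "n = c *\<^sub>R m" using orthogonal_hyperplane_collinear[of m n] m0 nv unfolding c_def by blast
    then have "c \<noteq> 0" using n by (auto simp: is_normal_def)
    then have mn: "is_normal m \<sigma>" using is_normal_scale[OF n, of "1 / c"] nc by simp
    obtain t where t: "y + t *\<^sub>R m \<notin> B.T u" "y - t *\<^sub>R m \<notin> B.T u" "P (y + t *\<^sub>R m) - P (y - t *\<^sub>R m) = m"
      "y + t *\<^sub>R m \<in> A.side \<sigma> m" "y - t *\<^sub>R m \<in> A.side \<sigma> (- m)"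
      using eventually_conj[OF m(2) A.side_ray[OF s(1) mn s(2)]] by (rule eventually_at_right_0_ex) blast
    have m': "is_normal (- m) \<sigma>" using mn by simp
    have "q (closure (A.side \<sigma> m)) = P (y + t *\<^sub>R m)"
      by (rule qval[OF A.side_component[OF s(1) mn] t(4,1)])
    moreover have "q (closure (A.side \<sigma> (- m))) = P (y - t *\<^sub>R m)"
      by (rule qval[OF A.side_component[OF s(1) m'] t(5,2)])
    ultimately show ?thesis using t(3) mn by auto
  qed
  have low: "aff_dim c < int CARD('n) - 1" if "c \<in> K1 - B.M" for c using B.aff_dim_nonmax[OF that] by simp
  have generic: "\<exists>y'\<in>rel_interior \<sigma>. dist y' y < e \<and> y' \<notin> B.T u"
    if s: "\<sigma> \<in> A.M" "y \<in> rel_interior \<sigma>" "e > 0" for \<sigma> y e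
  proof (rule A.generic_rel_interior_point[OF s(1) A.normal_X[OF s(1)] A.transversal_normal[OF uA s(1) A.normal_X[OF s(1)]] s(2,3)])
    show "finite (K1 - B.M)" by simp
    show "aff_dim c < int CARD('n) - 1" if "c \<in> K1 - B.M" for c using low[OF that] .
  qed (auto simp: B.T_def)
  have "parallel_frameworks (dual_edges (\<Union>K)) q p"
    unfolding parallel_frameworks_def
  proof (intro allI impI)
    fix v w assume vw: "{v, w} \<in> dual_edges (\<Union>K)"
    then obtain x r where xr: "crossing_vector v w x" "r > 0" "p v - p w = r *\<^sub>R x"
      using rd unfolding reciprocal_diagram_def by blast
    obtain \<sigma> where s: "\<sigma> \<in> A.M" "primitive_normal x \<sigma>" "v = closure (A.side \<sigma> x)" "w = closure (A.side \<sigma> (- x))"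
      using A.edge_is_cell[OF vw xr(1)] by blast
    have nx: "is_normal x \<sigma>" using s(2) primitive_normal_is_normal by blast
    obtain y0 where "y0 \<in> rel_interior \<sigma>" using A.rel_interior_M_nonempty s(1) by blast
    then obtain y where y: "y \<in> rel_interior \<sigma>" "y \<notin> B.T u" using generic[OF s(1) _ zero_less_one] by blast
    show "\<exists>l. q v - q w = l *\<^sub>R (p v - p w)"
    proof (cases "y \<in> \<Union>K1")
      case False
      then have "q v = q w" using q_same[OF s(1) y(1,2) _ nx] s(3,4) by simp
      then show ?thesis by (intro exI[of _ 0]) simp
    next
      case True
      then obtain m where m: "is_normal m \<sigma>" "q (closure (A.side \<sigma> m)) - q (closure (A.side \<sigma> (- m))) = m"
        using q_jump[OF s(1) y] by blast
      obtain c where c: "c \<noteq> 0" "m = c *\<^sub>R x" using A.normals_collinear[OF s(1) nx m(1)] .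
      \<comment> \<open>For negative \<open>c\<close> the normal \<open>m\<close> points from
        \<open>v\<close> to \<open>w\<close>, and the jump is read backwards.\<close>
      have "q v - q w = \<bar>c\<bar> *\<^sub>R x"
      proof (cases "c > 0")
        case True
        then show ?thesis
          using A.side_scale[of c \<sigma> x] A.side_scale[of c \<sigma> "- x"] c(2) m(2) s(3,4) by simp
      next
        case False
        then have c0: "- c > 0" using c(1) by simp
        then have "q w - q v = c *\<^sub>R x"
          using A.side_scale[OF c0, of \<sigma> x] A.side_scale[OF c0, of \<sigma> "- x"] c(2) m(2) s(3,4) by simp
        then have "q v - q w = - (c *\<^sub>R x)" by (metis minus_diff_eq)
        then show ?thesis using c0 by simp
      qed
      then have "q v - q w = (\<bar>c\<bar> / r) *\<^sub>R (p v - p w)" using xr(2,3) by simp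
      then show ?thesis by blast
    qed
  qed
  then obtain z l where zl: "\<And>v. v \<in> regions (\<Union>K) \<Longrightarrow> q v = l *\<^sub>R p v + z"
    using rigid unfolding direction_rigid_def by blast
  have reg: "closure (A.side \<sigma> n) \<in> regions (\<Union>K)" if "\<sigma> \<in> A.M" "is_normal n \<sigma>" for \<sigma> n
    using A.side_component[OF that] by (simp add: regions_def)
  \<comment> \<open>A cell with a generic point off \<open>\<Union>K1\<close> gives an edge that is
    collapsed by \<open>q\<close> but not by \<open>p\<close>.\<close>
  have "l = 0"
  proof -
    obtain y0 where y0: "y0 \<in> \<Union>K" "y0 \<notin> \<Union>K1" using sub by blast
    have op: "open (- \<Union>K1)" using B.closed_C by (rule open_Compl)
    then obtain \<sigma> y1 where s: "\<sigma> \<in> A.M" and y1: "y1 \<in> rel_interior \<sigma>" "y1 \<in> - \<Union>K1"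
      using A.rel_interior_M_near[OF y0(1)] y0(2) by (metis ComplI)
    obtain e where e: "e > 0" "ball y1 e \<subseteq> - \<Union>K1" using op y1(2) open_contains_ball by blast
    obtain y where y: "y \<in> rel_interior \<sigma>" "dist y y1 < e" "y \<notin> B.T u" using generic[OF s y1(1) e(1)] by blast
    have "y \<in> ball y1 e" using y(2) by (simp add: dist_commute)
    then have "y \<notin> \<Union>K1" using e(2) by blast
    define n where "n = A.X \<sigma>"
    have n: "is_normal n \<sigma>" "is_normal (- n) \<sigma>" using A.normal_X[OF s] by (simp_all add: n_def)
    let ?v = "closure (A.side \<sigma> n)" and ?w = "closure (A.side \<sigma> (- n))"
    have "q ?v = q ?w" using q_same[OF s y(1,3) \<open>y \<notin> \<Union>K1\<close> n(1)] .
    then have l0: "l *\<^sub>R (p ?v - p ?w) = 0"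
      using zl[OF reg[OF s n(1)]] zl[OF reg[OF s n(2)]] by (simp add: algebra_simps)
    obtain x r where xr: "crossing_vector ?v ?w x" "r > 0" "p ?v - p ?w = r *\<^sub>R x"
      using rd A.cell_sides_edge(1)[OF s n(1)] unfolding reciprocal_diagram_def by blast
    have "x \<noteq> 0" using xr(1) by (simp add: crossing_vector_def perp_integer_points_def)
    then show ?thesis using l0 xr by simp
  qed
  \<comment> \<open>A point of a cell of \<open>K1\<close> that is generic for both complexes gives
    an edge not collapsed by \<open>q\<close>, against \<open>l = 0\<close>.\<close>
  obtain \<sigma>1 y0 where s1: "\<sigma>1 \<in> B.M" "y0 \<in> rel_interior \<sigma>1"
    using B.M_nonempty B.rel_interior_M_nonempty by blast
  have lowA: "aff_dim c < int CARD('n) - 1" if "c \<in> K - A.M" for c using A.aff_dim_nonmax[OF that] by simp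
  have "\<exists>y\<in>rel_interior \<sigma>1. y \<notin> B.T u \<and> y \<notin> A.T u"
  proof (rule B.generic_rel_interior_point[OF s1(1) B.normal_X[OF s1(1)] B.transversal_normal[OF uB s1(1) B.normal_X[OF s1(1)]] s1(2) zero_less_one])
    show "finite (K - A.M)" by simp
    show "aff_dim c < int CARD('n) - 1" if "c \<in> K - A.M" for c using lowA[OF that] .
  qed (auto simp: A.T_def)
  then obtain y where y: "y \<in> rel_interior \<sigma>1" "y \<notin> B.T u" "y \<notin> A.T u" by blast
  have yK1: "y \<in> \<Union>K1" using y(1) rel_interior_subset B.M_K s1(1) by blast
  then have "y \<in> \<Union>K" using sub by blast
  then obtain \<sigma> where s: "\<sigma> \<in> A.M" "y \<in> rel_interior \<sigma>" using A.notin_T_rel_interior[OF _ y(3)] by blast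
  obtain m where m: "is_normal m \<sigma>" "q (closure (A.side \<sigma> m)) - q (closure (A.side \<sigma> (- m))) = m"
    using q_jump[OF s y(2) yK1] by blast
  have "is_normal (- m) \<sigma>" using m(1) by simp
  then have "m = 0"
    using m(2) zl[OF reg[OF s(1) m(1)]] zl[OF reg[OF s(1), of "- m"]] \<open>l = 0\<close> by simp
  then show False using m(1) by (simp add: is_normal_def)
qed

lemma rigid_imp_extremal:
  fixes C :: "(real ^ 'n) set"
  assumes "tropical_hypersurface C" "reciprocal_diagram C p" "direction_rigid (regions C) (dual_edges C) p"
  shows "extremal C"
  unfolding extremal_def
proof
  assume "\<exists>C1 C2. (\<exists>k. tropical_variety k C1) \<and> (\<exists>k. tropical_variety k C2) \<and> C1 \<subset> C \<and> C2 \<subset> C \<and> C = C1 \<union> C2"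
  then obtain C1 C2 k k2 where C12: "tropical_variety k C1" "tropical_variety k2 C2" "C1 \<subset> C" "C2 \<subset> C" "C = C1 \<union> C2"
    by blast
  obtain K \<omega> where K: "balanced_complex K \<omega>" "\<Union>K = C"
    using tropical_hypersurface_complex assms(1) unfolding tropical_hypersurface_def by blast
  interpret A: balanced_complex K \<omega> by fact
  have "k = CARD('n) - 1"
    using A.component_variety_dim[OF C12(1) closed_tropical_variety[OF C12(2)]] C12(4,5) K(2) by blast
  then obtain K1 \<omega>1 where K1: "balanced_complex K1 \<omega>1" "\<Union>K1 = C1"
    using tropical_hypersurface_complex C12(1) by blast
  then show False
    using not_rigid_if_proper_subhypersurface[OF K(1) K1(1)] C12(3) K(2) K1(2) assms(2,3) by blast
qed

section \<open>Extremality implies rigidity\<close>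

lemma eventually_nhds_inner_sign:
  fixes n :: "'a::real_inner"
  assumes "n \<bullet> (x - y0) \<noteq> 0"
  shows "eventually (\<lambda>y. n \<bullet> (y - y0) > 0 \<longleftrightarrow> n \<bullet> (x - y0) > 0) (nhds x)"
proof -
  have c: "continuous_on UNIV (\<lambda>y. n \<bullet> (y - y0))" by (intro continuous_intros)
  show ?thesis
  proof (cases "n \<bullet> (x - y0) > 0")
    case True
    have "eventually (\<lambda>y. n \<bullet> (y - y0) \<in> {0<..}) (nhds x)"
      unfolding eventually_nhds using open_vimage[OF open_greaterThan c] True
      by (intro exI[of _ "(\<lambda>y. n \<bullet> (y - y0)) -` {0<..}"]) auto
    then show ?thesis by (rule eventually_mono) (use True in auto)
  next
    case False
    then have "n \<bullet> (x - y0) < 0" using assms by simp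
    then have "eventually (\<lambda>y. n \<bullet> (y - y0) \<in> {..<0}) (nhds x)"
      unfolding eventually_nhds using open_vimage[OF open_lessThan c]
      by (intro exI[of _ "(\<lambda>y. n \<bullet> (y - y0)) -` {..<0}"]) auto
    then show ?thesis by (rule eventually_mono) (use False in auto)
  qed
qed

section \<open>Functions on components and connectedness of the dual graph\<close>

context hypersurface_complex
begin

text \<open>Turns functions on components into functions of points, to which local constancy
  applies; at points of \<open>C\<close> the value is the empty set.\<close>

definition comp :: "real ^ 'n \<Rightarrow> (real ^ 'n) set" where
  "comp y = connected_component_set (- C) y"

lemma comp_eq: assumes "U \<in> components (- C)" "y \<in> U" shows "comp y = U"
proof -
  have "y \<notin> C" using component_props(3)[OF assms(1)] assms(2) by blast
  then have "comp y \<in> components (- C)" "y \<in> comp y" by (auto simp: comp_def componentsI connected_component_refl)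
  then show ?thesis using component_eqI assms by blast
qed

lemma comp_near_side:
  assumes "\<sigma> \<in> M" "is_normal n \<sigma>" "x \<in> rel_interior \<sigma>"
  shows "eventually (\<lambda>y. y \<notin> C \<longrightarrow> (n \<bullet> (y - x) > 0 \<and> comp y = side \<sigma> n) \<or>
           (n \<bullet> (y - x) < 0 \<and> comp y = side \<sigma> (- n))) (nhds x)"
proof -
  have n': "is_normal (- n) \<sigma>" using assms(2) by simp
  obtain e where e: "e > 0" "\<And>y'. dist y' x < e \<Longrightarrow> n \<bullet> (y' - x) > 0 \<Longrightarrow> y' \<in> side \<sigma> n"
    "\<And>y'. dist y' x < e \<Longrightarrow> n \<bullet> (y' - x) < 0 \<Longrightarrow> y' \<in> side \<sigma> (- n)"
    "\<And>y'. dist y' x < e \<Longrightarrow> y' \<in> C \<longleftrightarrow> n \<bullet> (y' - x) = 0" using side_ball[OF assms] by blast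
  have "(n \<bullet> (y - x) > 0 \<and> comp y = side \<sigma> n) \<or> (n \<bullet> (y - x) < 0 \<and> comp y = side \<sigma> (- n))"
    if y: "dist y x < e" "y \<notin> C" for y
  proof -
    have "n \<bullet> (y - x) \<noteq> 0" using e(4)[OF y(1)] y(2) by blast
    then consider "n \<bullet> (y - x) > 0" | "n \<bullet> (y - x) < 0" by linarith
    then show ?thesis
      using e(2,3)[OF y(1)] comp_eq[OF side_component[OF assms(1,2)]] comp_eq[OF side_component[OF assms(1) n']]
      by cases auto
  qed
  then show ?thesis unfolding eventually_nhds_metric using e(1) by blast
qed

lemma comp_near_complement:
  assumes "x \<notin> C" shows "eventually (\<lambda>y. comp y = comp x) (nhds x)"
proof -
  obtain U where U: "U \<in> components (- C)" "x \<in> U" using component_of[OF assms] by blast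
  then show ?thesis unfolding eventually_nhds using component_props(1) comp_eq by (intro exI[of _ U]) auto
qed

text \<open>This says that the dual graph is connected.\<close>

lemma equal_across_cells_imp_constant:
  assumes n: "\<And>\<sigma>. \<sigma> \<in> M \<Longrightarrow> is_normal (n \<sigma>) \<sigma>"
    and f: "\<And>\<sigma>. \<sigma> \<in> M \<Longrightarrow> f (side \<sigma> (n \<sigma>)) = f (side \<sigma> (- n \<sigma>))"
    and UW: "U \<in> components (- C)" "W \<in> components (- C)"
  shows "f U = f W"
proof -
  \<comment> \<open>The affine hulls of lower cells have codimension at least two, so their
    complement is connected, and inside it \<open>C\<close> is crossed only through relative
    interiors of maximal cells.\<close>
  let ?F = "(\<lambda>c. affine hull c) ` (K - M)"
  have nm: "aff_dim c < int CARD('n) - 1" if "c \<in> K - M" for c using aff_dim_nonmax[OF that] by simp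
  have F: "affine A \<and> aff_dim A < int DIM(real ^ 'n) - 1" if "A \<in> ?F" for A using that nm by auto
  have conn: "connected (UNIV - \<Union>?F)"
    by (rule connected_open_minus_affines) (use F in auto)
  have opS: "open (UNIV - \<Union>?F)" by (intro open_Diff closed_Union) auto
  have avoid: "\<exists>a\<in>V. a \<in> UNIV - \<Union>?F" if V: "open V" "V \<noteq> {}" for V
  proof (rule open_avoids_lowdim[OF V, of ?F])
    show "aff_dim A < int DIM(real ^ 'n)" if "A \<in> ?F" for A using F[OF that] by simp
  qed auto
  obtain a where a: "a \<in> U" "a \<in> UNIV - \<Union>?F" using avoid component_props(1,4)[OF UW(1)] by blast
  obtain b where b: "b \<in> W" "b \<in> UNIV - \<Union>?F" using avoid component_props(1,4)[OF UW(2)] by blast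
  have "f (comp a) = f (comp b)"
  proof (rule locally_constant_imp_constant[OF conn opS, where P = "\<lambda>x. x \<notin> C" and f = "\<lambda>y. f (comp y)"])
    show "a \<in> UNIV - \<Union>?F" "b \<in> UNIV - \<Union>?F" by fact+
    show "a \<notin> C" "b \<notin> C" using component_props(3) UW a(1) b(1) by blast+
    show "\<exists>z\<in>V. z \<notin> C" if "open V" "V \<noteq> {}" for V using open_avoids_C[OF that] by blast
      show "\<exists>q. eventually (\<lambda>y. y \<notin> C \<longrightarrow> f (comp y) = q) (nhds x)"
      if x: "x \<in> UNIV - \<Union>?F" for x
      proof (cases "x \<in> C")
        case False
        then have "eventually (\<lambda>y. y \<notin> C \<longrightarrow> f (comp y) = f (comp x)) (nhds x)"
          by (intro eventually_mono[OF comp_near_complement]) auto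
        then show ?thesis by blast
      next
        case True
        then obtain \<sigma> where s: "\<sigma> \<in> M" "x \<in> rel_interior \<sigma>"
          using rel_interior_M_if_nonmax_avoided[of x] x by blast
        have "eventually (\<lambda>y. y \<notin> C \<longrightarrow> f (comp y) = f (side \<sigma> (n \<sigma>))) (nhds x)"
          by (rule eventually_mono[OF comp_near_side[OF s(1) n[OF s(1)] s(2)]]) (use f[OF s(1)] in auto)
        then show ?thesis by blast
      qed
  qed
  then show ?thesis using comp_eq UW a(1) b(1) by simp
qed

end

section \<open>Balancing from the jumps of a function on components\<close>

context balanced_complex
begin

lemma side_sgn:
  assumes "\<sigma> \<in> M" "g (side \<sigma> y) - g (side \<sigma> (- y)) = w *\<^sub>R y" "t \<noteq> (0::real)"
  shows "g (side \<sigma> (sgn t *\<^sub>R y)) - g (side \<sigma> (- (sgn t *\<^sub>R y))) = w *\<^sub>R sgn t *\<^sub>R y"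
proof (cases "t > 0")
  case False
  then have "sgn t = - 1" using assms(3) by simp
  moreover have "g (side \<sigma> (- y)) - g (side \<sigma> y) = - (w *\<^sub>R y)" using assms(2) by (metis minus_diff_eq)
  ultimately show ?thesis by simp
qed (use assms in simp)

text \<open>On each side of the hyperplane spanned by the ridge and \<open>u\<close>, the function \<open>g\<close> jumps by
  \<open>w \<sigma> *\<^sub>R n \<sigma>\<close> at every cell crossed in direction \<open>u\<close>; the total change from below to above the
  ridge is the same on both sides.\<close>

lemma jumps_balanced_at_ridge:
  fixes g :: "(real ^ 'n) set \<Rightarrow> real ^ 'n"
  assumes Y: "\<And>\<sigma>. \<sigma> \<in> M \<Longrightarrow> primitive_normal (Y \<sigma>) \<sigma>"
    and g: "\<And>\<sigma>. \<sigma> \<in> M \<Longrightarrow> g (side \<sigma> (Y \<sigma>)) - g (side \<sigma> (- Y \<sigma>)) = w \<sigma> *\<^sub>R Y \<sigma>"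
    and \<tau>: "\<tau> \<in> Rd" and z: "\<And>\<sigma>. \<sigma> \<in> star \<tau> \<Longrightarrow> lattice_normal \<tau> \<sigma> (z \<sigma>)"
  shows "(\<Sum>\<sigma>\<in>star \<tau>. w \<sigma> *\<^sub>R z \<sigma>) \<in> parallel_space \<tau>"
proof -
  obtain u where u: "transversal u" using transversal_avoiding[of UNIV "{}" 0] by auto
  have Yu: "Y \<sigma> \<bullet> u \<noteq> 0" if "\<sigma> \<in> M" for \<sigma>
    using transversal_normal[OF u that primitive_normal_is_normal[OF Y[OF that]]] .
  \<comment> \<open>The jump and the normal change sign together, so orienting along
    \<open>u\<close> preserves the coefficient \<open>w \<sigma>\<close>.\<close>
  define n where "n = (\<lambda>\<sigma>. sgn (Y \<sigma> \<bullet> u) *\<^sub>R Y \<sigma>)"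
  have n: "is_normal (n \<sigma>) \<sigma>" "n \<sigma> \<bullet> u > 0" if "\<sigma> \<in> M" for \<sigma>
    using is_normal_scale[OF primitive_normal_is_normal[OF Y[OF that]], of "sgn (Y \<sigma> \<bullet> u)"] Yu[OF that]
    by (auto simp: n_def sgn_zero_iff) (simp add: sgn_if)
  have jump: "g (side \<sigma> (n \<sigma>)) - g (side \<sigma> (- n \<sigma>)) = w \<sigma> *\<^sub>R n \<sigma>" if "\<sigma> \<in> M" for \<sigma>
    unfolding n_def using side_sgn[OF that g[OF that] Yu[OF that]] by simp
  show ?thesis
  proof (rule balanced_iff_sides[OF \<tau>, of z Y u])
    fix h assume h: "\<And>v. v \<in> parallel_space \<tau> \<Longrightarrow> h \<bullet> v = 0" "h \<bullet> u = 0"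
      "\<And>\<sigma>. \<sigma> \<in> star \<tau> \<Longrightarrow> h \<bullet> z \<sigma> \<noteq> 0"
      and bal: "\<And>\<omega>. (\<Sum>\<sigma>\<in>star \<tau>. \<omega> \<sigma> *\<^sub>R z \<sigma>) \<in> parallel_space \<tau> \<longleftrightarrow>
       (\<Sum>\<sigma> | \<sigma> \<in> star \<tau> \<and> h \<bullet> z \<sigma> > 0. \<omega> \<sigma> *\<^sub>R sgn (Y \<sigma> \<bullet> u) *\<^sub>R Y \<sigma>) =
       (\<Sum>\<sigma> | \<sigma> \<in> star \<tau> \<and> h \<bullet> z \<sigma> < 0. \<omega> \<sigma> *\<^sub>R sgn (Y \<sigma> \<bullet> u) *\<^sub>R Y \<sigma>)"
    obtain y0 where y0: "y0 \<in> rel_interior \<tau>" using cell(2,4)[OF Rd_K[OF \<tau>]] rel_interior_eq_empty by blast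
    have y0s: "y0 \<in> \<sigma>" if "\<sigma> \<in> star \<tau>" for \<sigma>
      using that y0 rel_interior_subset face_of_imp_subset unfolding star_def by blast
    have "\<exists>e>0. \<forall>p \<in> affine hull \<sigma>. dist p y0 < e \<longrightarrow> (p \<in> \<sigma> \<longleftrightarrow> 0 \<le> (h \<bullet> (p - y0)) * (h \<bullet> z \<sigma>))"
      if s: "\<sigma> \<in> star \<tau>" for \<sigma>
    proof -
      obtain x l where "x \<in> \<tau>" "l > 0" "x + l *\<^sub>R z \<sigma> \<in> \<sigma>" "z \<sigma> \<in> parallel_space \<sigma>"
        using z[OF s] by (auto simp: lattice_normal_def cell_lattice_def)
      then show ?thesis using halfspace_near_ridge[OF \<tau> s y0, of h "z \<sigma>" x l] h(1) h(3)[OF s] by blast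
    qed
    then obtain e1 where e1: "\<And>\<sigma>. \<sigma> \<in> star \<tau> \<Longrightarrow> e1 \<sigma> > 0 \<and> (\<forall>p \<in> affine hull \<sigma>. dist p y0 < e1 \<sigma> \<longrightarrow>
        (p \<in> \<sigma> \<longleftrightarrow> 0 \<le> (h \<bullet> (p - y0)) * (h \<bullet> z \<sigma>)))" by metis
    obtain e2 where e2: "e2 > 0" "\<forall>c\<in>K. c \<inter> ball y0 e2 \<noteq> {} \<longrightarrow> y0 \<in> c" using cells_near by blast
    \<comment> \<open>Small enough that the ball meets only cells with \<tau> as a face, and that in
      it each cell of the star is a half-space of its affine hull.\<close>
    define e where "e = Min (insert e2 (e1 ` star \<tau>))"
    have e: "e > 0" "e \<le> e2" "\<And>\<sigma>. \<sigma> \<in> star \<tau> \<Longrightarrow> e \<le> e1 \<sigma>" using e1 e2(1) by (auto simp: e_def)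
    define B where "B = ball y0 e"
    have half: "p \<in> \<sigma> \<longleftrightarrow> 0 \<le> (h \<bullet> (p - y0)) * (h \<bullet> z \<sigma>)"
      if "\<sigma> \<in> star \<tau>" "p \<in> B" "n \<sigma> \<bullet> (p - y0) = 0" for \<sigma> p
    proof -
      have "p \<in> affine hull \<sigma>"
        using affine_hull_M[OF star_M[OF that(1)] n(1)[OF star_M[OF that(1)]] y0s[OF that(1)]] that(3) by blast
      moreover have "dist p y0 < e1 \<sigma>" using that(2) e(3)[OF that(1)] by (simp add: B_def dist_commute)
      ultimately show ?thesis using e1[OF that(1)] by blast
    qed
    have face: "\<tau> face_of c" if c: "c \<in> K" "p \<in> c" "p \<in> B" for c p
    proof -
      have "p \<in> ball y0 e2" using c(3) e(2) by (simp add: B_def)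
      then have "y0 \<in> c" using e2(2) c by blast
      then show ?thesis using face_of_if_rel_interior[OF Rd_K[OF \<tau>] c(1) y0] by blast
    qed
    have inC: "\<exists>\<sigma>\<in>star \<tau>. p \<in> \<sigma> \<and> n \<sigma> \<bullet> (p - y0) = 0" if p: "p \<in> C" "p \<in> B" for p
    proof -
      obtain \<sigma> where s: "\<sigma> \<in> M" "p \<in> \<sigma>" using p(1) C_eq_Union_M by blast
      then have st: "\<sigma> \<in> star \<tau>" using face[OF M_K[OF s(1)] s(2) p(2)] by (simp add: star_def)
      have "n \<sigma> \<bullet> (p - y0) = 0"
        using affine_hull_M[OF s(1) n(1)[OF s(1)] y0s[OF st]] hull_inc[OF s(2)] by blast
      then show ?thesis using st s(2) by blast
    qed
    \<comment> \<open>Off the hyperplane of \<open>h\<close> the point is not in \<tau>, and for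
      reasons of dimension no face lies strictly between \<tau> and \<sigma>.\<close>
    have relint: "p \<in> rel_interior \<sigma>" if p: "\<sigma> \<in> star \<tau>" "p \<in> \<sigma>" "p \<in> B" "h \<bullet> (p - y0) \<noteq> 0" for p \<sigma>
    proof -
      have sM: "\<sigma> \<in> M" using star_M[OF p(1)] .
      obtain c where c: "c \<in> K" "c face_of \<sigma>" "p \<in> rel_interior c" using cell_rel_interior[OF M_K[OF sM] p(2)] by blast
      have "\<tau> face_of c" using face[OF c(1) _ p(3)] c(3) rel_interior_subset by blast
      moreover have "c \<noteq> \<tau>"
      proof
        assume "c = \<tau>"
        then have "p \<in> \<tau>" "y0 \<in> \<tau>" using c(3) y0 rel_interior_subset by blast+
        then have "p \<in> affine hull \<tau>" "y0 \<in> affine hull \<tau>" by (simp_all add: hull_inc)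
        then have "p - y0 \<in> parallel_space \<tau>" using affine_hull_parallel_space by blast
        then show False using h(1) p(4) by blast
      qed
      ultimately have "aff_dim \<tau> < aff_dim c" using face_of_aff_dim_lt[OF cell(2)[OF c(1)]] by metis
      then have "\<not> aff_dim c < aff_dim \<sigma>" using aff_dim_Rd[OF \<tau>] aff_dim_M[OF sM] by linarith
      then have "c = \<sigma>" using face_of_aff_dim_lt[OF cell(2)[OF M_K[OF sM]] c(2)] by blast
      then show ?thesis using c(3) by simp
    qed
    \<comment> \<open>The values 1 and -1 of \<epsilon> select the two sides of the hyperplane of
      \<open>h\<close>.\<close>
    let ?S = "\<lambda>\<epsilon>. {\<sigma> \<in> star \<tau>. \<epsilon> * (h \<bullet> z \<sigma>) > 0}"
    let ?G = "\<lambda>y. g (comp y)"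
    let ?J = "\<lambda>\<epsilon> y. \<Sum>\<sigma>\<in>?S \<epsilon>. if n \<sigma> \<bullet> (y - y0) > 0 then w \<sigma> *\<^sub>R n \<sigma> else 0"
    \<comment> \<open>\<open>?J\<close> adds up the jumps at the cells that are below the point in
      direction \<open>u\<close>. In the half-ball on one side, \<open>?G\<close> and
      \<open>?J\<close> change by the same amount at each cell, so the difference is constant off
      \<open>C\<close>.\<close>
    have side_const: "?G a - ?J \<epsilon> a = ?G b - ?J \<epsilon> b"
      if \<epsilon>: "\<epsilon> = 1 \<or> \<epsilon> = (-1::real)" and ab: "a \<in> B" "\<epsilon> * (h \<bullet> (a - y0)) > 0" "a \<notin> C"
        "b \<in> B" "\<epsilon> * (h \<bullet> (b - y0)) > 0" "b \<notin> C" for \<epsilon> a b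
    proof -
      let ?H = "B \<inter> {y. (\<epsilon> *\<^sub>R h) \<bullet> y > (\<epsilon> *\<^sub>R h) \<bullet> y0}"
      have Hiff: "y \<in> ?H \<longleftrightarrow> y \<in> B \<and> \<epsilon> * (h \<bullet> (y - y0)) > 0" for y by (auto simp: inner_diff_right right_diff_distrib)
      have conn: "connected ?H" unfolding B_def by (intro convex_connected convex_Int convex_ball convex_halfspace_gt)
      have opH: "open ?H" unfolding B_def by (intro open_Int open_ball open_halfspace_gt)
      show ?thesis
      proof (rule locally_constant_imp_constant[OF conn opH, where P = "\<lambda>x. x \<notin> C" and f = "\<lambda>y. ?G y - ?J \<epsilon> y"])
        show "a \<in> ?H" "b \<in> ?H" using Hiff ab by blast+
        show "a \<notin> C" "b \<notin> C" by fact+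
        show "\<exists>z\<in>V. z \<notin> C" if "open V" "V \<noteq> {}" for V using open_avoids_C[OF that] by blast
        show "\<exists>q. eventually (\<lambda>y. y \<notin> C \<longrightarrow> ?G y - ?J \<epsilon> y = q) (nhds x)" if x: "x \<in> ?H" for x
        proof -
          have xB: "x \<in> B" "\<epsilon> * (h \<bullet> (x - y0)) > 0" using x Hiff by blast+
          have hx: "h \<bullet> (x - y0) \<noteq> 0" using xB(2) by auto
          \<comment> \<open>On its own side a cell fills its hyperplane within the half-ball, so a
            summand of \<open>?J\<close> can change only on the cell itself.\<close>
          have onS: "x \<in> \<sigma>" if "\<sigma> \<in> ?S \<epsilon>" "n \<sigma> \<bullet> (x - y0) = 0" for \<sigma>
          proof -
            have "(\<epsilon> * (h \<bullet> (x - y0))) * (\<epsilon> * (h \<bullet> z \<sigma>)) > 0" using xB(2) that(1) by simp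
            then have "0 \<le> (h \<bullet> (x - y0)) * (h \<bullet> z \<sigma>)" using \<epsilon> by auto
            then show ?thesis using half[of \<sigma> x] that xB(1) by blast
          qed
          show ?thesis
          proof (cases "x \<in> C")
            case False
            have "eventually (\<lambda>y. \<forall>\<sigma>\<in>?S \<epsilon>. n \<sigma> \<bullet> (y - y0) > 0 \<longleftrightarrow> n \<sigma> \<bullet> (x - y0) > 0) (nhds x)"
            proof (intro eventually_ball_finite ballI eventually_nhds_inner_sign)
              show "n \<sigma> \<bullet> (x - y0) \<noteq> 0" if "\<sigma> \<in> ?S \<epsilon>" for \<sigma>
                using onS[OF that] False M_K star_M that by blast
            qed simp
            with comp_near_complement[OF False] have "eventually (\<lambda>y. ?G y - ?J \<epsilon> y = ?G x - ?J \<epsilon> x) (nhds x)"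
            proof eventually_elim
              case (elim y)
              have "?J \<epsilon> y = ?J \<epsilon> x" using elim(2) by (intro sum.cong) auto
              then show ?case using elim(1) by simp
            qed
            then have "eventually (\<lambda>y. y \<notin> C \<longrightarrow> ?G y - ?J \<epsilon> y = ?G x - ?J \<epsilon> x) (nhds x)"
              by (rule eventually_mono) simp
            then show ?thesis by blast
          next
            case True
            obtain \<sigma> where s: "\<sigma> \<in> star \<tau>" "x \<in> \<sigma>" "n \<sigma> \<bullet> (x - y0) = 0" using inC[OF True xB(1)] by blast
            have sM: "\<sigma> \<in> M" using star_M[OF s(1)] .
            have rel: "x \<in> rel_interior \<sigma>" using relint[OF s(1,2) xB(1) hx] .
            have "0 \<le> (h \<bullet> (x - y0)) * (h \<bullet> z \<sigma>)" using half[OF s(1) xB(1) s(3)] s(2) by blast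
            then have "0 < (h \<bullet> (x - y0)) * (h \<bullet> z \<sigma>)" using hx h(3)[OF s(1)] by (simp add: order_less_le)
            then have "0 < \<epsilon> * (h \<bullet> z \<sigma>)" using xB(2) \<epsilon> by (auto simp: zero_less_mult_iff)
            then have sS: "\<sigma> \<in> ?S \<epsilon>" using s(1) by simp
            have "eventually (\<lambda>y. \<forall>\<sigma>'\<in>?S \<epsilon> - {\<sigma>}. n \<sigma>' \<bullet> (y - y0) > 0 \<longleftrightarrow> n \<sigma>' \<bullet> (x - y0) > 0) (nhds x)"
            proof (intro eventually_ball_finite ballI eventually_nhds_inner_sign)
              fix \<sigma>' assume s': "\<sigma>' \<in> ?S \<epsilon> - {\<sigma>}"
              show "n \<sigma>' \<bullet> (x - y0) \<noteq> 0"
              proof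
                assume "n \<sigma>' \<bullet> (x - y0) = 0"
                then have "x \<in> \<sigma>'" using onS s' by blast
                then have "\<sigma>' = \<sigma>" using max_cell_unique[OF sM rel, of \<sigma>'] s' M_K star_M by blast
                then show False using s' by blast
              qed
            qed simp
            with comp_near_side[OF sM n(1)[OF sM] rel]
            have "eventually (\<lambda>y. y \<notin> C \<longrightarrow> ?G y - ?J \<epsilon> y = g (side \<sigma> (- n \<sigma>)) -
                (\<Sum>\<sigma>'\<in>?S \<epsilon> - {\<sigma>}. if n \<sigma>' \<bullet> (x - y0) > 0 then w \<sigma>' *\<^sub>R n \<sigma>' else 0)) (nhds x)"
            proof eventually_elim
              case (elim y)
              show ?case
              proof
                assume yC: "y \<notin> C"
                have "?J \<epsilon> y = (if n \<sigma> \<bullet> (y - y0) > 0 then w \<sigma> *\<^sub>R n \<sigma> else 0) +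
                   (\<Sum>\<sigma>'\<in>?S \<epsilon> - {\<sigma>}. if n \<sigma>' \<bullet> (y - y0) > 0 then w \<sigma>' *\<^sub>R n \<sigma>' else 0)"
                  by (rule sum.remove) (use sS in auto)
                also have "(\<Sum>\<sigma>'\<in>?S \<epsilon> - {\<sigma>}. if n \<sigma>' \<bullet> (y - y0) > 0 then w \<sigma>' *\<^sub>R n \<sigma>' else 0) =
                   (\<Sum>\<sigma>'\<in>?S \<epsilon> - {\<sigma>}. if n \<sigma>' \<bullet> (x - y0) > 0 then w \<sigma>' *\<^sub>R n \<sigma>' else 0)"
                  using elim(2) by (intro sum.cong) auto
                finally have J: "?J \<epsilon> y = (if n \<sigma> \<bullet> (y - y0) > 0 then w \<sigma> *\<^sub>R n \<sigma> else 0) +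
                   (\<Sum>\<sigma>'\<in>?S \<epsilon> - {\<sigma>}. if n \<sigma>' \<bullet> (x - y0) > 0 then w \<sigma>' *\<^sub>R n \<sigma>' else 0)" .
                have eq: "n \<sigma> \<bullet> (y - y0) = n \<sigma> \<bullet> (y - x)" using s(3) by (simp add: inner_diff_right)
                have jm: "g (side \<sigma> (n \<sigma>)) = g (side \<sigma> (- n \<sigma>)) + w \<sigma> *\<^sub>R n \<sigma>"
                  using jump[OF sM] by (simp add: diff_eq_eq add.commute)
                from elim(1) yC have "(n \<sigma> \<bullet> (y - x) > 0 \<and> comp y = side \<sigma> (n \<sigma>)) \<or>
                  (n \<sigma> \<bullet> (y - x) < 0 \<and> comp y = side \<sigma> (- n \<sigma>))" by blast
                then show "?G y - ?J \<epsilon> y = g (side \<sigma> (- n \<sigma>)) -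
                  (\<Sum>\<sigma>'\<in>?S \<epsilon> - {\<sigma>}. if n \<sigma>' \<bullet> (x - y0) > 0 then w \<sigma>' *\<^sub>R n \<sigma>' else 0)"
                  unfolding J eq using jm by auto
              qed
            qed
            then show ?thesis by blast
          qed
        qed
      qed
    qed
    have h0: "h \<bullet> h > 0"
    proof -
      obtain \<sigma> where "\<sigma> \<in> star \<tau>" using star_nonempty[OF \<tau>] by blast
      then have "h \<noteq> 0" using h(3) by fastforce
      then show ?thesis by simp
    qed
    \<comment> \<open>For \<open>\<kappa> = 1\<close> the point
      \<open>y0 + \<delta> *\<^sub>R u\<close> is above all cells of the star, for
      \<open>\<kappa> = -1\<close> below all of them. A small ball around it misses \<open>C\<close>
      and reaches both sides of the hyperplane of \<open>h\<close>, so \<open>a\<close> and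
      \<open>b\<close> share a component.\<close>
    have key: "\<exists>a b. a \<in> B \<and> h \<bullet> (a - y0) > 0 \<and> a \<notin> C \<and> b \<in> B \<and> h \<bullet> (b - y0) < 0 \<and> b \<notin> C \<and>
        comp a = comp b \<and> (\<forall>\<sigma>\<in>star \<tau>. \<kappa> * (n \<sigma> \<bullet> (a - y0)) > 0 \<and> \<kappa> * (n \<sigma> \<bullet> (b - y0)) > 0)"
      if \<kappa>: "\<kappa> = 1 \<or> \<kappa> = (-1::real)" for \<kappa>
    proof -
      obtain d where d: "d > 0" "norm (d *\<^sub>R u) < e" using exists_small_scale[OF e(1)] by blast
      define \<delta> where "\<delta> = \<kappa> * d"
      let ?c = "y0 + \<delta> *\<^sub>R u"
      have cB: "?c \<in> B" using d \<kappa> by (auto simp: B_def dist_norm \<delta>_def)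
      let ?O = "B \<inter> (\<Inter>\<sigma>\<in>star \<tau>. {y. \<kappa> * (n \<sigma> \<bullet> (y - y0)) > 0})"
      have "open ?O" unfolding B_def
        by (intro open_Int open_ball open_INT open_Collect_less continuous_intros ballI finite_star)
      moreover have "?c \<in> ?O"
      proof -
        have "\<kappa> * (n \<sigma> \<bullet> (?c - y0)) > 0" if "\<sigma> \<in> star \<tau>" for \<sigma>
          using \<kappa> d(1) n(2)[OF star_M[OF that]] by (auto simp: \<delta>_def)
        then show ?thesis using cB by blast
      qed
      ultimately obtain \<rho> where \<rho>: "\<rho> > 0" "ball ?c \<rho> \<subseteq> ?O" by (rule openE)
      have OC: "?O \<inter> C = {}"
      proof (rule ccontr)
        assume "?O \<inter> C \<noteq> {}"
        then obtain p where p: "p \<in> C" "p \<in> B" "\<And>\<sigma>. \<sigma> \<in> star \<tau> \<Longrightarrow> \<kappa> * (n \<sigma> \<bullet> (p - y0)) > 0" by blast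
        obtain \<sigma> where "\<sigma> \<in> star \<tau>" "n \<sigma> \<bullet> (p - y0) = 0" using inC[OF p(1,2)] by blast
        then show False using p(3)[of \<sigma>] by simp
      qed
      have "ball ?c \<rho> \<subseteq> - C" using \<rho>(2) OC by blast
      then obtain U where U: "U \<in> components (- C)" "ball ?c \<rho> \<subseteq> U"
        using exists_component_superset[of "ball ?c \<rho>" "- C"] \<rho>(1) by (metis centre_in_ball connected_ball empty_iff subsetD)
      obtain s where s: "s > 0" "norm (s *\<^sub>R h) < \<rho>" using exists_small_scale[OF \<rho>(1)] by blast
      let ?a = "?c + s *\<^sub>R h" and ?b = "?c - s *\<^sub>R h"
      have ab: "?a \<in> ball ?c \<rho>" "?b \<in> ball ?c \<rho>" using s(2) by (simp_all add: dist_norm)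
      have "s * (h \<bullet> h) > 0" using s(1) h0 by simp
      then have hab: "h \<bullet> (?a - y0) > 0" "h \<bullet> (?b - y0) < 0"
        using h(2) by (simp_all add: inner_diff_right inner_add_right)
      note O' = subsetD[OF \<rho>(2) ab(1)] subsetD[OF \<rho>(2) ab(2)]
      have B: "?a \<in> B" "?b \<in> B" using O' by (simp_all only: Int_iff)
      have nab: "\<kappa> * (n \<sigma> \<bullet> (?a - y0)) > 0" "\<kappa> * (n \<sigma> \<bullet> (?b - y0)) > 0" if "\<sigma> \<in> star \<tau>" for \<sigma>
        using O' that by blast+
      have "comp ?a = comp ?b" using comp_eq[OF U(1)] U(2) ab by (metis subsetD)
      moreover have "?a \<notin> C" "?b \<notin> C" using \<open>ball ?c \<rho> \<subseteq> - C\<close> ab by blast+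
      ultimately show ?thesis using B hab
        by (intro exI[of _ ?a] exI[of _ ?b] conjI ballI nab)
    qed
    obtain a1 b1 where p1: "a1 \<in> B" "h \<bullet> (a1 - y0) > 0" "a1 \<notin> C" "b1 \<in> B" "h \<bullet> (b1 - y0) < 0" "b1 \<notin> C"
      "comp a1 = comp b1" "\<forall>\<sigma>\<in>star \<tau>. n \<sigma> \<bullet> (a1 - y0) > 0 \<and> n \<sigma> \<bullet> (b1 - y0) > 0"
      using key[of 1] by auto
    obtain a2 b2 where p2: "a2 \<in> B" "h \<bullet> (a2 - y0) > 0" "a2 \<notin> C" "b2 \<in> B" "h \<bullet> (b2 - y0) < 0" "b2 \<notin> C"
      "comp a2 = comp b2" "\<forall>\<sigma>\<in>star \<tau>. n \<sigma> \<bullet> (a2 - y0) < 0 \<and> n \<sigma> \<bullet> (b2 - y0) < 0"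
      using key[of "- 1"] by auto
    have J1: "?J \<epsilon> y = (\<Sum>\<sigma>\<in>?S \<epsilon>. w \<sigma> *\<^sub>R n \<sigma>)" if "\<forall>\<sigma>\<in>star \<tau>. n \<sigma> \<bullet> (y - y0) > 0" for \<epsilon> y
      using that by (intro sum.cong) auto
    have J2: "?J \<epsilon> y = 0" if "\<forall>\<sigma>\<in>star \<tau>. n \<sigma> \<bullet> (y - y0) < 0" for \<epsilon> y
      using that by (intro sum.neutral) (auto simp: not_less less_imp_le)
    have "?G a1 - ?J 1 a1 = ?G a2 - ?J 1 a2" by (rule side_const) (use p1 p2 in auto)
    moreover have "?G b1 - ?J (- 1) b1 = ?G b2 - ?J (- 1) b2" by (rule side_const) (use p1 p2 in auto)
    moreover have "?J 1 a1 = (\<Sum>\<sigma>\<in>?S 1. w \<sigma> *\<^sub>R n \<sigma>)" "?J (- 1) b1 = (\<Sum>\<sigma>\<in>?S (- 1). w \<sigma> *\<^sub>R n \<sigma>)"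
      "?J 1 a2 = 0" "?J (- 1) b2 = 0"
      using J1[of a1 1] J1[of b1 "- 1"] J2[of a2 1] J2[of b2 "- 1"] p1(8) p2(8) by blast+
    ultimately have "?G a1 - (\<Sum>\<sigma>\<in>?S 1. w \<sigma> *\<^sub>R n \<sigma>) = ?G a2" "?G a1 - (\<Sum>\<sigma>\<in>?S (- 1). w \<sigma> *\<^sub>R n \<sigma>) = ?G a2"
      using p1(7) p2(7) by simp_all
    then have "(\<Sum>\<sigma>\<in>?S 1. w \<sigma> *\<^sub>R n \<sigma>) = (\<Sum>\<sigma>\<in>?S (- 1). w \<sigma> *\<^sub>R n \<sigma>)"
      by (rule diff_left_imp_eq[OF trans[OF _ sym]])
    then show ?thesis using bal[of w] by (simp add: n_def)
  qed (use z Y Yu star_M in auto)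
qed

end

section \<open>Subvarieties cut out by a parallel framework\<close>

context balanced_complex
begin

text \<open>The faces of the cells with positive \<open>w\<close> form a subcomplex. The cells left
  out have coefficient zero, so the sums at its ridges are those of
  \<open>jumps_balanced_at_ridge\<close>, with lattice normals inherited from \<open>K\<close>.
  Multiplication by a common denominator gives integer weights.\<close>

lemma tropical_positive_part:
  fixes g :: "(real ^ 'n) set \<Rightarrow> real ^ 'n"
  assumes Y: "\<And>\<sigma>. \<sigma> \<in> M \<Longrightarrow> primitive_normal (Y \<sigma>) \<sigma>"
    and g: "\<And>\<sigma>. \<sigma> \<in> M \<Longrightarrow> g (side \<sigma> (Y \<sigma>)) - g (side \<sigma> (- Y \<sigma>)) = w \<sigma> *\<^sub>R Y \<sigma>"
    and w: "\<And>\<sigma>. \<sigma> \<in> M \<Longrightarrow> w \<sigma> \<in> \<rat>" "\<And>\<sigma>. \<sigma> \<in> M \<Longrightarrow> w \<sigma> \<ge> 0"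
    and s0: "\<rho> \<in> M" "w \<rho> > 0"
  shows "tropical_variety (CARD('n) - 1) (\<Union>{\<sigma> \<in> M. w \<sigma> > 0})"
proof -
  let ?k = "CARD('n) - 1"
  obtain N where N: "N > 0" "\<forall>\<sigma>\<in>M. real N * w \<sigma> \<in> \<int>" using common_denominator[of M w] w(1) by auto
  define \<omega>1 where "\<omega>1 = (\<lambda>\<sigma>. nat \<lfloor>real N * w \<sigma>\<rfloor>)"
  have \<omega>1: "real (\<omega>1 \<sigma>) = real N * w \<sigma>" if "\<sigma> \<in> M" for \<sigma>
  proof -
    obtain i where i: "real N * w \<sigma> = of_int i" using N(2) \<open>\<sigma> \<in> M\<close> Ints_cases by metis
    have "real N * w \<sigma> \<ge> 0" using w(2)[OF that] by simp
    then show ?thesis using i by (simp add: \<omega>1_def)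
  qed
  define K1 where "K1 = {c \<in> K. \<exists>\<sigma>\<in>M. w \<sigma> > 0 \<and> c face_of \<sigma>}"
  have refl: "\<sigma> face_of \<sigma>" if "\<sigma> \<in> M" for \<sigma> using cell(2)[OF M_K[OF that]] by (rule face_of_refl)
  have inK1: "\<sigma> \<in> K1" if "\<sigma> \<in> M" "w \<sigma> > 0" for \<sigma> using that refl M_K by (auto simp: K1_def)
  have max: "max_cells ?k K1 = {\<sigma> \<in> M. w \<sigma> > 0}"
  proof
    show "{\<sigma> \<in> M. w \<sigma> > 0} \<subseteq> max_cells ?k K1"
      using inK1 by (auto simp: max_cells_def aff_dim_M int_card_pred)
    show "max_cells ?k K1 \<subseteq> {\<sigma> \<in> M. w \<sigma> > 0}"
    proof
      fix c assume c: "c \<in> max_cells ?k K1"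
      then obtain \<sigma> where s: "\<sigma> \<in> M" "w \<sigma> > 0" "c face_of \<sigma>" by (auto simp: max_cells_def K1_def)
      have "aff_dim c = aff_dim \<sigma>" using c aff_dim_M[OF s(1)] by (simp add: max_cells_def int_card_pred)
      then have "c = \<sigma>" using face_of_aff_dim_lt[OF cell(2)[OF M_K[OF s(1)]] s(3)] by force
      then show "c \<in> {\<sigma> \<in> M. w \<sigma> > 0}" using s by simp
    qed
  qed
  have K1K: "K1 \<subseteq> K" by (auto simp: K1_def)
  have rid: "ridges ?k K1 \<subseteq> Rd" using K1K by (auto simp: ridges_def Rd_def)
  have "polyhedral_complex K1"
    unfolding polyhedral_complex_def
  proof (intro conjI ballI allI impI)
    show "finite K1" using K1K finite_K finite_subset by blast
    show "K1 \<noteq> {}" using inK1[OF s0] by blast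
    show "polyhedron c" "c \<noteq> {}" if "c \<in> K1" for c using cell that K1K by blast+
    show "f \<in> K1" if "c \<in> K1" "f face_of c \<and> f \<noteq> {}" for c f
      using that face_in_K unfolding K1_def by (blast intro: face_of_trans)
    show "c \<inter> c' face_of c" "c \<inter> c' face_of c'" if "c \<in> K1" "c' \<in> K1" for c c'
      using polyhedral_complex that K1K unfolding polyhedral_complex_def by blast+
  qed
  moreover have "has_complex_dim K1 ?k"
    unfolding has_complex_dim_def using inK1[OF s0] aff_dim_M[OF s0(1)] aff_dim_K K1K
    by (auto simp: int_card_pred intro!: bexI[of _ \<rho>])
  moreover have "pure_complex ?k K1"
    unfolding pure_complex_def max by (auto simp: K1_def)
  moreover have "rational_complex ?k K1"
    using rational rid unfolding rational_complex_def max M_def Rd_def by blast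
  moreover have "\<Union>K1 = \<Union>{\<sigma> \<in> M. w \<sigma> > 0}"
    using inK1 face_of_imp_subset unfolding K1_def by blast
  moreover have "balanced_weighting ?k K1 \<omega>1"
    unfolding balanced_weighting_def max
  proof (intro conjI ballI)
    fix \<sigma> assume "\<sigma> \<in> {\<sigma> \<in> M. w \<sigma> > 0}"
    then have "real (\<omega>1 \<sigma>) > 0" using \<omega>1 N(1) by simp
    then show "\<omega>1 \<sigma> > 0" by simp
  next
    fix \<tau> assume "\<tau> \<in> ridges ?k K1"
    then have t: "\<tau> \<in> Rd" using rid by blast
    obtain z where z: "\<And>\<sigma>. \<sigma> \<in> star \<tau> \<Longrightarrow> lattice_normal \<tau> \<sigma> (z \<sigma>)" using ridge_lattice_normals[OF t] by blast
    have "(\<Sum>\<sigma> | \<sigma> \<in> {\<sigma> \<in> M. w \<sigma> > 0} \<and> \<tau> face_of \<sigma>. real (\<omega>1 \<sigma>) *\<^sub>R z \<sigma>) = (\<Sum>\<sigma>\<in>star \<tau>. real (\<omega>1 \<sigma>) *\<^sub>R z \<sigma>)"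
    proof (rule sum.mono_neutral_left)
      show "\<forall>\<sigma>\<in>star \<tau> - {\<sigma>. \<sigma> \<in> {\<sigma> \<in> M. w \<sigma> > 0} \<and> \<tau> face_of \<sigma>}. real (\<omega>1 \<sigma>) *\<^sub>R z \<sigma> = 0"
      proof
        fix \<sigma> assume s: "\<sigma> \<in> star \<tau> - {\<sigma>. \<sigma> \<in> {\<sigma> \<in> M. w \<sigma> > 0} \<and> \<tau> face_of \<sigma>}"
        then have "\<sigma> \<in> M" "\<not> w \<sigma> > 0" by (auto simp: star_def)
        then show "real (\<omega>1 \<sigma>) *\<^sub>R z \<sigma> = 0" using \<omega>1[of \<sigma>] w(2)[of \<sigma>] by simp
      qed
    qed (auto simp: star_def)
    also have "\<dots> = real N *\<^sub>R (\<Sum>\<sigma>\<in>star \<tau>. w \<sigma> *\<^sub>R z \<sigma>)"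
      unfolding scaleR_sum_right using \<omega>1 star_M by (intro sum.cong) auto
    also have "\<dots> \<in> parallel_space \<tau>"
      using jumps_balanced_at_ridge[OF Y g t z] by (intro subspace_scale) auto
    finally have "(\<Sum>\<sigma> | \<sigma> \<in> {\<sigma> \<in> M. w \<sigma> > 0} \<and> \<tau> face_of \<sigma>. real (\<omega>1 \<sigma>) *\<^sub>R z \<sigma>) \<in> parallel_space \<tau>" .
    then show "\<exists>z. (\<forall>\<sigma>\<in>{\<sigma> \<in> M. w \<sigma> > 0}. \<tau> face_of \<sigma> \<longrightarrow> lattice_normal \<tau> \<sigma> (z \<sigma>)) \<and>
        (\<Sum>\<sigma> | \<sigma> \<in> {\<sigma> \<in> M. w \<sigma> > 0} \<and> \<tau> face_of \<sigma>. real (\<omega>1 \<sigma>) *\<^sub>R z \<sigma>) \<in> parallel_space \<tau>"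
      using z by (intro exI[of _ z]) (auto simp: star_def)
  qed
  ultimately show ?thesis unfolding tropical_variety_def by blast
qed

text \<open>Ratios are attached to maximal cells rather than to edges, because both the construction
  of subvarieties and the connectedness argument are stated for cells.\<close>

lemma extremal_imp_rigid:
  assumes rd: "reciprocal_diagram C p" and ext: "extremal C"
  shows "direction_rigid (regions C) (dual_edges C) p"
  unfolding direction_rigid_def
proof (intro allI impI)
  fix q assume par: "parallel_frameworks (dual_edges C) q p"
  have "\<exists>x r l. primitive_normal x \<sigma> \<and> r \<in> \<rat> \<and> r > 0 \<and>
      p (closure (side \<sigma> x)) - p (closure (side \<sigma> (- x))) = r *\<^sub>R x \<and>
      q (closure (side \<sigma> x)) - q (closure (side \<sigma> (- x))) = (l * r) *\<^sub>R x" if s: "\<sigma> \<in> M" for \<sigma>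
  proof -
    let ?v = "closure (side \<sigma> (X \<sigma>))" and ?w = "closure (side \<sigma> (- X \<sigma>))"
    have edge: "{?v, ?w} \<in> dual_edges C" using cell_sides_edge(1)[OF s normal_X[OF s]] .
    obtain x r where xr: "crossing_vector ?v ?w x" "r \<in> \<rat>" "r > 0" "p ?v - p ?w = r *\<^sub>R x"
      using rd edge unfolding reciprocal_diagram_def by blast
    obtain l where l: "q ?v - q ?w = l *\<^sub>R (p ?v - p ?w)" using par edge unfolding parallel_frameworks_def by blast
    note cv = crossing_vector_side[OF s normal_X[OF s] xr(1)]
    have "q ?v - q ?w = (l * r) *\<^sub>R x" using l xr(4) by simp
    then show ?thesis using cv xr(2-4) by metis
  qed
  then obtain Y r l where Yrl: "\<And>\<sigma>. \<sigma> \<in> M \<Longrightarrow> primitive_normal (Y \<sigma>) \<sigma> \<and> r \<sigma> \<in> \<rat> \<and> r \<sigma> > 0 \<and>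
      p (closure (side \<sigma> (Y \<sigma>))) - p (closure (side \<sigma> (- Y \<sigma>))) = r \<sigma> *\<^sub>R Y \<sigma> \<and>
      q (closure (side \<sigma> (Y \<sigma>))) - q (closure (side \<sigma> (- Y \<sigma>))) = (l \<sigma> * r \<sigma>) *\<^sub>R Y \<sigma>" by metis
  have Y: "primitive_normal (Y \<sigma>) \<sigma>" and r: "r \<sigma> \<in> \<rat>" "r \<sigma> > 0"
    and pj: "p (closure (side \<sigma> (Y \<sigma>))) - p (closure (side \<sigma> (- Y \<sigma>))) = r \<sigma> *\<^sub>R Y \<sigma>"
    and qj: "q (closure (side \<sigma> (Y \<sigma>))) - q (closure (side \<sigma> (- Y \<sigma>))) = (l \<sigma> * r \<sigma>) *\<^sub>R Y \<sigma>"
    if "\<sigma> \<in> M" for \<sigma> using Yrl[OF that] by blast+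
  have "l \<sigma>1 = l \<sigma>2" if s12: "\<sigma>1 \<in> M" "\<sigma>2 \<in> M" for \<sigma>1 \<sigma>2
  proof (rule ccontr)
    assume "l \<sigma>1 \<noteq> l \<sigma>2"
    then have "l \<sigma>1 - l \<sigma>2 \<noteq> 0" by simp
    then obtain \<phi> where \<phi>: "\<And>x y. \<phi> (x + y) = \<phi> x + \<phi> y" "\<And>r x. r \<in> \<rat> \<Longrightarrow> \<phi> (r * x) = r * \<phi> x"
      "\<And>x. \<phi> x \<in> \<rat>" "\<phi> (l \<sigma>1 - l \<sigma>2) \<noteq> 0" using rational_linear_functional by blast
    have \<phi>diff: "\<phi> (x - y) = \<phi> x - \<phi> y" for x y using \<phi>(1)[of "x - y" y] by simp
    define \<mu> where "\<mu> = (\<lambda>\<sigma>. \<phi> (l \<sigma>))"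
    \<comment> \<open>Applying \<phi> coordinatewise preserves parallelism because
      \<open>r \<sigma>\<close> and the coordinates of \<open>Y \<sigma>\<close> are rational. The
      ratios become the rational numbers \<open>\<mu> \<sigma>\<close>, and \<phi> was chosen so
      that they still differ at \<open>\<sigma>1\<close> and \<open>\<sigma>2\<close>.\<close>
    define q' :: "(real ^ 'n) set \<Rightarrow> real ^ 'n" where "q' = (\<lambda>v. \<chi> i. \<phi> (q v $ i))"
    have q'j: "q' (closure (side \<sigma> (Y \<sigma>))) - q' (closure (side \<sigma> (- Y \<sigma>))) = (\<mu> \<sigma> * r \<sigma>) *\<^sub>R Y \<sigma>" if s: "\<sigma> \<in> M" for \<sigma>
    proof -
      have "\<phi> (q (closure (side \<sigma> (Y \<sigma>))) $ i) - \<phi> (q (closure (side \<sigma> (- Y \<sigma>))) $ i) = \<mu> \<sigma> * r \<sigma> * Y \<sigma> $ i" for i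
      proof -
        have "Y \<sigma> $ i \<in> \<rat>"
          using primitive_normal_integer[OF Y[OF s]] Ints_subset_Rats by (auto simp: integer_points_def)
        then have rY: "r \<sigma> * Y \<sigma> $ i \<in> \<rat>" using r(1)[OF s] by simp
        have "\<phi> (q (closure (side \<sigma> (Y \<sigma>))) $ i) - \<phi> (q (closure (side \<sigma> (- Y \<sigma>))) $ i) =
           \<phi> ((q (closure (side \<sigma> (Y \<sigma>))) - q (closure (side \<sigma> (- Y \<sigma>)))) $ i)" by (simp add: \<phi>diff)
        also have "\<dots> = \<phi> ((r \<sigma> * Y \<sigma> $ i) * l \<sigma>)" unfolding qj[OF s] by (simp add: mult.commute mult.left_commute)
        also have "\<dots> = \<mu> \<sigma> * r \<sigma> * Y \<sigma> $ i" using \<phi>(2)[OF rY] by (simp add: \<mu>_def)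
        finally show ?thesis .
      qed
      then show ?thesis by (simp add: vec_eq_iff q'_def)
    qed
    define a b where "a = Min (\<mu> ` M)" and "b = Max (\<mu> ` M)"
    have fin: "finite (\<mu> ` M)" "\<mu> ` M \<noteq> {}" using M_nonempty by auto
    have bounds: "a \<le> \<mu> \<sigma>" "\<mu> \<sigma> \<le> b" if "\<sigma> \<in> M" for \<sigma> using that by (auto simp: a_def b_def)
    obtain \<sigma>a \<sigma>b where sab: "\<sigma>a \<in> M" "\<mu> \<sigma>a = a" "\<sigma>b \<in> M" "\<mu> \<sigma>b = b"
      using Min_in[OF fin] Max_in[OF fin] by (auto simp: a_def b_def)
    have "\<mu> \<sigma>1 \<noteq> \<mu> \<sigma>2" using \<phi>(4) \<phi>diff by (simp add: \<mu>_def)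
    then have "a < b" using bounds[OF s12(1)] bounds[OF s12(2)] by linarith
    have rat: "\<mu> \<sigma> \<in> \<rat>" "a \<in> \<rat>" "b \<in> \<rat>" for \<sigma> using \<phi>(3) sab(2,4) by (auto simp: \<mu>_def)
    \<comment> \<open>Applied with \<open>c = 1\<close>, \<open>t = a\<close> and with
      \<open>c = - 1\<close>, \<open>t = b\<close>: subtracting \<open>t\<close> times
      \<open>p\<close> collapses the cells of extremal ratio, and \<open>c\<close> makes the
      remaining jumps positive.\<close>
    have part: "tropical_variety (CARD('n) - 1) (\<Union>{\<sigma> \<in> M. c * (\<mu> \<sigma> - t) * r \<sigma> > 0})"
      if c: "c \<in> \<rat>" "t \<in> \<rat>" "\<And>\<sigma>. \<sigma> \<in> M \<Longrightarrow> c * (\<mu> \<sigma> - t) \<ge> 0" "\<rho> \<in> M" "c * (\<mu> \<rho> - t) > 0" for c t \<rho>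
    proof (rule tropical_positive_part[where Y = Y and \<rho> = \<rho>])
      let ?g = "\<lambda>U. c *\<^sub>R (q' (closure U) - t *\<^sub>R p (closure U))"
      fix \<sigma> assume s: "\<sigma> \<in> M"
      show "primitive_normal (Y \<sigma>) \<sigma>" using Y[OF s] .
      have "?g (side \<sigma> (Y \<sigma>)) - ?g (side \<sigma> (- Y \<sigma>)) =
         c *\<^sub>R ((q' (closure (side \<sigma> (Y \<sigma>))) - q' (closure (side \<sigma> (- Y \<sigma>)))) -
         t *\<^sub>R (p (closure (side \<sigma> (Y \<sigma>))) - p (closure (side \<sigma> (- Y \<sigma>)))))"
        by (simp add: scaleR_diff_right)
      also have "\<dots> = (c * (\<mu> \<sigma> - t) * r \<sigma>) *\<^sub>R Y \<sigma>"
        unfolding q'j[OF s] pj[OF s] by (simp add: algebra_simps)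
      finally show "?g (side \<sigma> (Y \<sigma>)) - ?g (side \<sigma> (- Y \<sigma>)) = (c * (\<mu> \<sigma> - t) * r \<sigma>) *\<^sub>R Y \<sigma>" .
      show "c * (\<mu> \<sigma> - t) * r \<sigma> \<in> \<rat>" using rat(1) c(1,2) r(1)[OF s] by simp
      show "c * (\<mu> \<sigma> - t) * r \<sigma> \<ge> 0" using c(3)[OF s] r(2)[OF s] by simp
    next
      show "\<rho> \<in> M" by fact
      show "c * (\<mu> \<rho> - t) * r \<rho> > 0" using c(5) r(2)[OF c(4)] by simp
    qed
    let ?C1 = "\<Union>{\<sigma> \<in> M. 1 * (\<mu> \<sigma> - a) * r \<sigma> > 0}" and ?C2 = "\<Union>{\<sigma> \<in> M. (- 1) * (\<mu> \<sigma> - b) * r \<sigma> > 0}"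
    have t1: "tropical_variety (CARD('n) - 1) ?C1"
      by (rule part[where \<rho> = \<sigma>b]) (use rat bounds sab \<open>a < b\<close> in auto)
    have t2: "tropical_variety (CARD('n) - 1) ?C2"
      by (rule part[where \<rho> = \<sigma>a]) (use rat bounds sab \<open>a < b\<close> in auto)
    have proper: "\<Union>S \<subset> C" if S: "S \<subseteq> M" "\<sigma> \<in> M" "\<sigma> \<notin> S" for S \<sigma>
    proof -
      obtain y where y: "y \<in> rel_interior \<sigma>" using rel_interior_M_nonempty[OF S(2)] by blast
      have "y \<notin> \<Union>S" using max_cell_unique[OF S(2) y] S M_K by blast
      moreover have "y \<in> C" using y rel_interior_subset M_K[OF S(2)] by blast
      moreover have "\<Union>S \<subseteq> C" using S(1) M_K by blast
      ultimately show ?thesis by blast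
    qed
    \<comment> \<open>A cell attaining the minimum is missing from \<open>?C1\<close>, and one
      attaining the maximum from \<open>?C2\<close>.\<close>
    have "?C1 \<subset> C" by (rule proper[OF _ sab(1)]) (use sab in auto)
    moreover have "?C2 \<subset> C" by (rule proper[OF _ sab(3)]) (use sab in auto)
    moreover have "C = ?C1 \<union> ?C2"
    proof -
      have "1 * (\<mu> \<sigma> - a) * r \<sigma> > 0 \<or> (- 1) * (\<mu> \<sigma> - b) * r \<sigma> > 0" if s: "\<sigma> \<in> M" for \<sigma>
        using \<open>a < b\<close> r(2)[OF s] by (auto simp: zero_less_mult_iff)
      then have "\<Union>M \<subseteq> ?C1 \<union> ?C2" by blast
      then show ?thesis using C_eq_Union_M by blast
    qed
    ultimately show False using ext t1 t2 unfolding extremal_def by blast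
  qed
  then obtain m where m: "\<And>\<sigma>. \<sigma> \<in> M \<Longrightarrow> l \<sigma> = m" by metis
  \<comment> \<open>With a common ratio \<open>m\<close> this difference does not change across any
    cell, so connectedness of the dual graph makes it constant; the constant is the translation
    vector.\<close>
  let ?f = "\<lambda>U. q (closure U) - m *\<^sub>R p (closure U)"
  have f: "?f (side \<sigma> (Y \<sigma>)) = ?f (side \<sigma> (- Y \<sigma>))" if s: "\<sigma> \<in> M" for \<sigma>
  proof -
    have "q (closure (side \<sigma> (Y \<sigma>))) - q (closure (side \<sigma> (- Y \<sigma>))) =
       m *\<^sub>R (p (closure (side \<sigma> (Y \<sigma>))) - p (closure (side \<sigma> (- Y \<sigma>))))"
      using qj[OF s] pj[OF s] m[OF s] by simp
    then show ?thesis by (simp add: algebra_simps)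
  qed
  have "?f U = ?f W" if "U \<in> components (- C)" "W \<in> components (- C)" for U W
    by (rule equal_across_cells_imp_constant[where n = Y and f = ?f, OF _ f that])
       (use primitive_normal_is_normal[OF Y] in auto)
  then obtain z where z: "\<And>U. U \<in> components (- C) \<Longrightarrow> ?f U = z" by metis
  have "q v = m *\<^sub>R p v + z" if v: "v \<in> regions C" for v
  proof -
    obtain U where "U \<in> components (- C)" "v = closure U" using v by (auto simp: regions_def)
    then show ?thesis using z[of U] by (auto simp: algebra_simps)
  qed
  then show "\<exists>z l. \<forall>v\<in>regions C. q v = l *\<^sub>R p v + z" by blast
qed

end

theorem theorem1p1:
  fixes C :: "(real ^ 'n) set" and p :: "(real ^ 'n) set \<Rightarrow> real ^ 'n"
  assumes "tropical_hypersurface C"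
    and "reciprocal_diagram C p"
  shows "extremal C \<longleftrightarrow> direction_rigid (regions C) (dual_edges C) p"
proof
  assume ext: "extremal C"
  obtain K \<omega> where K: "balanced_complex K \<omega>" "\<Union>K = C"
    using tropical_hypersurface_complex assms(1) unfolding tropical_hypersurface_def by blast
  then show "direction_rigid (regions C) (dual_edges C) p"
    using balanced_complex.extremal_imp_rigid[OF K(1), of p] assms(2) ext by simp
next
  assume "direction_rigid (regions C) (dual_edges C) p"
  then show "extremal C" using rigid_imp_extremal assms by blast
qed

end
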